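(* Let $f\in\mathcal{C}^3(\mathbb{R})$ with $f(1)=0$ and $f'(1)<0$, put $F(\rho)=\int_\rho^1 f(r)\,dr$ and $c_s=\sqrt{-2f'(1)}$, and suppose that $\frac{c_s^2}{4}(1-\rho)^2\le F(\rho)$ for all $\rho\ge0$, and that there exist $M\ge0$, $q\in[2,+\infty)$ such that $F(\rho)\le M|1-\rho|^q$ for all $\rho\ge2$. Then: (i) $E_{\min}$ is nonnegative, even and Lipschitz continuous on $\mathbb{R}$, with $|E_{\min}(\mathfrak{p})-E_{\min}(\mathfrak{q})|\le c_s|\mathfrak{p}-\mathfrak{q}|$ for all $\mathfrak{p},\mathfrak{q}\in\mathbb{R}$. (ii) $E_{\min}$ is nondecreasing and concave on $[0,+\infty)$, and strictly increasing on $[0,\mathfrak{q}_*]$. (iii) If moreover $f''(1)+3f'(1)\neq0$, there exist positive constants $\mathfrak{q}_0,K_0,K_1,K_2$ such that $$c_s\mathfrak{q}-K_0\mathfrak{q}^{5/3}\le E_{\min}(\mathfrak{q})\le c_s\mathfrak{q}-K_1\mathfrak{q}^{5/3}+K_2\mathfrak{q}^{7/3}\quad\text{for all }\mathfrak{q}\in[0,\mathfrak{q}_0].$$ (iv) If moreover $f''(1)+3f'(1)\ne0$, then $E_{\min}$ is strictly subadditive, i.e. $E_{\min}(\mathfrak{p}+\mathfrak{q})<E_{\min}(\mathfrak{p})+E_{\min}(\mathfrak{q})$ for all $\mathfrak{p},\mathfrak{q}>0$.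
   Context: Functions on $\mathbb{R}$ are complex-valued. $E(v)=\frac12\int_{\mathbb{R}}|v'|^2+\frac12\int_{\mathbb{R}}F(|v|^2)$. $\mathcal{X}^1(\mathbb{R})=\{u\in H^1_{loc}(\mathbb{R}) : u'\in L^2(\mathbb{R}),\ F(|u|^2)\in L^1(\mathbb{R})\}$, $\mathcal{NX}^1(\mathbb{R})=\{u\in\mathcal{X}^1(\mathbb{R}) : \inf_{\mathbb{R}}|u|>0\}$. For $u=\rho e^{i\varphi}\in\mathcal{NX}^1(\mathbb{R})$ ($\rho=|u|$, $\varphi$ real-valued), $p(u)=\frac12\int_{\mathbb{R}}(1-\rho^2)\varphi'$. For $\mathfrak{p}\in\mathbb{R}$, $E_{\min}(\mathfrak{p})=\inf\{E(v): v\in\mathcal{NX}^1(\mathbb{R}),\ p(v)=\mathfrak{p}\}$. Finally $\mathfrak{q}_*=\sup\{\mathfrak{q}>0 : \forall v\in\mathcal{X}^1(\mathbb{R}),\ E(v)\le E_{\min}(\mathfrak{q})\Rightarrow\inf_{\mathbb{R}}|v|>0\}$. *)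

theory Defs
  imports "HOL-Analysis.Analysis"
begin

definition C_class :: "nat \<Rightarrow> (real \<Rightarrow> real) \<Rightarrow> bool" where
  "C_class k f \<longleftrightarrow>
     (\<forall>j<k. (deriv ^^ j) f differentiable_on UNIV) \<and> continuous_on UNIV ((deriv ^^ k) f)"

definition test_function :: "(real \<Rightarrow> real) \<Rightarrow> bool" where
  "test_function \<psi> \<longleftrightarrow> (\<forall>k. C_class k \<psi>) \<and> compact (closure {x. \<psi> x \<noteq> 0})"

definition L1_loc :: "(real \<Rightarrow> 'a::{banach, second_countable_topology}) set" where
  "L1_loc = {u \<in> borel_measurable lborel. \<forall>K. compact K \<longrightarrow> set_integrable lborel K u}"

definition L2_loc :: "(real \<Rightarrow> 'a::{banach, second_countable_topology}) set" where
  "L2_loc = {u \<in> borel_measurable lborel.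
     \<forall>K. compact K \<longrightarrow> set_integrable lborel K (\<lambda>x. (norm (u x))\<^sup>2)}"

definition has_weak_deriv ::
  "(real \<Rightarrow> 'a::{banach, second_countable_topology}) \<Rightarrow> (real \<Rightarrow> 'a) \<Rightarrow> bool" where
  "has_weak_deriv u g \<longleftrightarrow> u \<in> L1_loc \<and> g \<in> L1_loc \<and>
     (\<forall>\<psi>. test_function \<psi> \<longrightarrow>
        (LINT x|lborel. deriv \<psi> x *\<^sub>R u x) = - (LINT x|lborel. \<psi> x *\<^sub>R g x))"

text \<open>A weak derivative is unique only almost everywhere; below, the chosen representative
  occurs only under integrals.\<close>

definition weak_deriv ::
  "(real \<Rightarrow> 'a::{banach, second_countable_topology}) \<Rightarrow> real \<Rightarrow> 'a" where
  "weak_deriv u = (SOME g. has_weak_deriv u g)"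

text \<open>In one dimension every Sobolev class has exactly one continuous representative. As usual,
  elements of \<open>H\<^sup>1\<^sub>l\<^sub>o\<^sub>c\<close> are identified with it, so that pointwise
  notions such as the infimum of the modulus make sense.\<close>

definition H1_loc :: "(real \<Rightarrow> 'a::{banach, second_countable_topology}) set" where
  "H1_loc = {u. continuous_on UNIV u \<and> u \<in> L2_loc \<and> (\<exists>g \<in> L2_loc. has_weak_deriv u g)}"

text \<open>The interval integral is oriented, as needed for \<open>\<rho> > 1\<close>.\<close>

definition F_pot :: "(real \<Rightarrow> real) \<Rightarrow> real \<Rightarrow> real" where
  "F_pot f \<rho> = (LBINT r=ereal \<rho>..ereal 1. f r)"

definition sound_speed :: "(real \<Rightarrow> real) \<Rightarrow> real" where
  "sound_speed f = sqrt (- 2 * deriv f 1)"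

definition energy :: "(real \<Rightarrow> real) \<Rightarrow> (real \<Rightarrow> complex) \<Rightarrow> real" where
  "energy f v = 1/2 * (LINT x|lborel. (cmod (weak_deriv v x))\<^sup>2)
              + 1/2 * (LINT x|lborel. F_pot f ((cmod (v x))\<^sup>2))"

definition X1 :: "(real \<Rightarrow> real) \<Rightarrow> (real \<Rightarrow> complex) set" where
  "X1 f = {u \<in> H1_loc. integrable lborel (\<lambda>x. (cmod (weak_deriv u x))\<^sup>2) \<and>
                       integrable lborel (\<lambda>x. F_pot f ((cmod (u x))\<^sup>2))}"

definition NX1 :: "(real \<Rightarrow> real) \<Rightarrow> (real \<Rightarrow> complex) set" where
  "NX1 f = {u \<in> X1 f. (INF x. cmod (u x)) > 0}"

text \<open>A continuous phase of a nonvanishing continuous function; it is unique up to an additive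
  constant in \<open>2\<pi>\<int>\<close>, which does not affect its derivative.\<close>

definition phase :: "(real \<Rightarrow> complex) \<Rightarrow> real \<Rightarrow> real" where
  "phase u = (SOME \<phi>. continuous_on UNIV \<phi> \<and>
     (\<forall>x. u x = complex_of_real (cmod (u x)) * exp (\<i> * complex_of_real (\<phi> x))))"

definition momentum :: "(real \<Rightarrow> complex) \<Rightarrow> real" where
  "momentum u = 1/2 * (LINT x|lborel. (1 - (cmod (u x))\<^sup>2) * weak_deriv (phase u) x)"

definition E_min :: "(real \<Rightarrow> real) \<Rightarrow> real \<Rightarrow> real" where
  "E_min f p = Inf {energy f v | v. v \<in> NX1 f \<and> momentum v = p}"

text \<open>The supremum is taken in the extended reals, so that no finiteness is presupposed.\<close>

definition q_star :: "(real \<Rightarrow> real) \<Rightarrow> ereal" where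
  "q_star f = Sup {ereal q | q. q > 0 \<and>
     (\<forall>v \<in> X1 f. energy f v \<le> E_min f q \<longrightarrow> (INF x. cmod (v x)) > 0)}"

end

theory Submission
  imports Defs
begin

text \<open>On the line a continuous function with weak derivative \<open>g\<close> is a primitive of \<open>g\<close>, and primitives obey
  the chain rule, so a nonvanishing \<open>v = \<rho> e\<^sup>i\<^sup>\<phi>\<close> is described by \<open>\<rho>\<close>, \<open>r = \<rho>'\<close> and \<open>s = \<phi>'\<close>, with
  energy \<open>1/2 \<integral> r\<^sup>2 + \<rho>\<^sup>2 s\<^sup>2 + F(\<rho>\<^sup>2)\<close> and momentum \<open>1/2 \<integral> (1 - \<rho>\<^sup>2) s\<close>. Replacing \<open>s\<close> by \<open>l s\<close> shows that
  \<open>E_min\<close> is even, nondecreasing on \<open>[0, \<infinity>)\<close> and continuous on \<open>(0, \<infinity>)\<close>; reflecting a near-minimizer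
  across a point gives midpoint concavity.
  The long waves \<open>1 - \<rho>\<^sup>2 = \<epsilon>\<^sup>2 \<eta>(\<epsilon> x)\<close>, \<open>s = c/2 (1 - \<rho>\<^sup>2)\<close> have
  \<open>E - c p = O(\<epsilon>\<^sup>5)\<close> and \<open>p\<close> of order \<open>\<epsilon>\<^sup>3\<close>, and the \<open>\<epsilon>\<^sup>5\<close> coefficient can be made negative when
  \<open>f''(1) + 3 f'(1) \<noteq> 0\<close>. Concavity then yields the Lipschitz bound, and together with the lower bound
  of order \<open>q\<^sup>5\<^sup>/\<^sup>3\<close> it yields strict subadditivity. If \<open>E_min\<close> were constant
  beyond some \<open>a\<close> below the threshold, near-minimizers of large momentum would come arbitrarily close to
  zero, so the constant would be at least the energy of the kink \<open>v' = sqrt (F (v\<^sup>2))\<close>, which vanishes at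
  a point; this contradicts the definition of the threshold.\<close>

text \<open>Existence of minimizers is never invoked: each inequality for \<open>E_min\<close> comes
  from modifying near-minimizers, and this decides the encoding. In polar data \<open>s\<close> is
  merely measurable and the phase is recovered as a primitive, so \<open>s\<close> can be rescaled,
  or reflected without a change of sign, with no matching condition at the mirror point; the
  momentum density is then doubled instead of cancelled. Scaling controls increments only away from
  momentum 0, so concavity is obtained on (0, oo) first and extended to 0 by
  \<open>l * E_min f p <= E_min f (l * p)\<close>, which also gives subadditivity and the bound by
  \<open>c * p\<close>. The lower bound at momentum t^3 completes the square in \<open>s\<close>;
  what is lost lies where the modulus is below 1 and is paid by the gradient energy up to O(t^5).
  With W' = sqrt (F (y^2)), twice W 1 - W 0 is both the bound for the energy of the kink and the
  limiting cost of any profile that descends from modulus near 1 to almost 0 and returns.\<close>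

section \<open>Primitives of locally integrable functions\<close>

text \<open>Absolute continuity, encoded by increments with a fixed representative \<open>g\<close>.
  Unlike weak derivatives, such pairs can be added, multiplied, composed, glued and reflected
  without integrating against test functions.\<close>

definition primitive :: "(real \<Rightarrow> 'a::euclidean_space) \<Rightarrow> (real \<Rightarrow> 'a) \<Rightarrow> bool" where
  "primitive u g \<longleftrightarrow> g \<in> L1_loc \<and> (\<forall>a b. a \<le> b \<longrightarrow> (g has_integral (u b - u a)) {a..b})"

lemma L1_locD: "g \<in> L1_loc \<Longrightarrow> g \<in> borel_measurable borel"
  "g \<in> L1_loc \<Longrightarrow> set_integrable lborel {a..b} g"
  by (auto simp: L1_loc_def)

lemma L1_locI:
  fixes g :: "real \<Rightarrow> 'a::euclidean_space"
  assumes "g \<in> borel_measurable borel" "\<And>a b. set_integrable lborel {a..b} g"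
  shows "g \<in> L1_loc"
  unfolding L1_loc_def
proof (intro CollectI conjI allI impI)
  fix K :: "real set" assume K: "compact K"
  then obtain B where B: "\<And>x. x \<in> K \<Longrightarrow> norm x \<le> B"
    using compact_imp_bounded bounded_iff by metis
  show "set_integrable lborel K g"
    by (rule set_integrable_subset[OF assms(2)[of "-B" B]])
      (use B K in \<open>force simp: abs_le_iff compact_imp_closed\<close>)+
qed (use assms in auto)

lemma L1_loc_dominated:
  fixes g :: "real \<Rightarrow> 'a::euclidean_space" and k :: "real \<Rightarrow> 'b::euclidean_space"
  assumes "k \<in> L1_loc" "g \<in> borel_measurable borel" "\<And>x. norm (g x) \<le> norm (k x)"
  shows "g \<in> L1_loc"
proof (rule L1_locI)
  fix a b
  show "set_integrable lborel {a..b} g"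
    unfolding set_integrable_def
    by (rule Bochner_Integration.integrable_bound[OF L1_locD(2)[OF assms(1), of a b, unfolded set_integrable_def]])
      (use assms(2,3) in \<open>auto simp: indicator_def\<close>)
qed fact

lemma L1_loc_norm: 
  fixes g :: "real \<Rightarrow> 'a::euclidean_space"
  shows "g \<in> L1_loc \<Longrightarrow> (\<lambda>x. norm (g x)) \<in> L1_loc"
  by (rule L1_loc_dominated[of g]) (auto simp: L1_loc_def)

lemma L1_loc_add:
  fixes g :: "real \<Rightarrow> 'a::euclidean_space"
  assumes "g \<in> L1_loc" "k \<in> L1_loc" 
  shows "(\<lambda>x. g x + k x) \<in> L1_loc"
  by (rule L1_locI)
    (use assms in \<open>auto intro!: set_integral_add borel_measurable_add intro: L1_locD\<close>)

lemma L1_loc_continuous: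
  fixes g :: "real \<Rightarrow> 'a::euclidean_space"
  assumes "continuous_on UNIV g"
  shows "g \<in> L1_loc"
  by (rule L1_locI) (use assms in \<open>auto intro!: borel_integrable_atLeastAtMost' borel_measurable_continuous_onI intro: continuous_on_subset\<close>)

lemma L1_loc_bounded_linear:
  fixes g :: "real \<Rightarrow> 'a::euclidean_space" and T :: "'a \<Rightarrow> 'b::euclidean_space"
  assumes "g \<in> L1_loc" "bounded_linear T"
  shows "(\<lambda>x. T (g x)) \<in> L1_loc"
proof (rule L1_locI)
  show "(\<lambda>x. T (g x)) \<in> borel_measurable borel"
    using assms L1_locD borel_measurable_continuous_onI linear_continuous_on measurable_compose by metis
  show "set_integrable lborel {a..b} (\<lambda>x. T (g x))" for a b
    using integrable_bounded_linear[OF assms(2) L1_locD(2)[OF assms(1), of a b, unfolded set_integrable_def]]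
    unfolding set_integrable_def by (simp add: bounded_linear.linear[OF assms(2)] linear_scale)
qed

lemma L1_loc_mult_continuous:
  fixes g :: "real \<Rightarrow> 'a::{real_normed_algebra,euclidean_space}"
  assumes "g \<in> L1_loc" "continuous_on UNIV w"
  shows "(\<lambda>x. w x * g x) \<in> L1_loc"
proof (rule L1_locI)
  show m: "(\<lambda>x. w x * g x) \<in> borel_measurable borel"
    using assms by (intro borel_measurable_times) (auto dest: L1_locD borel_measurable_continuous_onI)
  fix a b :: real
  have "bounded (w ` {a..b})"
    using assms(2) by (intro compact_imp_bounded compact_continuous_image) (auto intro: continuous_on_subset)
  then obtain B where B: "\<And>x. x \<in> {a..b} \<Longrightarrow> norm (w x) \<le> B" "B > 0"
    unfolding bounded_pos by (metis imageI)
  show "set_integrable lborel {a..b} (\<lambda>x. w x * g x)"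
    unfolding set_integrable_def
  proof (rule Bochner_Integration.integrable_bound)
    show "integrable lborel (\<lambda>x. B *\<^sub>R (indicator {a..b} x *\<^sub>R g x))"
      using L1_locD(2)[OF assms(1), of a b] unfolding set_integrable_def by (rule integrable_scaleR_right)
    show "AE x in lborel. norm (indicat_real {a..b} x *\<^sub>R (w x * g x)) \<le> norm (B *\<^sub>R indicat_real {a..b} x *\<^sub>R g x)"
      using B by (auto simp: indicator_def intro!: order_trans[OF norm_mult_ineq] mult_right_mono)
  qed (use m in auto)
qed

lemma L1_loc_has_integral:
  fixes g :: "real \<Rightarrow> 'a::euclidean_space"
  assumes "g \<in> L1_loc"
  shows "(g has_integral (LINT x:{a..b}|lborel. g x)) {a..b}"
  using set_borel_integral_eq_integral[OF L1_locD(2)[OF assms]]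
  by (metis integrable_integral)

lemma primitive_integral:
  fixes g :: "real \<Rightarrow> 'a::euclidean_space"
  shows "primitive u g \<Longrightarrow> a \<le> b \<Longrightarrow> (LINT x:{a..b}|lborel. g x) = u b - u a"
  unfolding primitive_def using L1_loc_has_integral has_integral_unique by blast

lemma primitive_exists:
  fixes g :: "real \<Rightarrow> 'a::euclidean_space"
  assumes "g \<in> L1_loc"
  obtains u where "primitive u g" "u 0 = c"
proof
  define u where "u x = c + (if x \<ge> 0 then integral {0..x} g else - integral {x..0} g)" for x
  have io: "g integrable_on {a..b}" for a b
    using L1_loc_has_integral[OF assms] by blast
  have "u b - u a = integral {a..b} g" if "a \<le> b" for a b
  proof -
    consider "0 \<le> a" | "a < 0" "0 \<le> b" | "b < 0" by linarith
    then show ?thesis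
    proof cases
      case 1 then show ?thesis
        using Henstock_Kurzweil_Integration.integral_combine[of 0 a b g] that io by (auto simp: u_def algebra_simps)
    next
      case 2 then show ?thesis
        using Henstock_Kurzweil_Integration.integral_combine[of a 0 b g] that io by (auto simp: u_def algebra_simps)
    next
      case 3 then show ?thesis
        using Henstock_Kurzweil_Integration.integral_combine[of a b 0 g] that io by (auto simp: u_def algebra_simps)
    qed
  qed
  then show "primitive u g" "u 0 = c"
    using assms io by (auto simp: primitive_def u_def integrable_integral)
qed

lemma primitive_continuous:
  fixes g :: "real \<Rightarrow> 'a::euclidean_space"
  assumes "primitive u g"
  shows "continuous_on UNIV u"
proof -
  have "continuous_on {a..b} u" for a b
  proof -
    have "continuous_on {a..b} (\<lambda>x. u a + integral {a..x} g)"
      using assms by (intro continuous_intros indefinite_integral_continuous_1)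
        (metis box_real(2) empty_iff has_integral_empty has_integral_integrable has_integral_iff integrable_on_empty atLeastatMost_empty_iff2 primitive_def)
    also have "?this \<longleftrightarrow> ?thesis"
    proof (rule continuous_on_cong[OF refl])
      fix x assume "x \<in> {a..b}"
      then have "integral {a..x} g = u x - u a"
        using assms unfolding primitive_def by (intro integral_unique) auto
      then show "u a + integral {a..x} g = u x" by simp
    qed
    finally show ?thesis .
  qed
  then have "continuous_on {x-1<..<x+1} u" for x
    by (rule continuous_on_subset[of "{x-1..x+1}"]) auto
  then have "isCont u x" for x
    using continuous_on_interior[of "{x-1<..<x+1}" u x] by (simp add: interior_open)
  then show ?thesis by (simp add: continuous_at_imp_continuous_on)
qed

lemma primitive_C1:
  fixes u :: "real \<Rightarrow> 'a::euclidean_space"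
  assumes "\<And>x. (u has_vector_derivative g x) (at x)" "continuous_on UNIV g"
  shows "primitive u g"
  unfolding primitive_def
  by (auto intro!: L1_loc_continuous assms fundamental_theorem_of_calculus has_vector_derivative_at_within)

lemma primitive_add:
  fixes u :: "real \<Rightarrow> 'a::euclidean_space"
  assumes "primitive u g" "primitive v k"
  shows "primitive (\<lambda>x. u x + v x) (\<lambda>x. g x + k x)"
proof -
  have "(u b + v b) - (u a + v a) = (u b - u a) + (v b - v a)" for a b by simp
  then show ?thesis
  using assms unfolding primitive_def by (auto intro!: L1_loc_add has_integral_add simp only:)
qed

lemma primitive_bounded_linear:
  fixes u :: "real \<Rightarrow> 'a::euclidean_space" and T :: "'a \<Rightarrow> 'b::euclidean_space"
  assumes "primitive u g" "bounded_linear T"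
  shows "primitive (\<lambda>x. T (u x)) (\<lambda>x. T (g x))"
  unfolding primitive_def
proof (intro conjI allI impI)
  show "((\<lambda>x. T (g x)) has_integral T (u b) - T (u a)) {a..b}" if "a \<le> b" for a b
    using has_integral_linear[OF _ assms(2), of g "u b - u a" "{a..b}"] assms that
    by (simp add: primitive_def o_def linear_diff[OF bounded_linear.linear[OF assms(2)]])
qed (use assms L1_loc_bounded_linear in \<open>auto simp: primitive_def\<close>)

text \<open>Cut the interval into steps shorter than \<open>d\<close> and add up: the total error is
  at most \<open>e * (m b - m a)\<close>, which vanishes with \<open>e\<close>. This stands in for
  the mean value theorem when \<open>H\<close> is not differentiable.\<close>

lemma eq_if_small_increments:
  fixes H :: "real \<Rightarrow> 'a::real_normed_vector" and m :: "real \<Rightarrow> real"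
  assumes ab: "a \<le> b"
    and small: "\<And>e. e > 0 \<Longrightarrow> \<exists>d>0. \<forall>x y. a \<le> x \<longrightarrow> x \<le> y \<longrightarrow> y \<le> b \<longrightarrow> y - x < d \<longrightarrow> norm (H y - H x) \<le> e * (m y - m x)"
  shows "H b = H a"
proof -
  have bound: "norm (H b - H a) \<le> e * (m b - m a)" if e: "e > 0" for e
  proof -
    obtain d where d: "d > 0" "\<And>x y. \<lbrakk>a \<le> x; x \<le> y; y \<le> b; y - x < d\<rbrakk> \<Longrightarrow> norm (H y - H x) \<le> e * (m y - m x)"
      using small[OF e] by blast
    obtain n where n: "(b - a) / d < real n" using reals_Archimedean2 by blast
    have n0: "n > 0" using n d(1) \<open>a \<le> b\<close> by (cases n) (auto simp: divide_less_0_iff not_less[symmetric])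
    define p where "p k = a + real k * ((b - a) / n)" for k
    have pn: "p n = b" "p 0 = a" using n0 by (auto simp: p_def)
    have step: "p (Suc k) - p k = (b - a) / n" for k by (simp add: p_def algebra_simps add_divide_distrib diff_divide_distrib)
    have lt: "(b - a) / n < d" using n n0 d(1) by (simp add: field_simps)
    have mono: "p k \<le> p l" if "k \<le> l" for k l
      unfolding p_def using that \<open>a \<le> b\<close> by (intro add_left_mono mult_right_mono) auto
    have "norm (H (p k) - H a) \<le> e * (m (p k) - m a)" if "k \<le> n" for k
      using that
    proof (induction k)
      case (Suc k)
      have "norm (H (p (Suc k)) - H (p k)) \<le> e * (m (p (Suc k)) - m (p k))"
        using Suc.prems mono[of 0 k] mono[of "Suc k" n] mono[of k "Suc k"] pn step lt
        by (intro d(2)) auto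
      moreover have "norm (H (p (Suc k)) - H a) \<le> norm (H (p (Suc k)) - H (p k)) + norm (H (p k) - H a)"
        using norm_triangle_ineq[of "H (p (Suc k)) - H (p k)" "H (p k) - H a"] by simp
      ultimately show ?case using Suc by (simp add: algebra_simps)
    qed (simp add: pn)
    from this[of n] pn show ?thesis by simp
  qed
  have "((\<lambda>e. e * (m b - m a)) \<longlongrightarrow> 0 * (m b - m a)) (at_right 0)"
    by (intro tendsto_intros)
  then have "norm (H b - H a) \<le> 0 * (m b - m a)"
    by (rule tendsto_lowerbound) (auto simp: eventually_at_filter bound intro!: always_eventually)
  then show ?thesis by simp
qed


lemma primitive_increment_le:
  fixes g :: "real \<Rightarrow> 'a::euclidean_space"
  assumes "primitive u g" "a \<le> b"
  shows "norm (u b - u a) \<le> integral {a..b} (\<lambda>x. norm (g x))"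
proof -
  have "norm (integral {a..b} g) \<le> integral {a..b} (\<lambda>x. norm (g x))"
    using has_integral_integrable[OF L1_loc_has_integral[of g]]
      has_integral_integrable[OF L1_loc_has_integral[OF L1_loc_norm, of g]] assms
    by (intro integral_norm_bound_integral) (auto simp: primitive_def)
  moreover have "integral {a..b} g = u b - u a"
    using assms unfolding primitive_def by (intro integral_unique) auto
  ultimately show ?thesis by simp
qed

text \<open>\<open>u\<close> may fail to be differentiable, so the classical chain rule does not
  apply. Instead, on short intervals both \<open>G (u x)\<close> and a primitive \<open>I\<close> of
  the claimed derivative differ from the linearization of \<open>G\<close> at the left end by at
  most \<open>e\<close> times the increment of the integral of |g|; hence their difference is
  constant.\<close>

lemma primitive_chain:
  fixes u :: "real \<Rightarrow> 'a::{real_normed_field,euclidean_space}"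
  assumes u: "primitive u g"
    and G: "\<And>z. (G has_field_derivative G' z) (at z)"
    and G': "continuous_on UNIV G'"
  shows "primitive (\<lambda>x. G (u x)) (\<lambda>x. G' (u x) * g x)"
proof -
  have g: "g \<in> L1_loc" using u by (simp add: primitive_def)
  have cu: "continuous_on UNIV u" by (rule primitive_continuous[OF u])
  have cG'u: "continuous_on UNIV (\<lambda>x. G' (u x))"
    using continuous_on_compose2[OF G' cu] by simp
  have k: "(\<lambda>x. G' (u x) * g x) \<in> L1_loc"
    by (rule L1_loc_mult_continuous[OF g cG'u])
  then obtain I where I: "primitive I (\<lambda>x. G' (u x) * g x)"
    using primitive_exists by blast
  obtain m where m: "primitive m (\<lambda>x. norm (g x))"
    using primitive_exists[OF L1_loc_norm[OF g]] by blast
  have mI: "integral {x..y} (\<lambda>x. norm (g x)) = m y - m x" if "x \<le> y" for x y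
    using m that unfolding primitive_def by (intro integral_unique) auto
  have "G (u b) - I b = G (u a) - I a" if ab: "a \<le> b" for a b
  proof (rule eq_if_small_increments[OF ab, of "\<lambda>x. G (u x) - I x" "\<lambda>x. 2 * m x"])
    fix e :: real assume e: "e > 0"
    have "bounded (u ` {a..b})"
      using cu by (intro compact_imp_bounded compact_continuous_image) (auto intro: continuous_on_subset)
    then obtain R where R: "\<And>x. x \<in> {a..b} \<Longrightarrow> u x \<in> cball 0 R"
      unfolding bounded_iff by (metis imageI mem_cball_0)
    have "uniformly_continuous_on (cball 0 R) G'"
      by (intro compact_uniformly_continuous continuous_on_subset[OF G']) auto
    then obtain d' where d': "d' > 0"
      "\<And>z w. \<lbrakk>z \<in> cball 0 R; w \<in> cball 0 R; dist z w < d'\<rbrakk> \<Longrightarrow> dist (G' z) (G' w) < e"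
      unfolding uniformly_continuous_on_def using e by meson
    have "uniformly_continuous_on {a..b} u"
      by (intro compact_uniformly_continuous continuous_on_subset[OF cu]) auto
    then obtain d where d: "d > 0"
      "\<And>x y. \<lbrakk>x \<in> {a..b}; y \<in> {a..b}; dist x y < d\<rbrakk> \<Longrightarrow> dist (u x) (u y) < d'"
      unfolding uniformly_continuous_on_def using d'(1) by meson
    show "\<exists>d>0. \<forall>x y. a \<le> x \<longrightarrow> x \<le> y \<longrightarrow> y \<le> b \<longrightarrow> y - x < d \<longrightarrow>
       norm (G (u y) - I y - (G (u x) - I x)) \<le> e * (2 * m y - 2 * m x)"
    proof (intro exI[of _ d] conjI allI impI d(1))
      fix x y assume xy: "a \<le> x" "x \<le> y" "y \<le> b" "y - x < d"
      have near: "dist (u t) (u x) < d'" if "t \<in> {x..y}" for t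
        using xy that by (intro d(2)) (auto simp: dist_real_def)
      have near': "u t \<in> cball 0 R \<inter> ball (u x) d'" if "t \<in> {x..y}" for t
        using near[OF that] R[of t] xy that by (auto simp: dist_commute)
      have close: "norm (G' z - G' (u x)) \<le> e" if "z \<in> cball 0 R \<inter> ball (u x) d'" for z
        using d'(2)[of z "u x"] that near'[of x] xy by (auto simp: dist_norm dist_commute norm_minus_commute)
      have "norm ((G (u y) - G' (u x) * u y) - (G (u x) - G' (u x) * u x)) \<le> e * norm (u y - u x)"
      \<comment> \<open>The segment from \<open>u x\<close> to \<open>u y\<close> need not lie in
        the range of \<open>u\<close>, hence a convex set on which \<open>G'\<close> stays within
        \<open>e\<close> of \<open>G' (u x)\<close>.\<close>
      proof (rule field_differentiable_bound[where S = "cball 0 R \<inter> ball (u x) d'"])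
        show "convex (cball 0 R \<inter> ball (u x) d')"
          by (intro convex_Int convex_cball convex_ball)
        show "((\<lambda>z. G z - G' (u x) * z) has_field_derivative G' z - G' (u x)) (at z within cball 0 R \<inter> ball (u x) d')"
          for z by (auto intro!: derivative_eq_intros has_field_derivative_at_within[OF G])
      qed (use close near' xy d'(1) in auto)
      also have "\<dots> \<le> e * (m y - m x)"
        using primitive_increment_le[OF u xy(2)] mI[OF xy(2)] e by (intro mult_left_mono) auto
      finally have 1: "norm ((G (u y) - G' (u x) * u y) - (G (u x) - G' (u x) * u x)) \<le> e * (m y - m x)" .
      have hi: "((\<lambda>t. G' (u t) * g t - G' (u x) * g t) has_integral (I y - I x) - G' (u x) * (u y - u x)) {x..y}"
        using I u xy(2) unfolding primitive_def by (intro has_integral_diff has_integral_mult_right) auto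
      have "norm (integral {x..y} (\<lambda>t. G' (u t) * g t - G' (u x) * g t)) \<le> integral {x..y} (\<lambda>t. e * norm (g t))"
      proof (rule integral_norm_bound_integral)
        show "(\<lambda>t. G' (u t) * g t - G' (u x) * g t) integrable_on {x..y}" using hi by blast
        show "(\<lambda>t. e * norm (g t)) integrable_on {x..y}"
          using L1_loc_has_integral[OF L1_loc_norm[OF g]] by (intro integrable_on_mult_right has_integral_integrable)
        show "norm (G' (u t) * g t - G' (u x) * g t) \<le> e * norm (g t)" if "t \<in> {x..y}" for t
          using close[OF near'[OF that]] by (simp add: norm_mult mult_right_mono flip: left_diff_distrib)
      qed
      then have 2: "norm ((I y - I x) - G' (u x) * (u y - u x)) \<le> e * (m y - m x)"
        using integral_unique[OF hi] mI[OF xy(2)] by simp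
      have "norm (G (u y) - I y - (G (u x) - I x)) =
        norm (((G (u y) - G' (u x) * u y) - (G (u x) - G' (u x) * u x)) - ((I y - I x) - G' (u x) * (u y - u x)))"
        by (simp add: algebra_simps)
      also have "\<dots> \<le> e * (m y - m x) + e * (m y - m x)"
        using 1 2 by (rule order_trans[OF norm_triangle_ineq4 add_mono])
      finally show "norm (G (u y) - I y - (G (u x) - I x)) \<le> e * (2 * m y - 2 * m x)"
        by (simp add: algebra_simps)
    qed
  qed
  note const = this
  have "I b - I a = G (u b) - G (u a)" if "a \<le> b" for a b
    using const[OF that] by algebra
  then show ?thesis using I unfolding primitive_def by auto
qed

lemma primitive_scaleR:
  fixes u :: "real \<Rightarrow> 'a::euclidean_space"
  shows "primitive u g \<Longrightarrow> primitive (\<lambda>x. c *\<^sub>R u x) (\<lambda>x. c *\<^sub>R g x)"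
  by (rule primitive_bounded_linear) (auto intro: bounded_linear_scaleR_right)

lemma primitive_cmult:
  fixes u :: "real \<Rightarrow> 'a::{real_normed_field,euclidean_space}"
  shows "primitive u g \<Longrightarrow> primitive (\<lambda>x. c * u x) (\<lambda>x. c * g x)"
  by (rule primitive_bounded_linear) (auto intro: bounded_linear_mult_right)

text \<open>Polarization: the product is a quarter of the difference of two squares, and squares are
  covered by the chain rule.\<close>

lemma primitive_mult:
  fixes u v :: "real \<Rightarrow> 'a::{real_normed_field,euclidean_space}"
  assumes "primitive u g" "primitive v k"
  shows "primitive (\<lambda>x. u x * v x) (\<lambda>x. g x * v x + u x * k x)"
proof -
  have sq: "primitive (\<lambda>x. (w x)\<^sup>2) (\<lambda>x. 2 * w x * l x)" if "primitive w l" for w l :: "real \<Rightarrow> 'a"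
    by (rule primitive_chain[OF that]) (auto intro!: derivative_eq_intros continuous_intros)
  have "primitive (\<lambda>x. (1/4) * ((u x + v x)\<^sup>2 + (-1) * (u x + (-1) * v x)\<^sup>2))
     (\<lambda>x. (1/4) * (2 * (u x + v x) * (g x + k x) + (-1) * (2 * (u x + (-1) * v x) * (g x + (-1) * k x))))"
    by (intro primitive_cmult primitive_add sq assms)
  moreover have "(1/4) * ((a + b)\<^sup>2 + (-1) * (a + (-1) * b)\<^sup>2) = a * b" for a b :: 'a
  proof -
    have "(a + b)\<^sup>2 + (-1) * (a + (-1) * b)\<^sup>2 = 4 * (a * b)" by algebra
    then show ?thesis by simp
  qed
  moreover have "(1/4) * (2 * (a + b) * (c + d) + (-1) * (2 * (a + (-1) * b) * (c + (-1) * d))) = c * b + a * d"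
    for a b c d :: 'a
  proof -
    have "2 * (a + b) * (c + d) + (-1) * (2 * (a + (-1) * b) * (c + (-1) * d)) = 4 * (c * b + a * d)" by algebra
    then show ?thesis by simp
  qed
  ultimately show ?thesis by (simp only:)
qed

lemma primitive_of_real:
  "primitive u g \<Longrightarrow> primitive (\<lambda>x. complex_of_real (u x)) (\<lambda>x. complex_of_real (g x))"
  by (rule primitive_bounded_linear) (auto intro: bounded_linear_of_real)

section \<open>Weak derivatives on the line\<close>

lemma deriv_pow_eq:
  assumes "\<And>k x. (D k has_real_derivative D (Suc k) x) (at x)"
  shows "(deriv ^^ k) (D 0) = D k"
proof (induction k)
  case (Suc k)
  then show ?case using assms by (auto simp: DERIV_imp_deriv)
qed auto

text \<open>\<open>D\<close> lists all derivatives at once, so that smoothness of every order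
  reduces to one family of first-order facts.\<close>

lemma test_functionI:
  assumes D: "\<And>k x. (D k has_real_derivative D (Suc k) x) (at x)"
    and supp: "\<And>x. x \<notin> {a..b} \<Longrightarrow> D 0 x = 0"
  shows "test_function (D 0)"
  unfolding test_function_def C_class_def
proof (intro conjI allI impI)
  fix k j
  show "(deriv ^^ j) (D 0) differentiable_on UNIV"
    using D by (auto simp: deriv_pow_eq[of D, OF D] differentiable_on_def real_differentiable_def intro: differentiable_at_withinI)
  show "continuous_on UNIV ((deriv ^^ k) (D 0))"
    using D by (auto simp: deriv_pow_eq[of D, OF D] intro!: continuous_at_imp_continuous_on DERIV_isCont)
next
  have "closure {x. D 0 x \<noteq> 0} \<subseteq> {a..b}"
    by (intro closure_minimal subsetI) (use supp in blast, auto)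
  then show "compact (closure {x. D 0 x \<noteq> 0})"
    by (meson bounded_closed_interval bounded_subset closed_closure compact_eq_bounded_closed)
qed

text \<open>For the points where two pieces of a piecewise formula meet: the ends of the bump and
  the corner of the positive part.\<close>

lemma has_derivative_zero_if_quadratic_bound:
  fixes f :: "real \<Rightarrow> real"
  assumes "\<And>x. \<bar>f x\<bar> \<le> M * (x - a)\<^sup>2"
  shows "(f has_real_derivative 0) (at a)"
proof -
  have fa: "f a = 0" using assms[of a] by simp
  have "((\<lambda>x. (f x - f a) / (x - a)) \<longlongrightarrow> 0) (at a)"
  proof (rule Lim_null_comparison)
    have "((\<lambda>x. M * \<bar>x - a\<bar>) \<longlongrightarrow> M * \<bar>a - a\<bar>) (at a)" by (intro tendsto_intros)
    then show "((\<lambda>x. M * \<bar>x - a\<bar>) \<longlongrightarrow> 0) (at a)" by simp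
    show "\<forall>\<^sub>F x in at a. norm ((f x - f a) / (x - a)) \<le> M * \<bar>x - a\<bar>"
      unfolding eventually_at_filter
    proof (rule always_eventually, intro allI impI)
      fix x assume "x \<noteq> a"
      then show "norm ((f x - f a) / (x - a)) \<le> M * \<bar>x - a\<bar>"
        using assms[of x] fa by (simp add: abs_divide pos_divide_le_eq power2_eq_square abs_mult mult.assoc)
    qed
  qed
  then show ?thesis by (simp add: has_field_derivative_iff)
qed

text \<open>Functions of this form are closed under differentiation, whence the smoothness of the
  standard bump.\<close>

definition bump_fun :: "real poly \<Rightarrow> nat \<Rightarrow> real \<Rightarrow> real" where
  "bump_fun p k x = (if 0 < x \<and> x < 1
     then poly p x / (x * (1 - x)) ^ k * exp (- 1 / (x * (1 - x))) else 0)"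

text \<open>With w = x (1 - x) and n = k + 2, the inequality exp y >= (y/n)^n at y = 1/w gives exp
  (-1/w) <= n^n w^n. The exponent exceeds \<open>k\<close> by 2, so a factor w^2 survives the
  division by w^k; this quadratic decay makes the derivative vanish at both ends.\<close>

lemma bump_fun_bound:
  "\<exists>M. \<forall>x. \<bar>bump_fun p k x\<bar> \<le> M * x\<^sup>2 \<and> \<bar>bump_fun p k x\<bar> \<le> M * (x - 1)\<^sup>2"
proof -
  have "bounded (poly p ` {0..1})"
    by (intro compact_imp_bounded compact_continuous_image continuous_intros) auto
  then obtain P where P: "\<And>x. x \<in> {0..1} \<Longrightarrow> \<bar>poly p x\<bar> \<le> P" "P > 0"
    unfolding bounded_pos by (metis imageI real_norm_def)
  define M where "M = P * real (k + 2) ^ (k + 2)"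
  have M: "M \<ge> 0" unfolding M_def using P(2) by simp
  have "\<bar>bump_fun p k x\<bar> \<le> M * (x * (1 - x))\<^sup>2" if x: "0 < x" "x < 1" for x
  proof -
    define w where "w = x * (1 - x)"
    have w: "w > 0" using x by (simp add: w_def)
    define n where "n = k + 2"
    have "(1 / w / real n) ^ n \<le> (1 + 1 / w / real n) ^ n"
      using w by (intro power_mono) auto
    also have "\<dots> \<le> exp (1 / w)"
      by (rule exp_ge_one_plus_x_over_n_power_n) (use w in \<open>auto simp: n_def intro: order_trans[of _ 0]\<close>)
    finally have "(1 / w / real n) ^ n \<le> exp (1 / w)" .
    moreover have "(1 / w / real n) ^ n > 0" using w by (simp add: n_def)
    ultimately have "1 / exp (1 / w) \<le> 1 / (1 / w / real n) ^ n"
      by (intro divide_left_mono) auto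
    also have "\<dots> = real n ^ n * w ^ n"
      by (simp add: power_divide power_mult_distrib mult.commute)
    finally have e: "exp (- 1 / w) \<le> real (k + 2) ^ (k + 2) * w ^ (k + 2)"
      by (simp add: exp_minus divide_inverse n_def)
    have "\<bar>bump_fun p k x\<bar> = \<bar>poly p x\<bar> / w ^ k * exp (- 1 / w)"
      using x w by (simp add: bump_fun_def abs_mult w_def)
    also have "\<dots> \<le> P / w ^ k * (real (k + 2) ^ (k + 2) * w ^ (k + 2))"
      using P(1)[of x] P(2) x w e by (intro mult_mono divide_right_mono) auto
    also have "\<dots> = M * w\<^sup>2" using w by (simp add: M_def power_add power2_eq_square)
    finally show ?thesis by (simp add: w_def)
  qed
  moreover have "M * (x * (1 - x))\<^sup>2 \<le> M * x\<^sup>2" "M * (x * (1 - x))\<^sup>2 \<le> M * (x - 1)\<^sup>2" if "0 < x" "x < 1" for x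
  proof -
    show "M * (x * (1 - x))\<^sup>2 \<le> M * x\<^sup>2"
      using that M by (intro mult_left_mono power_mono mult_left_le) auto
    have "(x * (1 - x))\<^sup>2 \<le> (1 - x)\<^sup>2"
      using that by (intro power_mono mult_left_le_one_le) auto
    then show "M * (x * (1 - x))\<^sup>2 \<le> M * (x - 1)\<^sup>2"
      using M by (intro mult_left_mono) (auto simp: power2_commute)
  qed
  ultimately have "\<bar>bump_fun p k x\<bar> \<le> M * x\<^sup>2 \<and> \<bar>bump_fun p k x\<bar> \<le> M * (x - 1)\<^sup>2" for x
    using M by (cases "0 < x \<and> x < 1") (fastforce simp: bump_fun_def intro: order_trans)+
  then show ?thesis by blast
qed

text \<open>The exponent grows by 2 because the derivative of -1/W is W'/W^2; the factor 1/W^k alone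
  would cost only one more power.\<close>

lemma bump_fun_deriv:
  defines "W \<equiv> [:0, 1, -1:]"
  shows "(bump_fun p k has_real_derivative
    bump_fun (pderiv p * W * W - of_nat k * p * pderiv W * W + p * pderiv W) (k + 2) x) (at x)"
proof -
  obtain M where M: "\<And>x. \<bar>bump_fun p k x\<bar> \<le> M * x\<^sup>2" "\<And>x. \<bar>bump_fun p k x\<bar> \<le> M * (x - 1)\<^sup>2"
    using bump_fun_bound by blast
  consider "x = 0" | "x = 1" | "0 < x" "x < 1" | "x < 0 \<or> x > 1" by linarith
  then show ?thesis
  proof cases
    case 1
    with has_derivative_zero_if_quadratic_bound[of "bump_fun p k" M 0] M show ?thesis
      by (simp add: bump_fun_def)
  next
    case 2
    with has_derivative_zero_if_quadratic_bound[of "bump_fun p k" M 1] M show ?thesis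
      by (simp add: bump_fun_def)
  next
    case 3
    define w where "w y = y * (1 - y)" for y :: real
    have w: "w x \<noteq> 0" using 3 by (simp add: w_def)
    have W: "poly W x = w x" "poly (pderiv W) x = 1 - 2 * x"
      by (simp_all add: W_def w_def pderiv_pCons algebra_simps)
    have dw: "(w has_real_derivative 1 - 2 * x) (at x)"
      unfolding w_def by (auto intro!: derivative_eq_intros)
    have "((\<lambda>y. poly p y / w y ^ k * exp (- 1 / w y)) has_real_derivative
       (poly (pderiv p) x * w x ^ k - poly p x * (real k * (1 - 2 * x) * w x ^ (k - 1))) / (w x ^ k * w x ^ k) * exp (- 1 / w x)
        + poly p x / w x ^ k * (exp (- 1 / w x) * ((1 - 2 * x) / (w x * w x)))) (at x)"
      using w by (auto intro!: derivative_eq_intros dw poly_DERIV) (simp add: divide_simps, simp add: algebra_simps)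
    also have "(poly (pderiv p) x * w x ^ k - poly p x * (real k * (1 - 2 * x) * w x ^ (k - 1))) / (w x ^ k * w x ^ k) * exp (- 1 / w x)
        + poly p x / w x ^ k * (exp (- 1 / w x) * ((1 - 2 * x) / (w x * w x))) =
       (poly (pderiv p) x * w x * w x - real k * poly p x * (1 - 2 * x) * w x + poly p x * (1 - 2 * x))
         / w x ^ (k + 2) * exp (- 1 / w x)"
      using w by (cases k) (simp_all add: divide_simps power_add power2_eq_square, simp_all add: algebra_simps)
    finally have *: "((\<lambda>y. poly p y / (y * (1 - y)) ^ k * exp (- 1 / (y * (1 - y)))) has_real_derivative
       bump_fun (pderiv p * W * W - of_nat k * p * pderiv W * W + p * pderiv W) (k + 2) x) (at x)"
      using 3 W by (simp add: bump_fun_def w_def)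
    show ?thesis
      by (rule has_field_derivative_transform_within_open[OF *, of "{0<..<1}"])
        (use 3 in \<open>auto simp: bump_fun_def\<close>)
  next
    case 4
    have "((\<lambda>x. 0) has_real_derivative bump_fun (pderiv p * W * W - of_nat k * p * pderiv W * W + p * pderiv W) (k + 2) x) (at x)"
      using 4 by (auto simp: bump_fun_def)
    then show ?thesis
      by (rule has_field_derivative_transform_within_open[of _ _ _ "{..<0} \<union> {1<..}"])
        (use 4 in \<open>auto simp: bump_fun_def\<close>)
  qed
qed

lemma smooth_bump:
  obtains b :: "nat \<Rightarrow> real \<Rightarrow> real" where
    "\<And>k x. (b k has_real_derivative b (Suc k) x) (at x)"
    "\<And>x. b 0 x \<ge> 0" "\<And>x. 0 < x \<Longrightarrow> x < 1 \<Longrightarrow> b 0 x > 0" "\<And>x. x \<le> 0 \<or> x \<ge> 1 \<Longrightarrow> b 0 x = 0"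
proof -
  define P where "P = rec_nat (1 :: real poly) (\<lambda>n p. pderiv p * [:0, 1, -1:] * [:0, 1, -1:] - of_nat (2 * n) * p * pderiv [:0, 1, -1:] * [:0, 1, -1:] + p * pderiv [:0, 1, -1:])"
  show ?thesis
  proof (rule that[of "\<lambda>k. bump_fun (P k) (2 * k)"])
    show "(bump_fun (P k) (2 * k) has_real_derivative bump_fun (P (Suc k)) (2 * Suc k) x) (at x)" for k x
      using bump_fun_deriv[of "P k" "2 * k" x] by (simp add: P_def)
  qed (auto simp: bump_fun_def P_def)
qed

lemma primitive_has_vector_derivative:
  fixes u :: "real \<Rightarrow> 'a::euclidean_space"
  assumes "primitive u g" "continuous_on UNIV g"
  shows "(u has_vector_derivative g x) (at x)"
proof -
  have "((\<lambda>y. u (x-1) + integral {x-1..y} g) has_vector_derivative 0 + g x) (at x within {x-1..x+1})"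
    using assms(2) by (intro derivative_intros integral_has_vector_derivative) (auto intro: continuous_on_subset)
  then have "((\<lambda>y. u (x-1) + integral {x-1..y} g) has_vector_derivative g x) (at x within {x-1..x+1})"
    by (simp only: add_0)
  then have "(u has_vector_derivative g x) (at x within {x-1..x+1})"
  proof (rule has_vector_derivative_transform[rotated 2])
    show "u y = u (x-1) + integral {x-1..y} g" if "y \<in> {x-1..x+1}" for y
      using assms(1) that unfolding primitive_def by (subst integral_unique[of g "u y - u (x-1)"]) auto
  qed simp
  then show ?thesis by (simp add: at_within_Icc_at)
qed

text \<open>The normalized primitive of the bump; the bump divided by its mass becomes the
  derivative \<open>S 1\<close>.\<close>

lemma smooth_step:
  obtains S :: "nat \<Rightarrow> real \<Rightarrow> real" where
    "\<And>k x. (S k has_real_derivative S (Suc k) x) (at x)"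
    "\<And>x. x \<le> 0 \<Longrightarrow> S 0 x = 0" "\<And>x. x \<ge> 1 \<Longrightarrow> S 0 x = 1" "\<And>x. 0 \<le> S 0 x" "\<And>x. S 0 x \<le> 1"
    "\<And>x. S 1 x \<ge> 0" "\<And>x. x \<notin> {0..1} \<Longrightarrow> S 1 x = 0"
proof -
  obtain b :: "nat \<Rightarrow> real \<Rightarrow> real" where b:
    "\<And>k x. (b k has_real_derivative b (Suc k) x) (at x)"
    "\<And>x. b 0 x \<ge> 0" "\<And>x. 0 < x \<Longrightarrow> x < 1 \<Longrightarrow> b 0 x > 0" "\<And>x. x \<le> 0 \<or> x \<ge> 1 \<Longrightarrow> b 0 x = 0"
    using smooth_bump by blast
  have cb: "continuous_on UNIV (b 0)"
    using b(1) by (auto intro!: continuous_at_imp_continuous_on DERIV_isCont)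
  obtain B where B: "primitive B (b 0)" "B 0 = 0"
    using primitive_exists[OF L1_loc_continuous[OF cb]] by blast
  have dB: "(B has_real_derivative b 0 x) (at x)" for x
    using primitive_has_vector_derivative[OF B(1) cb] by (simp add: has_real_derivative_iff_has_vector_derivative)
  have mono: "B x \<le> B y" if "x \<le> y" for x y
    using DERIV_nonneg_imp_nondecreasing[OF that] dB b(2) by blast
  have const: "B x = B y" if "x \<le> y" "\<And>z. z \<in> {x..y} \<Longrightarrow> b 0 z = 0" for x y
  proof -
    have "(b 0 has_integral (B y - B x)) {x..y}" using B(1) that(1) by (simp add: primitive_def)
    moreover have "(b 0 has_integral 0) {x..y}" using that(2) by (intro has_integral_is_0) auto
    ultimately have "B y - B x = 0" by (rule has_integral_unique)
    then show ?thesis by simp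
  qed
  have 0: "B x = 0" if "x \<le> 0" for x
    using const[of x 0] that b(4) B(2) by auto
  have 1: "B x = B 1" if "x \<ge> 1" for x
    using const[of 1 x] that b(4) by auto
  have pos: "B 1 > 0"
  proof -
    have "B (1/2) < B (3/4)"
    proof (rule DERIV_pos_imp_increasing[of "1/2" "3/4" B])
      fix z :: real assume z: "1/2 \<le> z" "z \<le> 3/4"
      show "\<exists>y. (B has_real_derivative y) (at z) \<and> 0 < y"
        by (rule exI[of _ "b 0 z"]) (use z dB b(3)[of z] in simp)
    qed simp
    then show ?thesis using mono[of 0 "1/2"] mono[of "3/4" 1] B(2) by simp
  qed
  define T where "T k x = (case k of 0 \<Rightarrow> B x | Suc j \<Rightarrow> b j x) / B 1" for k x
  have T: "T 0 x = B x / B 1" "T (Suc j) x = b j x / B 1" for x j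
    by (simp_all add: T_def)
  show ?thesis
  proof (rule that[of T])
    show "(T k has_real_derivative T (Suc k) x) (at x)" for k x
      using dB b(1) unfolding T_def by (cases k) (auto intro!: DERIV_cdivide)
    show "T 0 x \<le> 1" for x
      using pos mono[of x 1] 1[of x] by (cases "x \<le> 1") (simp_all add: T)
    show "0 \<le> T 0 x" for x
      using pos mono[of 0 x] 0[of x] B(2) by (cases "x \<le> 0") (simp_all add: T)
    show "T 0 x = 1" if "1 \<le> x" for x
      using 1[OF that] pos by (simp add: T)
  qed (use 0 pos b in \<open>auto simp: T\<close>)
qed

text \<open>The rescaled \<open>s\<close> is a nonnegative kernel of mass 1 supported in
  [a, a + 1/(n+1)], an approximate identity at \<open>a\<close>; the averages of \<open>u\<close>
  converge by continuity at that one point.\<close>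

lemma mollified_evaluation:
  fixes u :: "real \<Rightarrow> 'a::euclidean_space" and s :: "real \<Rightarrow> real"
  assumes u: "continuous_on UNIV u"
    and s: "continuous_on UNIV s" "\<And>x. s x \<ge> 0" "\<forall>x. x \<notin> {0..1} \<longrightarrow> s x = 0" "(s has_integral 1) {0..1}"
  shows "integrable lborel (\<lambda>x. (real (Suc n) * s (real (Suc n) * (x - a))) *\<^sub>R u x)"
    "(\<lambda>n. LINT x|lborel. (real (Suc n) * s (real (Suc n) * (x - a))) *\<^sub>R u x) \<longlonglongrightarrow> u a"
proof -
  define k where "k n x = real (Suc n) * s (real (Suc n) * (x - a))" for n x
  have ck: "continuous_on UNIV (k n)" for n
    unfolding k_def by (intro continuous_intros continuous_on_compose2[OF s(1)]) auto
  have k0: "k n x = 0" if "x \<notin> {a..a + 1 / real (Suc n)}" for n x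
  proof -
    have "real (Suc n) * (x - a) \<notin> {0..1}"
    proof (cases "x < a")
      case True
      then have "real (Suc n) * (x - a) < 0" by (intro mult_pos_neg) auto
      then show ?thesis by simp
    next
      case False
      then have "1 / real (Suc n) < x - a" using that by auto
      then have "1 < real (Suc n) * (x - a)" by (simp only: pos_divide_less_eq mult.commute of_nat_0_less_iff zero_less_Suc)
      then show ?thesis by simp
    qed
    then have "s (real (Suc n) * (x - a)) = 0" using s(3) by blast
    then show ?thesis unfolding k_def by (simp only: mult_zero_right)
  qed
  have kpos: "k n x \<ge> 0" for n x by (simp add: k_def s(2))
  have int: "integrable lborel (\<lambda>x. k n x *\<^sub>R v x)" if "continuous_on UNIV v" for v :: "real \<Rightarrow> 'b::euclidean_space" and n
  proof -
    have "integrable lborel (\<lambda>x. indicator {a..a + 1 / real (Suc n)} x *\<^sub>R (k n x *\<^sub>R v x))"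
      by (intro borel_integrable_compact continuous_on_subset[OF continuous_on_scaleR[OF ck that]]) auto
    also have "(\<lambda>x. indicator {a..a + 1 / real (Suc n)} x *\<^sub>R (k n x *\<^sub>R v x)) = (\<lambda>x. k n x *\<^sub>R v x)"
      using k0 by (force simp: indicator_def)
    finally show ?thesis .
  qed
  have k1: "(LINT x|lborel. k n x) = 1" for n
  proof -
    have "(LINT x|lborel. s x) = 1"
    proof -
      have i: "integrable lborel (\<lambda>x. indicator {0..1} x *\<^sub>R s x)"
        by (intro borel_integrable_compact continuous_on_subset[OF s(1)]) auto
      have "(LINT x:{0..1}|lborel. s x) = 1"
        using set_borel_integral_eq_integral(2)[of "{0..1}" s] i integral_unique[OF s(4)] by (simp add: set_integrable_def)
      moreover have "(\<lambda>x. indicator {0..1} x *\<^sub>R s x) = s" using s(3) by (force simp: indicator_def)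
      ultimately show ?thesis by (simp add: set_lebesgue_integral_def)
    qed
    moreover have "(LINT x|lborel. s x) = c * (LINT x|lborel. s (c * (x - a)))" if "c > 0" for c
      using lborel_integral_real_affine[of c s "- c * a"] that by (simp add: algebra_simps)
    ultimately show ?thesis
      unfolding k_def by (subst integral_mult_right_zero) (metis of_nat_0_less_iff zero_less_Suc)
  qed
  show "integrable lborel (\<lambda>x. (real (Suc n) * s (real (Suc n) * (x - a))) *\<^sub>R u x)"
    using int[OF u, of n] by (simp add: k_def)
  have "(\<lambda>n. LINT x|lborel. k n x *\<^sub>R u x) \<longlonglongrightarrow> u a"
  proof (rule LIMSEQ_I)
    fix e :: real assume e: "e > 0"
    have "isCont u a" using u by (simp add: continuous_on_eq_continuous_at)
    then obtain d where d: "d > 0" "\<And>x. dist x a < d \<Longrightarrow> dist (u x) (u a) < e / 2"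
      unfolding continuous_at_eps_delta using e half_gt_zero by meson
    obtain N where N: "1 / real (Suc N) < d" using d(1) nat_approx_posE by metis
    show "\<exists>no. \<forall>n\<ge>no. norm ((LINT x|lborel. k n x *\<^sub>R u x) - u a) < e"
    proof (intro exI[of _ N] allI impI)
      fix n assume n: "N \<le> n"
      have "1 / real (Suc n) \<le> 1 / real (Suc N)" using n by (intro divide_left_mono) auto
      then have nd: "1 / real (Suc n) < d" using N by simp
      have "(LINT x|lborel. k n x *\<^sub>R u x) - u a = (LINT x|lborel. k n x *\<^sub>R u x) - (LINT x|lborel. k n x *\<^sub>R u a)"
        by (subst integral_scaleR_left) (use int[of "\<lambda>_. 1::real" n] k1 in auto)
      also have "\<dots> = (LINT x|lborel. k n x *\<^sub>R (u x - u a))"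
        by (subst Bochner_Integration.integral_diff[symmetric]) (auto intro!: int u continuous_intros simp: scaleR_diff_right)
      finally have "norm ((LINT x|lborel. k n x *\<^sub>R u x) - u a) \<le> (LINT x|lborel. norm (k n x *\<^sub>R (u x - u a)))"
        by (simp only: integral_norm_bound)
      also have "\<dots> \<le> (LINT x|lborel. k n x *\<^sub>R (e / 2))"
      proof (rule integral_mono)
        show "integrable lborel (\<lambda>x. norm (k n x *\<^sub>R (u x - u a)))"
          by (intro integrable_norm int continuous_intros u)
        show "integrable lborel (\<lambda>x. k n x *\<^sub>R (e / 2))" by (intro int continuous_intros)
        show "norm (k n x *\<^sub>R (u x - u a)) \<le> k n x *\<^sub>R (e / 2)" for x
        proof (cases "x \<in> {a..a + 1 / real (Suc n)}")
          case True
          then have "dist x a < d" using nd by (auto simp: dist_real_def)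
          then have "norm (u x - u a) \<le> e / 2" using d(2) by (fastforce simp: dist_norm)
          from mult_left_mono[OF this kpos[of n x]] show ?thesis using kpos[of n x] by simp
        qed (use k0 in auto)
      qed
      also have "\<dots> = e / 2" using k1[of n] by simp
      finally show "norm ((LINT x|lborel. k n x *\<^sub>R u x) - u a) < e" using e by simp
    qed
  qed
  then show "(\<lambda>n. LINT x|lborel. (real (Suc n) * s (real (Suc n) * (x - a))) *\<^sub>R u x) \<longlonglongrightarrow> u a"
    by (simp add: k_def)
qed

text \<open>The du Bois-Reymond lemma: test with a smoothed indicator function of the interval.\<close>

lemma weak_deriv_imp_primitive:
  fixes u :: "real \<Rightarrow> 'a::euclidean_space"
  assumes u: "continuous_on UNIV u" and w: "has_weak_deriv u g"
  shows "primitive u g"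
proof -
  have g: "g \<in> L1_loc" using w by (simp add: has_weak_deriv_def)
  obtain S :: "nat \<Rightarrow> real \<Rightarrow> real" where S:
    "\<And>k x. (S k has_real_derivative S (Suc k) x) (at x)"
    "\<And>x. x \<le> 0 \<Longrightarrow> S 0 x = 0" "\<And>x. x \<ge> 1 \<Longrightarrow> S 0 x = 1" "\<And>x. 0 \<le> S 0 x" "\<And>x. S 0 x \<le> 1"
    "\<And>x. S 1 x \<ge> 0" "\<And>x. x \<notin> {0..1} \<Longrightarrow> S 1 x = 0"
    using smooth_step by metis
  have S1: "continuous_on UNIV (S 1)"
    using S(1) by (auto intro!: continuous_at_imp_continuous_on DERIV_isCont)
  have SI: "(S 1 has_integral 1) {0..1}"
    using fundamental_theorem_of_calculus[of 0 1 "S 0" "S 1"] S(1)[of 0] S(2)[of 0] S(3)[of 1]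
    by (auto intro: has_vector_derivative_at_within simp: has_real_derivative_iff_has_vector_derivative)
  have "u b - u a = (LINT x:{a..b}|lborel. g x)" if ab: "a < b" for a b
  proof -
    \<comment> \<open>Difference of two ever steeper steps, a smooth substitute for the indicator of
      the interval; the factor \<open>real (Suc n) ^ k\<close> comes from the chain rule, so
      \<open>D n\<close> lists successive derivatives.\<close>
    define D where "D n k x = real (Suc n) ^ k * (S k (real (Suc n) * (x - a)) - S k (real (Suc n) * (x - b)))" for n k x
    have dD: "(D n k has_real_derivative D n (Suc k) x) (at x)" for n k x
    proof -
      have "((\<lambda>x. S k (real (Suc n) * (x - c))) has_real_derivative S (Suc k) (real (Suc n) * (x - c)) * real (Suc n)) (at x)" for c
        by (rule DERIV_chain2[OF S(1)]) (auto intro!: derivative_eq_intros)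
      from DERIV_cmult[OF DERIV_diff[OF this[of a] this[of b]], of "real (Suc n) ^ k"]
      show ?thesis unfolding D_def by (simp add: algebra_simps)
    qed
    have D0: "D n 0 x = 0" if "x \<notin> {a..b + 1}" for n x
    proof (cases "x < a")
      case True
      then show ?thesis using ab S(2)[of "real (Suc n) * (x - a)"] S(2)[of "real (Suc n) * (x - b)"]
        by (simp add: D_def mult_nonneg_nonpos)
    next
      case False
      then have "x > b + 1" using that by auto
      then have "1 \<le> real (Suc n) * (x - b)" "1 \<le> real (Suc n) * (x - a)"
        using ab mult_mono[of 1 "real (Suc n)" 1 "x - b"] mult_mono[of 1 "real (Suc n)" 1 "x - a"] by auto
      then show ?thesis by (simp add: D_def S(3))
    qed
    have "test_function (D n 0)" for n
      by (rule test_functionI[OF dD D0])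
    then have eq: "(LINT x|lborel. D n 1 x *\<^sub>R u x) = - (LINT x|lborel. D n 0 x *\<^sub>R g x)" for n
    proof -
      have "deriv (D n 0) = D n 1"
        using DERIV_imp_deriv[OF dD[of n 0]] by auto
      then show ?thesis
        using w \<open>test_function (D n 0)\<close> unfolding has_weak_deriv_def by metis
    qed
    have "\<forall>x. x \<notin> {0..1} \<longrightarrow> S 1 x = 0" using S(7) by blast
    note M = mollified_evaluation[OF u S1 S(6) this SI]
    have "(LINT x|lborel. D n 1 x *\<^sub>R u x) = (LINT x|lborel. (real (Suc n) * S 1 (real (Suc n) * (x - a))) *\<^sub>R u x
        - (real (Suc n) * S 1 (real (Suc n) * (x - b))) *\<^sub>R u x)" for n
      by (intro Bochner_Integration.integral_cong)
        (simp_all only: D_def scaleR_diff_left right_diff_distrib power_one_right)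
    then have "(LINT x|lborel. D n 1 x *\<^sub>R u x) = (LINT x|lborel. (real (Suc n) * S 1 (real (Suc n) * (x - a))) *\<^sub>R u x)
        - (LINT x|lborel. (real (Suc n) * S 1 (real (Suc n) * (x - b))) *\<^sub>R u x)" for n
      using Bochner_Integration.integral_diff[OF M(1)[of n a] M(1)[of n b]] by (rule trans)
    then have L1: "(\<lambda>n. LINT x|lborel. D n 1 x *\<^sub>R u x) \<longlonglongrightarrow> u a - u b"
      using tendsto_diff[OF M(2)[of a] M(2)[of b]] by (simp only:)
    \<comment> \<open>Each step vanishes up to and including its base point and rises only to the
      right of it, hence a half-open interval in the limit.\<close>
    have L2: "(\<lambda>n. LINT x|lborel. D n 0 x *\<^sub>R g x) \<longlonglongrightarrow> (LINT x|lborel. indicator {a<..b} x *\<^sub>R g x)"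
    proof (rule integral_dominated_convergence)
      show "integrable lborel (\<lambda>x. indicator {a..b + 1} x *\<^sub>R norm (g x))"
        using L1_locD(2)[OF L1_loc_norm[OF g]] by (simp add: set_integrable_def)
      have "continuous_on UNIV (D n 0)" for n
        using dD by (auto intro!: continuous_at_imp_continuous_on DERIV_isCont)
      then show "(\<lambda>x. D n 0 x *\<^sub>R g x) \<in> borel_measurable lborel" for n
        using L1_locD(1)[OF g] by (auto intro!: borel_measurable_scaleR dest: borel_measurable_continuous_onI)
      show "(\<lambda>x. indicat_real {a<..b} x *\<^sub>R g x) \<in> borel_measurable lborel"
        using L1_locD(1)[OF g] by auto
      have D1: "\<bar>D n 0 x\<bar> \<le> 1" for n x
        using S(4,5)[of "real (Suc n) * (x - a)"] S(4,5)[of "real (Suc n) * (x - b)"] by (auto simp: D_def abs_if)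
      show "AE x in lborel. norm (D n 0 x *\<^sub>R g x) \<le> indicator {a..b + 1} x *\<^sub>R norm (g x)" for n
        using D0[of _ n] D1[of n] by (auto simp: indicator_def mult_left_le_one_le)
      have lim: "(\<lambda>n. S 0 (real (Suc n) * (x - c))) \<longlonglongrightarrow> (if x > c then 1 else 0)" for x c
      proof (cases "x > c")
        case True
        obtain N where N: "1 / (x - c) < real N" using reals_Archimedean2 by blast
        have "S 0 (real (Suc n) * (x - c)) = 1" if "n \<ge> N" for n
        proof (rule S(3))
          have "1 / (x - c) \<le> real (Suc n)" using N that by simp
          then show "1 \<le> real (Suc n) * (x - c)" using True by (simp add: pos_divide_le_eq)
        qed
        then have "\<forall>\<^sub>F n in sequentially. S 0 (real (Suc n) * (x - c)) = 1"
          using eventually_sequentially by blast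
        then show ?thesis using True by (simp add: tendsto_eventually)
      next
        case False
        then show ?thesis using S(2) by (simp add: mult_nonneg_nonpos)
      qed
      have "(\<lambda>n. D n 0 x) \<longlonglongrightarrow> indicator {a<..b} x" for x
        using tendsto_diff[OF lim[of x a] lim[of x b]] ab by (auto simp: D_def indicator_def split: if_splits)
      then show "AE x in lborel. (\<lambda>n. D n 0 x *\<^sub>R g x) \<longlonglongrightarrow> indicat_real {a<..b} x *\<^sub>R g x"
        by (auto intro!: tendsto_scaleR)
    qed
    have "u a - u b = - (LINT x|lborel. indicator {a<..b} x *\<^sub>R g x)"
      using LIMSEQ_unique[OF L1 ] tendsto_minus[OF L2] by (simp only: eq)
    moreover have "(LINT x|lborel. indicator {a<..b} x *\<^sub>R g x) = (LINT x|lborel. indicator {a..b} x *\<^sub>R g x)"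
    proof (rule integral_cong_AE)
      show "AE x in lborel. indicat_real {a<..b} x *\<^sub>R g x = indicat_real {a..b} x *\<^sub>R g x"
        using AE_lborel_singleton[of a] by eventually_elim (auto simp: indicator_def)
    qed (use L1_locD(1)[OF g] in auto)
    ultimately show ?thesis by (simp add: set_lebesgue_integral_def algebra_simps)
  qed
  then have "(g has_integral (u b - u a)) {a..b}" if "a \<le> b" for a b
    using L1_loc_has_integral[OF g, of a b] that by (cases "a = b") auto
  then show ?thesis using g by (simp add: primitive_def)
qed

text \<open>Integrate the derivative of the product of \<psi> and \<open>u\<close> over an interval
  larger than the support of \<psi>: the boundary terms vanish.\<close>

lemma primitive_imp_weak_deriv:
  fixes u :: "real \<Rightarrow> 'a::{real_normed_field,euclidean_space}"
  assumes p: "primitive u g"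
  shows "has_weak_deriv u g"
  unfolding has_weak_deriv_def
proof (intro conjI allI impI)
  show "u \<in> L1_loc" using primitive_continuous[OF p] by (rule L1_loc_continuous)
  show "g \<in> L1_loc" using p by (simp add: primitive_def)
  fix \<psi> assume t: "test_function \<psi>"
  have C1: "C_class 1 \<psi>" using t by (simp add: test_function_def)
  then have d: "(\<psi> has_real_derivative deriv \<psi> x) (at x)" for x
    by (auto simp: C_class_def differentiable_on_def real_differentiable_def DERIV_deriv_iff_real_differentiable)
  have c: "continuous_on UNIV (deriv \<psi>)" using C1 by (simp add: C_class_def)
  have P: "primitive \<psi> (deriv \<psi>)"
    by (rule primitive_C1[OF _ c]) (simp add: d flip: has_real_derivative_iff_has_vector_derivative)
  have "bounded (closure {x. \<psi> x \<noteq> 0})" using t by (simp add: test_function_def compact_imp_bounded)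
  then obtain R where R: "R > 0" "\<And>x. x \<in> closure {x. \<psi> x \<noteq> 0} \<Longrightarrow> \<bar>x\<bar> \<le> R"
    unfolding bounded_pos real_norm_def by blast
  have \<psi>0: "\<psi> x = 0" if "\<bar>x\<bar> > R" for x
    using R(2)[of x] that closure_subset[of "{x. \<psi> x \<noteq> 0}"] by (meson in_mono mem_Collect_eq not_le)
  have \<psi>'0: "deriv \<psi> x = 0" if x: "\<bar>x\<bar> > R" for x
  proof -
    have "(\<psi> has_real_derivative 0) (at x)"
      by (rule has_field_derivative_transform_within_open[of "\<lambda>_. 0" 0 x "- {-R..R}"]) (use x \<psi>0 in auto)
    then show ?thesis by (rule DERIV_imp_deriv)
  qed
  have "primitive (\<lambda>x. (of_real (\<psi> x) :: 'a)) (\<lambda>x. of_real (deriv \<psi> x))"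
    by (rule primitive_bounded_linear[OF P bounded_linear_of_real])
  note pm = primitive_mult[OF this p]
  \<comment> \<open>\<psi> is known to vanish only strictly beyond \<open>R\<close>, hence the
    margin 1.\<close>
  have out: "\<bar>x\<bar> > R" if "x \<notin> {-R-1..R+1}" for x using that by auto
  from pm
  have "primitive (\<lambda>x. \<psi> x *\<^sub>R u x) (\<lambda>x. deriv \<psi> x *\<^sub>R u x + \<psi> x *\<^sub>R g x)"
    by (simp add: scaleR_conv_of_real)
  from primitive_integral[OF this, of "-R-1" "R+1"] R(1)
  have "(LINT x:{-R-1..R+1}|lborel. deriv \<psi> x *\<^sub>R u x + \<psi> x *\<^sub>R g x) = 0"
    using \<psi>0[of "R+1"] \<psi>0[of "-R-1"] by simp
  also have "(LINT x:{-R-1..R+1}|lborel. deriv \<psi> x *\<^sub>R u x + \<psi> x *\<^sub>R g x) =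
     (LINT x:{-R-1..R+1}|lborel. deriv \<psi> x *\<^sub>R u x) + (LINT x:{-R-1..R+1}|lborel. \<psi> x *\<^sub>R g x)"
  proof (rule set_integral_add(2))
    have "(\<lambda>x. deriv \<psi> x *\<^sub>R u x) \<in> L1_loc"
      by (intro L1_loc_continuous continuous_intros c primitive_continuous[OF p])
    then show "set_integrable lborel {-R-1..R+1} (\<lambda>x. deriv \<psi> x *\<^sub>R u x)" by (rule L1_locD)
    have "(\<lambda>x. of_real (\<psi> x) * g x) \<in> L1_loc"
      using p primitive_continuous[OF P] by (intro L1_loc_mult_continuous continuous_intros) (auto simp: primitive_def)
    then show "set_integrable lborel {-R-1..R+1} (\<lambda>x. \<psi> x *\<^sub>R g x)" by (auto dest: L1_locD simp: scaleR_conv_of_real)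
  qed
  also have "(LINT x:{-R-1..R+1}|lborel. deriv \<psi> x *\<^sub>R u x) = (LINT x|lborel. deriv \<psi> x *\<^sub>R u x)"
    unfolding set_lebesgue_integral_def
    by (rule Bochner_Integration.integral_cong) (use \<psi>'0[OF out] in \<open>auto simp: indicator_def\<close>)
  also have "(LINT x:{-R-1..R+1}|lborel. \<psi> x *\<^sub>R g x) = (LINT x|lborel. \<psi> x *\<^sub>R g x)"
    unfolding set_lebesgue_integral_def
    by (rule Bochner_Integration.integral_cong) (use \<psi>0[OF out] in \<open>auto simp: indicator_def\<close>)
  finally show "(LINT x|lborel. deriv \<psi> x *\<^sub>R u x) = - (LINT x|lborel. \<psi> x *\<^sub>R g x)"
    by (simp add: eq_neg_iff_add_eq_0)
qed

text \<open>Truncation to [-n, n] makes \<open>g\<close> integrable. The sets over which it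
  integrates to 0 are closed under complements and countable disjoint unions and contain the
  intersection-stable family of closed intervals, hence include all Borel sets.\<close>

lemma AE_zero_if_interval_integrals_zero:
  fixes g :: "real \<Rightarrow> 'a::euclidean_space"
  assumes g: "g \<in> L1_loc" and zero: "\<And>a b. a \<le> b \<Longrightarrow> (LINT x:{a..b}|lborel. g x) = 0"
  shows "AE x in lborel. g x = 0"
proof -
  have "AE x in lborel. indicator {- real n..real n} x *\<^sub>R g x = 0" for n
  proof (rule sigma_finite_measure.density_zero[OF sigma_finite_lborel])
    define h where "h = (\<lambda>x. indicator {- real n..real n} x *\<^sub>R g x)"
    show int: "integrable lborel (\<lambda>x. indicator {- real n..real n} x *\<^sub>R g x)"
      using L1_locD(2)[OF g] by (simp add: set_integrable_def)
    then have h: "integrable lborel h" by (simp add: h_def)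
    have si: "set_integrable lborel A h" if "A \<in> sets borel" for A
      using that h unfolding set_integrable_def by (intro integrable_mult_indicator) auto
    have box: "set_lebesgue_integral lborel {a..b} h = 0" for a b
    proof -
      have "set_lebesgue_integral lborel {a..b} h = (LINT x:{max a (-n)..min b n}|lborel. g x)"
        unfolding set_lebesgue_integral_def h_def
        by (rule Bochner_Integration.integral_cong) (auto simp: indicator_def)
      also have "\<dots> = 0"
        using zero[of "max a (-n)" "min b n"] by (cases "max a (-n) \<le> min b n") (auto simp: set_lebesgue_integral_def)
      finally show ?thesis .
    qed
    have all: "set_lebesgue_integral lborel UNIV h = 0"
    proof -
      have "set_lebesgue_integral lborel UNIV h = set_lebesgue_integral lborel {-real n..real n} h"
        unfolding set_lebesgue_integral_def h_def
        by (rule Bochner_Integration.integral_cong) (auto simp: indicator_def)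
      then show ?thesis using box by simp
    qed
    fix A :: "real set" assume "A \<in> sets lborel"
    then have "A \<in> sigma_sets UNIV (range (\<lambda>(a, b). {a..b :: real}))"
      by (simp add: arg_cong[OF borel_eq_atLeastAtMost, of sets])
    note A = this
    have "Int_stable (range (\<lambda>(a, b). {a..b :: real}))"
      by (auto simp: Int_stable_def)
    moreover have "range (\<lambda>(a, b). {a..b :: real}) \<subseteq> Pow UNIV" by simp
    ultimately have "A \<in> sets borel \<and> set_lebesgue_integral lborel A h = 0"
      using A
    proof (induction rule: sigma_sets_induct_disjoint)
      case (basic A) then show ?case using box by auto
    next
      case empty show ?case by (simp add: set_lebesgue_integral_def)
    next
      case (compl A)
      have "set_lebesgue_integral lborel UNIV h = set_lebesgue_integral lborel (A \<union> (UNIV - A)) h" by simp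
      also have "\<dots> = set_lebesgue_integral lborel A h + set_lebesgue_integral lborel (UNIV - A) h"
        using compl by (intro set_integral_Un si) auto
      finally show ?case using all compl by auto
    next
      case (union A)
      have "(\<Sum>i. set_lebesgue_integral lborel (A i) h) = set_lebesgue_integral lborel (\<Union>i. A i) h"
        using union by (intro lebesgue_integral_countable_add[symmetric] si) (auto simp: disjoint_family_on_def)
      then show ?case using union by auto
    qed
    then show "set_lebesgue_integral lborel A (\<lambda>x. indicator {- real n..real n} x *\<^sub>R g x) = 0"
      by (simp add: h_def)
  qed
  then have "AE x in lborel. \<forall>n. indicator {- real n..real n} x *\<^sub>R g x = 0"
    unfolding AE_all_countable by blast
  then show ?thesis
  proof eventually_elim
    case (elim x)
    obtain n where "\<bar>x\<bar> \<le> real n" using real_arch_simple by blast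
    with elim[rule_format, of n] show ?case by (auto simp: indicator_def abs_le_iff split: if_splits)
  qed
qed

lemma primitive_unique_AE:
  fixes u :: "real \<Rightarrow> 'a::euclidean_space"
  assumes "primitive u g" "primitive u k"
  shows "AE x in lborel. g x = k x"
proof -
  have p: "primitive (\<lambda>x. u x + (-1) *\<^sub>R u x) (\<lambda>x. g x + (-1) *\<^sub>R k x)"
    by (intro primitive_add primitive_scaleR assms)
  then have "(\<lambda>x. g x + (-1) *\<^sub>R k x) \<in> L1_loc" by (simp add: primitive_def)
  then have "AE x in lborel. g x + (-1) *\<^sub>R k x = 0"
    by (rule AE_zero_if_interval_integrals_zero) (rule trans[OF primitive_integral[OF p]], auto)
  then show ?thesis by eventually_elim simp
qed

lemma weak_deriv_AE:
  fixes u :: "real \<Rightarrow> 'a::{real_normed_field,euclidean_space}"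
  assumes "primitive u g"
  shows "AE x in lborel. weak_deriv u x = g x" "primitive u (weak_deriv u)"
proof -
  have "has_weak_deriv u (weak_deriv u)"
    unfolding weak_deriv_def by (rule someI[of _ g]) (rule primitive_imp_weak_deriv[OF assms])
  then show p: "primitive u (weak_deriv u)"
    by (rule weak_deriv_imp_primitive[OF primitive_continuous[OF assms]])
  show "AE x in lborel. weak_deriv u x = g x"
    by (rule primitive_unique_AE[OF p assms])
qed

section \<open>Polar coordinates\<close>

text \<open>\<open>r\<close> and \<open>s\<close> stand for the derivatives of modulus and phase.
  The phase itself is absent and \<open>s\<close> need only be measurable: it is locally integrable
  because \<rho> is bounded away from 0, so any such \<open>s\<close> has a phase as
  primitive.\<close>

definition polar :: "(real \<Rightarrow> real) \<Rightarrow> (real \<Rightarrow> real) \<Rightarrow> (real \<Rightarrow> real) \<Rightarrow> (real \<Rightarrow> real) \<Rightarrow> bool" where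
  "polar f \<rho> r s \<longleftrightarrow> primitive \<rho> r \<and> s \<in> borel_measurable borel \<and> (\<exists>d>0. \<forall>x. d \<le> \<rho> x) \<and>
     integrable lborel (\<lambda>x. (r x)\<^sup>2) \<and> integrable lborel (\<lambda>x. (\<rho> x * s x)\<^sup>2) \<and>
     integrable lborel (\<lambda>x. F_pot f ((\<rho> x)\<^sup>2))"

definition polar_energy :: "(real \<Rightarrow> real) \<Rightarrow> (real \<Rightarrow> real) \<Rightarrow> (real \<Rightarrow> real) \<Rightarrow> (real \<Rightarrow> real) \<Rightarrow> real" where
  "polar_energy f \<rho> r s = 1/2 * (LINT x|lborel. (r x)\<^sup>2 + (\<rho> x * s x)\<^sup>2 + F_pot f ((\<rho> x)\<^sup>2))"

definition polar_momentum :: "(real \<Rightarrow> real) \<Rightarrow> (real \<Rightarrow> real) \<Rightarrow> real" where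
  "polar_momentum \<rho> s = 1/2 * (LINT x|lborel. (1 - (\<rho> x)\<^sup>2) * s x)"

lemma L1_loc_square_integrable:
  fixes s :: "real \<Rightarrow> real"
  assumes "s \<in> borel_measurable borel" "integrable lborel (\<lambda>x. (s x)\<^sup>2)"
  shows "s \<in> L1_loc"
proof (rule L1_loc_dominated)
  show "(\<lambda>x. 1 + (s x)\<^sup>2) \<in> L1_loc"
  proof (rule L1_loc_add)
    show "(\<lambda>x. 1 :: real) \<in> L1_loc" by (intro L1_loc_continuous continuous_intros)
    show "(\<lambda>x. (s x)\<^sup>2) \<in> L1_loc"
      using assms integrable_mult_indicator[OF _ assms(2)] by (intro L1_locI) (auto simp: set_integrable_def)
  qed
  show "norm (s x) \<le> norm (1 + (s x)\<^sup>2)" for x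
  proof -
    have "0 \<le> (\<bar>s x\<bar> - 1)\<^sup>2" by simp
    then have "2 * \<bar>s x\<bar> \<le> 1 + (s x)\<^sup>2" unfolding power2_diff by simp
    then show ?thesis by simp
  qed
qed fact

lemma polar_phase_L1_loc:
  assumes "polar f \<rho> r s"
  shows "s \<in> L1_loc"
proof -
  obtain d where d: "d > 0" "\<And>x. d \<le> \<rho> x" using assms by (auto simp: polar_def)
  have s: "s \<in> borel_measurable borel" using assms by (simp add: polar_def)
  have "integrable lborel (\<lambda>x. (s x)\<^sup>2)"
  proof (rule Bochner_Integration.integrable_bound)
    show "integrable lborel (\<lambda>x. (1 / d\<^sup>2) * (\<rho> x * s x)\<^sup>2)"
      using assms by (intro integrable_mult_right) (simp add: polar_def)
    have "(s x)\<^sup>2 \<le> (1 / d\<^sup>2) * (\<rho> x * s x)\<^sup>2" for x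
    proof -
      have "d\<^sup>2 * (s x)\<^sup>2 \<le> (\<rho> x)\<^sup>2 * (s x)\<^sup>2"
        using d by (intro mult_right_mono power_mono) (auto intro: less_imp_le)
      then show ?thesis using d(1) by (simp add: field_simps power_mult_distrib)
    qed
    then show "AE x in lborel. norm ((s x)\<^sup>2) \<le> norm (1 / d\<^sup>2 * (\<rho> x * s x)\<^sup>2)" by simp
  qed (use s in auto)
  then show ?thesis using L1_loc_square_integrable s by blast
qed

lemma L2_loc_integrable:
  fixes g :: "real \<Rightarrow> 'a::euclidean_space"
  assumes "g \<in> borel_measurable borel" "integrable lborel (\<lambda>x. (norm (g x))\<^sup>2)"
  shows "g \<in> L2_loc"
  using assms unfolding L2_loc_def set_integrable_def
  by (auto intro!: integrable_mult_indicator borel_compact simp del: real_scaleR_def)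

lemma H1_locI:
  fixes u :: "real \<Rightarrow> 'a::{real_normed_field,euclidean_space}"
  assumes "primitive u g" "integrable lborel (\<lambda>x. (norm (g x))\<^sup>2)"
  shows "u \<in> H1_loc"
proof -
  have c: "continuous_on UNIV u" by (rule primitive_continuous[OF assms(1)])
  have "u \<in> L2_loc"
    unfolding L2_loc_def set_integrable_def
    using c by (auto intro!: borel_integrable_compact continuous_intros borel_measurable_continuous_onI
        simp del: real_scaleR_def intro: continuous_on_subset)
  moreover have "g \<in> L2_loc"
    using assms by (intro L2_loc_integrable) (auto simp: primitive_def dest: L1_locD)
  ultimately show ?thesis
    using c primitive_imp_weak_deriv[OF assms(1)] by (auto simp: H1_loc_def)
qed

lemma primitive_measurable:
  fixes u :: "real \<Rightarrow> 'a::euclidean_space"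
  assumes "primitive u g"
  shows "u \<in> borel_measurable borel" "g \<in> borel_measurable borel"
  using assms primitive_continuous[OF assms] by (auto simp: primitive_def dest: L1_locD borel_measurable_continuous_onI)

text \<open>The representative behind \<open>weak_deriv\<close> is an arbitrary choice; here it is
  traded for a known derivative \<open>g\<close>, with which it agrees almost everywhere.\<close>

lemma X1_energy:
  assumes p: "primitive u g" and i: "integrable lborel (\<lambda>x. (cmod (g x))\<^sup>2)"
    "integrable lborel (\<lambda>x. F_pot f ((cmod (u x))\<^sup>2))"
  shows "u \<in> X1 f" "energy f u = 1/2 * (LINT x|lborel. (cmod (g x))\<^sup>2 + F_pot f ((cmod (u x))\<^sup>2))"
proof -
  have AE: "AE x in lborel. (cmod (weak_deriv u x))\<^sup>2 = (cmod (g x))\<^sup>2"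
    using weak_deriv_AE(1)[OF p] by eventually_elim simp
  note m = primitive_measurable[OF p] primitive_measurable[OF weak_deriv_AE(2)[OF p]]
  have "integrable lborel (\<lambda>x. (cmod (weak_deriv u x))\<^sup>2)"
    by (rule integrable_cong_AE_imp[OF i(1)]) (use AE m in auto)
  then show "u \<in> X1 f" using H1_locI[OF p i(1)] i(2) by (simp add: X1_def)
  have "(LINT x|lborel. (cmod (weak_deriv u x))\<^sup>2) = (LINT x|lborel. (cmod (g x))\<^sup>2)"
    by (rule integral_cong_AE) (use AE m in auto)
  then show "energy f u = 1/2 * (LINT x|lborel. (cmod (g x))\<^sup>2 + F_pot f ((cmod (u x))\<^sup>2))"
    using i by (simp add: energy_def algebra_simps)
qed

text \<open>Two continuous phases of one function differ by a continuous function with values in 2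
  pi Z, hence by a constant. This frees the momentum from the choice made in
  \<open>phase\<close>.\<close>

lemma phase_eq:
  assumes u: "\<And>x. u x = complex_of_real (\<rho> x) * exp (\<i> * complex_of_real (\<phi> x))"
    and \<rho>: "\<And>x. \<rho> x > 0" and \<phi>: "continuous_on UNIV \<phi>"
  obtains c where "\<And>x. phase u x = \<phi> x + c"
proof -
  have cm: "cmod (u x) = \<rho> x" for x
    using \<rho>[of x] by (simp add: u norm_mult)
  define \<theta> where "\<theta> = phase u"
  have "continuous_on UNIV \<phi> \<and> (\<forall>x. u x = complex_of_real (cmod (u x)) * exp (\<i> * complex_of_real (\<phi> x)))"
    using u \<phi> cm by simp
  then have "continuous_on UNIV \<theta> \<and> (\<forall>x. u x = complex_of_real (cmod (u x)) * exp (\<i> * complex_of_real (\<theta> x)))"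
    unfolding \<theta>_def phase_def
    by (rule someI[of "\<lambda>\<phi>. continuous_on UNIV \<phi> \<and>
      (\<forall>x. u x = complex_of_real (cmod (u x)) * exp (\<i> * complex_of_real (\<phi> x)))"])
  then have c\<theta>: "continuous_on UNIV \<theta>" and
    u\<theta>: "\<And>x. u x = complex_of_real (\<rho> x) * exp (\<i> * complex_of_real (\<theta> x))" by (auto simp: cm)
  define h where "h x = (\<theta> x - \<phi> x) / (2 * pi)" for x
  have hZ: "h x \<in> \<int>" for x
  proof -
    have "exp (\<i> * complex_of_real (\<theta> x)) = exp (\<i> * complex_of_real (\<phi> x))"
      using u[of x] u\<theta>[of x] \<rho>[of x] by auto
    then obtain n :: int where "\<i> * complex_of_real (\<theta> x) = \<i> * complex_of_real (\<phi> x) + (of_int (2 * n) * pi) * \<i>"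
      unfolding exp_eq by auto
    then have "Im (\<i> * complex_of_real (\<theta> x)) = Im (\<i> * complex_of_real (\<phi> x) + (of_int (2 * n) * pi) * \<i>)" by simp
    then have "\<theta> x = \<phi> x + 2 * of_int n * pi" by simp
    then have "h x = of_int n" by (simp add: h_def)
    then show ?thesis by simp
  qed
  have "h constant_on UNIV"
  proof (rule continuous_discrete_range_constant)
    show "continuous_on UNIV h" unfolding h_def by (intro continuous_intros c\<theta> \<phi>) auto
    show "\<exists>e>0. \<forall>y. y \<in> UNIV \<and> h y \<noteq> h x \<longrightarrow> e \<le> norm (h y - h x)" for x
    proof (intro exI[of _ 1] conjI allI impI)
      fix y assume "y \<in> UNIV \<and> h y \<noteq> h x"
      moreover have "h y - h x \<in> \<int>" using hZ by auto
      ultimately show "1 \<le> norm (h y - h x)" using Ints_nonzero_abs_ge1 by fastforce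
    qed simp
  qed auto
  then obtain k where "\<And>x. h x = k" by (auto simp: constant_on_def)
  then have "phase u x = \<phi> x + 2 * pi * k" for x
    by (simp add: h_def \<theta>_def field_simps)
  then show ?thesis by (rule that)
qed

lemma polar_NX1:
  assumes p: "polar f \<rho> r s" and \<phi>: "primitive \<phi> s"
    and u: "\<And>x. u x = complex_of_real (\<rho> x) * exp (\<i> * complex_of_real (\<phi> x))"
  shows "u \<in> NX1 f" "energy f u = polar_energy f \<rho> r s" "momentum u = polar_momentum \<rho> s"
proof -
  obtain d where d: "d > 0" "\<And>x. d \<le> \<rho> x" using p by (auto simp: polar_def)
  have \<rho>: "\<rho> x > 0" for x using d(1) d(2)[of x] by simp
  have cm: "cmod (u x) = \<rho> x" for x
    using \<rho>[of x] by (simp add: u norm_mult)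
  have pr: "primitive \<rho> r" using p by (simp add: polar_def)
  \<comment> \<open>By the product rule u' = exp (i \<phi>) (r + i \<rho> s); real and imaginary
    part give the two kinetic terms without a cross term.\<close>
  define g where "g x = exp (\<i> * complex_of_real (\<phi> x)) * Complex (r x) (\<rho> x * s x)" for x
  have "primitive (\<lambda>x. exp (\<i> * complex_of_real (\<phi> x))) (\<lambda>x. exp (\<i> * complex_of_real (\<phi> x)) * (\<i> * complex_of_real (s x)))"
    by (rule primitive_chain[OF primitive_cmult[OF primitive_of_real[OF \<phi>]]]) (auto intro!: derivative_eq_intros continuous_intros)
  from primitive_mult[OF primitive_of_real[OF pr] this]
  have ug: "primitive u g"
    by (simp add: u[abs_def] g_def[abs_def] Complex_eq algebra_simps)
  have ng: "(cmod (g x))\<^sup>2 = (r x)\<^sup>2 + (\<rho> x * s x)\<^sup>2" for x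
    by (simp add: g_def norm_mult power_mult_distrib cmod_power2)
  have "integrable lborel (\<lambda>x. (cmod (g x))\<^sup>2)"
    using p by (simp add: ng polar_def)
  note X = X1_energy[OF ug this, of f, unfolded cm ng]
  have i: "integrable lborel (\<lambda>x. F_pot f ((\<rho> x)\<^sup>2))" using p by (simp add: polar_def)
  show "energy f u = polar_energy f \<rho> r s"
    using X(2)[OF i] by (simp add: polar_energy_def)
  have "d \<le> (INF x. cmod (u x))"
    using d by (intro cINF_greatest) (auto simp: cm)
  then show "u \<in> NX1 f" using X(1)[OF i] d(1) by (simp add: NX1_def)
  obtain c where c: "\<And>x. phase u x = \<phi> x + c"
    using phase_eq[OF u \<rho> primitive_continuous[OF \<phi>]] by blast
  have "primitive (phase u) s" using \<phi> c by (simp add: primitive_def)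
  note w = weak_deriv_AE[OF this]
  have "(LINT x|lborel. (1 - (\<rho> x)\<^sup>2) * weak_deriv (phase u) x) = (LINT x|lborel. (1 - (\<rho> x)\<^sup>2) * s x)"
    using w(1) primitive_measurable[OF pr] primitive_measurable[OF w(2)] primitive_measurable[OF \<phi>]
    by (intro integral_cong_AE) auto
  then show "momentum u = polar_momentum \<rho> s"
    by (simp add: momentum_def polar_momentum_def cm)
qed

lemma polar_realized:
  assumes p: "polar f \<rho> r s"
  obtains u where "u \<in> NX1 f" "energy f u = polar_energy f \<rho> r s" "momentum u = polar_momentum \<rho> s"
proof -
  obtain \<phi> where "primitive \<phi> s" using primitive_exists[OF polar_phase_L1_loc[OF p]] by blast
  from polar_NX1[OF p this, of "\<lambda>x. complex_of_real (\<rho> x) * exp (\<i> * complex_of_real (\<phi> x))"]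
  show ?thesis by (intro that) auto
qed

text \<open>A global logarithm without any lifting argument: let \<open>L\<close> be a primitive of
  u'/u. Then u exp (-L) has derivative 0 and equals 1 at 0, so u = exp L, and real and imaginary
  part of \<open>L\<close> give the logarithm of the modulus and the phase.\<close>

lemma NX1_polar:
  assumes "u \<in> NX1 f"
  obtains \<rho> r s where "polar f \<rho> r s" "energy f u = polar_energy f \<rho> r s" "momentum u = polar_momentum \<rho> s"
proof -
  have uX: "u \<in> H1_loc" "integrable lborel (\<lambda>x. (cmod (weak_deriv u x))\<^sup>2)"
    "integrable lborel (\<lambda>x. F_pot f ((cmod (u x))\<^sup>2))" and inf: "(INF x. cmod (u x)) > 0"
    using assms by (auto simp: NX1_def X1_def)
  define g where "g = weak_deriv u"
  define d where "d = (INF x. cmod (u x))"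
  have d: "d > 0" "d \<le> cmod (u x)" for x
    using inf by (auto simp: d_def intro!: cINF_lower bdd_belowI[of _ 0])
  have u0: "u x \<noteq> 0" for x using d(1) d(2)[of x] by auto
  have ug: "primitive u g"
    using uX(1) unfolding g_def H1_loc_def by (auto intro: weak_deriv_AE(2) weak_deriv_imp_primitive)
  define q where "q x = inverse (u x) * g x" for x
  have q: "q \<in> L1_loc"
    unfolding q_def using ug primitive_continuous[OF ug] u0
    by (intro L1_loc_mult_continuous continuous_intros) (auto simp: primitive_def)
  obtain L where L: "primitive L q" "L 0 = Ln (u 0)" using primitive_exists[OF q] by blast
  have "primitive (\<lambda>x. exp (- L x)) (\<lambda>x. - exp (- L x) * q x)"
    by (rule primitive_chain[OF L(1)]) (auto intro!: derivative_eq_intros continuous_intros)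
  note P = primitive_mult[OF ug this]
  have "g x * exp (- L x) + u x * (- exp (- L x) * q x) = 0" for x
  proof -
    have "u x * (exp (- L x) * q x) = exp (- L x) * (u x * q x)" by (simp only: ac_simps)
    also have "u x * q x = g x" using u0[of x] by (simp add: q_def)
    finally show ?thesis by simp
  qed
  note P = P[unfolded this]
  have const: "u b * exp (- L b) = u a * exp (- L a)" if "a \<le> b" for a b
    using primitive_integral[OF P that] by (simp add: set_lebesgue_integral_def)
  have "u x * exp (- L x) = u 0 * exp (- L 0)" for x
    using const[of 0 x] const[of x 0] by (cases "0 \<le> x") auto
  moreover have "u 0 * exp (- L 0) = 1"
    using u0[of 0] L(2) by (simp add: exp_minus)
  ultimately have uL1: "u x * exp (- L x) = 1" for x by simp
  have uL: "u x = exp (L x)" for x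
  proof -
    have "u x = u x * exp (- L x) * exp (L x)" by (simp add: mult.assoc flip: exp_add)
    then show ?thesis by (simp only: uL1 mult_1)
  qed
  define \<rho> where "\<rho> x = exp (Re (L x))" for x
  define \<phi> where "\<phi> x = Im (L x)" for x
  define r where "r x = \<rho> x * Re (q x)" for x
  define s where "s x = Im (q x)" for x
  have \<phi>: "primitive \<phi> s"
    unfolding \<phi>_def s_def by (rule primitive_bounded_linear[OF L(1) bounded_linear_Im])
  have pr: "primitive \<rho> r"
    unfolding \<rho>_def r_def
    by (rule primitive_chain[OF primitive_bounded_linear[OF L(1) bounded_linear_Re]])
      (auto intro!: derivative_eq_intros continuous_intros)
  have u: "u x = complex_of_real (\<rho> x) * exp (\<i> * complex_of_real (\<phi> x))" for x
    unfolding uL \<rho>_def \<phi>_def using exp_eq_polar[of "L x"] by (simp only: cis_conv_exp)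
  have cm: "cmod (u x) = \<rho> x" for x by (simp add: uL \<rho>_def)
  have ng: "(cmod (g x))\<^sup>2 = (r x)\<^sup>2 + (\<rho> x * s x)\<^sup>2" for x
  proof -
    have "g x = u x * q x" using u0[of x] by (simp add: q_def)
    then have "(cmod (g x))\<^sup>2 = (\<rho> x)\<^sup>2 * (cmod (q x))\<^sup>2" by (simp add: norm_mult cm power_mult_distrib)
    then show ?thesis unfolding cmod_power2[of "q x"] by (simp add: r_def s_def power_mult_distrib algebra_simps)
  qed
  have "polar f \<rho> r s"
    unfolding polar_def
  proof (intro conjI)
    have i: "integrable lborel (\<lambda>x. (r x)\<^sup>2 + (\<rho> x * s x)\<^sup>2)"
      using uX(2) by (simp flip: ng add: g_def)
    note m = primitive_measurable[OF \<phi>] primitive_measurable[OF pr]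
    show "integrable lborel (\<lambda>x. (r x)\<^sup>2)" "integrable lborel (\<lambda>x. (\<rho> x * s x)\<^sup>2)"
      by (rule Bochner_Integration.integrable_bound[OF i]; use m in simp)+
    show "\<exists>d>0. \<forall>x. d \<le> \<rho> x" using d by (auto simp: cm)
    show "s \<in> borel_measurable borel" using m by simp
  qed (use pr uX(3) in \<open>simp_all add: cm\<close>)
  then show ?thesis using that polar_NX1[OF _ \<phi> u] by blast
qed

lemma E_min_polar:
  "E_min f p = Inf {polar_energy f \<rho> r s | \<rho> r s. polar f \<rho> r s \<and> polar_momentum \<rho> s = p}"
proof -
  have "{energy f v | v. v \<in> NX1 f \<and> momentum v = p} =
    {polar_energy f \<rho> r s | \<rho> r s. polar f \<rho> r s \<and> polar_momentum \<rho> s = p}" (is "?A = ?B")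
  proof
    show "?A \<subseteq> ?B"
    proof
      fix e assume "e \<in> ?A"
      then obtain v where v: "v \<in> NX1 f" "e = energy f v" "momentum v = p" by blast
      obtain \<rho> r s where "polar f \<rho> r s" "energy f v = polar_energy f \<rho> r s" "momentum v = polar_momentum \<rho> s"
        using NX1_polar[OF v(1)] by blast
      with v show "e \<in> ?B" by auto
    qed
    show "?B \<subseteq> ?A"
    proof
      fix e assume "e \<in> ?B"
      then obtain \<rho> r s where p: "polar f \<rho> r s" "e = polar_energy f \<rho> r s" "polar_momentum \<rho> s = p" by blast
      obtain u where "u \<in> NX1 f" "energy f u = polar_energy f \<rho> r s" "momentum u = polar_momentum \<rho> s"
        using polar_realized[OF p(1)] by blast
      with p show "e \<in> ?A" by (metis (mono_tags, lifting) mem_Collect_eq)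
    qed
  qed
  then show ?thesis by (simp add: E_min_def)
qed

section \<open>Long-wave test functions\<close>

lemma DERIV_pos_part_square:
  "((\<lambda>y. (max 0 y)\<^sup>2) has_real_derivative 2 * max 0 y) (at (y::real))"
proof -
  consider "y > 0" | "y = 0" | "y < 0" by linarith
  then show ?thesis
  proof cases
    case 1
    have "((\<lambda>y. y\<^sup>2) has_real_derivative 2 * max 0 y) (at y)"
      using 1 by (auto intro!: derivative_eq_intros)
    then show ?thesis
      by (rule has_field_derivative_transform_within_open[of _ _ _ "{0<..}"]) (use 1 in auto)
  next
    case 2
    have "\<bar>(max 0 z)\<^sup>2\<bar> \<le> 1 * (z - 0)\<^sup>2" for z :: real
      by (auto simp: max_def)
    from has_derivative_zero_if_quadratic_bound[OF this] 2 show ?thesis by simp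
  next
    case 3
    have "((\<lambda>y. 0) has_real_derivative 2 * max 0 y) (at y)" using 3 by simp
    then show ?thesis
      by (rule has_field_derivative_transform_within_open[of _ _ _ "{..<0}"]) (use 3 in auto)
  qed
qed

text \<open>One C^1 function with two uses: as compactly supported profile of the long waves, and,
  composed with the modulus, as the square of the positive part of 1 - \<rho>^2, which obeys the
  chain rule although the positive part alone has a corner.\<close>

definition hat :: "real \<Rightarrow> real" where "hat x = (max 0 (1 - x\<^sup>2))\<^sup>2"
definition hat' :: "real \<Rightarrow> real" where "hat' x = - (4 * x * max 0 (1 - x\<^sup>2))"

lemma DERIV_hat: "(hat has_real_derivative hat' x) (at x)"
proof -
  have "((\<lambda>x. (max 0 (1 - x\<^sup>2))\<^sup>2) has_real_derivative 2 * max 0 (1 - x\<^sup>2) * (- (2 * x))) (at x)"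
    by (rule DERIV_chain2[OF DERIV_pos_part_square]) (auto intro!: derivative_eq_intros)
  then show ?thesis by (simp add: hat_def[abs_def] hat'_def algebra_simps)
qed

lemma continuous_hat: "continuous_on A hat" "continuous_on A hat'"
  unfolding hat_def[abs_def] hat'_def[abs_def] by (intro continuous_intros)+

lemma hat_bounds: "0 \<le> hat x" "hat x \<le> 1"
proof -
  show "0 \<le> hat x" by (simp add: hat_def)
  have "(max 0 (1 - x\<^sup>2))\<^sup>2 \<le> 1\<^sup>2" by (rule power_mono) auto
  then show "hat x \<le> 1" by (simp add: hat_def)
qed

lemma hat_outside: "\<bar>x\<bar> \<ge> 1 \<Longrightarrow> hat x = 0" "\<bar>x\<bar> \<ge> 1 \<Longrightarrow> hat' x = 0"
  using power_mono[of 1 "\<bar>x\<bar>" 2] by (auto simp: hat_def hat'_def max_def)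

lemma integrable_compact_support:
  fixes g :: "real \<Rightarrow> real"
  assumes "continuous_on UNIV g" "\<And>x. \<bar>x\<bar> \<ge> R \<Longrightarrow> g x = 0"
  shows "integrable lborel g"
proof -
  have "integrable lborel (\<lambda>x. indicator {-R..R} x *\<^sub>R g x)"
    by (intro borel_integrable_compact continuous_on_subset[OF assms(1)]) auto
  also have "(\<lambda>x. indicator {-R..R} x *\<^sub>R g x) = g"
  proof
    fix x show "indicator {-R..R} x *\<^sub>R g x = g x"
      using assms(2)[of x] by (cases "x \<in> {-R..R}") auto
  qed
  finally show ?thesis .
qed

text \<open>These integrals become the coefficients of momentum and energy of the long waves. Only
  signs are ever needed, not values.\<close>

definition hat_mass :: "nat \<Rightarrow> real" where "hat_mass k = (LINT x|lborel. hat x ^ k)"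
definition hat_stiffness :: real where "hat_stiffness = (LINT x|lborel. (hat' x)\<^sup>2)"

lemma integrable_hat_power: "k > 0 \<Longrightarrow> integrable lborel (\<lambda>x. hat x ^ k)"
  by (rule integrable_compact_support[where R = 1]) (auto intro!: continuous_intros continuous_hat simp: hat_outside)

lemma hat_mass_pos:
  assumes "k > 0"
  shows "hat_mass k > 0"
proof -
  \<comment> \<open>On [-1/2, 1/2], an interval of length 1, the profile is at least (3/4)^2 =
    9/16.\<close>
  have "(LINT x|lborel. indicator {-1/2..1/2::real} x *\<^sub>R (9/16 :: real) ^ k) \<le> hat_mass k"
    unfolding hat_mass_def
  proof (rule integral_mono)
    show "integrable lborel (\<lambda>x. indicator {-1/2..1/2::real} x *\<^sub>R (9/16 :: real) ^ k)"
      by (intro borel_integrable_compact continuous_intros) auto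
    show "integrable lborel (\<lambda>x. hat x ^ k)" by (rule integrable_hat_power[OF assms])
    show "indicator {-1/2..1/2} x *\<^sub>R (9/16 :: real) ^ k \<le> hat x ^ k" for x :: real
    proof (cases "x \<in> {-1/2..1/2}")
      case True
      then have "\<bar>x\<bar> \<le> 1/2" by auto
      then have "x\<^sup>2 \<le> (1/2)\<^sup>2" using power_mono[of "\<bar>x\<bar>" "1/2" 2] by simp
      then have "x\<^sup>2 \<le> 1/4" by (simp add: power2_eq_square)
      then have "3/4 \<le> max 0 (1 - x\<^sup>2)" by (intro max.coboundedI2) simp
      then have "(3/4)\<^sup>2 \<le> hat x" unfolding hat_def by (rule power_mono) simp
      then have "(9/16) ^ k \<le> hat x ^ k" by (intro power_mono) (auto simp: power2_eq_square)
      then show ?thesis using True by simp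
    qed (simp add: hat_bounds)
  qed
  moreover have "(LINT x|lborel. indicator {-1/2..1/2::real} x *\<^sub>R (9/16 :: real) ^ k) = (9/16) ^ k"
    by (simp add: mult.commute)
  ultimately show ?thesis by (smt (verit) zero_less_power zero_less_divide_iff)
qed

lemma hat_stiffness_nonneg: "hat_stiffness \<ge> 0"
  unfolding hat_stiffness_def by (intro Bochner_Integration.integral_nonneg) auto

lemma integral_dilate:
  fixes g :: "real \<Rightarrow> real"
  assumes "e > 0"
  shows "(LINT x|lborel. g (e * x)) = (LINT x|lborel. g x) / e"
  using lborel_integral_real_affine[of e g 0] assms by simp

section \<open>The nonlinearity, its expansion at 1, and the energy of long waves\<close>

locale nonlinearity =
  fixes f :: "real \<Rightarrow> real"
  assumes C3: "C_class 3 f" and f_one: "f 1 = 0" and deriv_neg: "deriv f 1 < 0"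
    and F_lower: "\<forall>\<rho>\<ge>0. (sound_speed f)\<^sup>2 / 4 * (1 - \<rho>)\<^sup>2 \<le> F_pot f \<rho>"
begin

abbreviation F :: "real \<Rightarrow> real" where "F \<equiv> F_pot f"
abbreviation c :: real where "c \<equiv> sound_speed f"

text \<open>Half the coefficient of h^3 in the energy density of a long wave: F contributes
  f''(1)/6, and the factor 1 - h in front of s^2 contributes -c^2/4 = f'(1)/2.\<close>

definition \<Gamma> :: real where "\<Gamma> = (deriv (deriv f) 1 + 3 * deriv f 1) / 12"

lemma c_pos: "c > 0" and c_sq: "c\<^sup>2 = - 2 * deriv f 1"
  using deriv_neg by (simp_all add: sound_speed_def)

lemma f_derivs:
  "(f has_real_derivative deriv f x) (at x)"
  "(deriv f has_real_derivative deriv (deriv f) x) (at x)"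
  "(deriv (deriv f) has_real_derivative deriv (deriv (deriv f)) x) (at x)"
  "continuous_on UNIV (deriv (deriv (deriv f)))"
proof -
  have d: "\<forall>j<3. (deriv ^^ j) f differentiable_on UNIV" and ct: "continuous_on UNIV ((deriv ^^ 3) f)"
    using C3 by (auto simp: C_class_def)
  have D: "((deriv ^^ j) f has_real_derivative deriv ((deriv ^^ j) f) x) (at x)" if "j < 3" for j
    using d that by (auto simp: differentiable_on_def DERIV_deriv_iff_real_differentiable)
  show "(f has_real_derivative deriv f x) (at x)" using D[of 0] by simp
  show "(deriv f has_real_derivative deriv (deriv f) x) (at x)" using D[of 1] by simp
  show "(deriv (deriv f) has_real_derivative deriv (deriv (deriv f)) x) (at x)"
    using D[of 2] by (simp add: numeral_2_eq_2)
  show "continuous_on UNIV (deriv (deriv (deriv f)))" using ct by (simp add: numeral_3_eq_3)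
qed

lemma f_cont: "continuous_on UNIV f"
  using f_derivs(1) by (auto intro!: continuous_at_imp_continuous_on DERIV_isCont)

lemma F_one: "F 1 = 0"
  by (simp add: F_pot_def)

lemma DERIV_F: "(F has_real_derivative - f x) (at x)"
proof -
  obtain P where P: "primitive P f" using primitive_exists[OF L1_loc_continuous[OF f_cont]] by blast
  have dP: "(P has_vector_derivative f y) (at y)" for y
    by (rule primitive_has_vector_derivative[OF P f_cont])
  have "F y = P 1 - P y" for y
    unfolding F_pot_def
    by (rule interval_integral_FTC_finite)
      (auto intro: continuous_on_subset[OF f_cont] has_vector_derivative_at_within dP)
  then have "F = (\<lambda>y. P 1 - P y)" by auto
  moreover have "((\<lambda>y. P 1 - P y) has_real_derivative - f x) (at x)"
    using dP[of x] by (auto intro!: derivative_eq_intros simp: has_real_derivative_iff_has_vector_derivative)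
  ultimately show ?thesis by simp
qed

lemma F_cont: "continuous_on A F"
  using DERIV_F by (auto intro!: continuous_at_imp_continuous_on DERIV_isCont)

lemma F_ge: "x \<ge> 0 \<Longrightarrow> c\<^sup>2 / 4 * (1 - x)\<^sup>2 \<le> F x"
  using F_lower by blast

lemma F_nonneg: "x \<ge> 0 \<Longrightarrow> 0 \<le> F x"
  by (rule order_trans[OF _ F_ge]) auto

text \<open>Taylor expansion to fourth order at 1. As F' = -f, the third derivative of
  \<open>f\<close> controls the remainder. F and F' vanish at 1, the quadratic coefficient is
  -f'(1)/2 = c^2/4, and the cubic one changes sign because the increment is -h.\<close>

lemma F_upper:
  "\<exists>C\<ge>0. \<forall>h. \<bar>h\<bar> \<le> 1/2 \<longrightarrow> F (1 - h) \<le> c\<^sup>2 / 4 * h\<^sup>2 + deriv (deriv f) 1 / 6 * h ^ 3 + C * h ^ 4"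
proof -
  have "bounded (deriv (deriv (deriv f)) ` {1/2..3/2})"
    by (intro compact_imp_bounded compact_continuous_image continuous_on_subset[OF f_derivs(4)]) auto
  then obtain B where B: "B > 0" "\<And>t. t \<in> {1/2..3/2} \<Longrightarrow> \<bar>deriv (deriv (deriv f)) t\<bar> \<le> B"
    unfolding bounded_pos by (metis imageI real_norm_def)
  define d where "d n = (if n = 0 then F else if n = 1 then (\<lambda>x. - f x)
    else if n = 2 then (\<lambda>x. - deriv f x) else if n = 3 then (\<lambda>x. - deriv (deriv f) x) else (\<lambda>x. - deriv (deriv (deriv f)) x))" for n :: nat
  have d: "(d m has_real_derivative d (Suc m) t) (at t)" if "m < 4" for m t
  proof -
    have "m = 0 \<or> m = 1 \<or> m = 2 \<or> m = 3" using that by linarith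
    then show ?thesis
      using DERIV_F f_derivs by (auto simp: d_def intro!: DERIV_minus)
  qed
  have "F (1 - h) \<le> c\<^sup>2 / 4 * h\<^sup>2 + deriv (deriv f) 1 / 6 * h ^ 3 + B / 24 * h ^ 4" if h: "\<bar>h\<bar> \<le> 1/2" for h
  proof (cases "h = 0")
    case False
    have "\<exists>t. (if 1 - h < 1 then 1 - h < t \<and> t < 1 else 1 < t \<and> t < 1 - h) \<and>
      F (1 - h) = (\<Sum>m<4. d m 1 / fact m * (1 - h - 1) ^ m) + d 4 t / fact 4 * (1 - h - 1) ^ 4"
      by (rule Taylor[where a = "1/2" and b = "3/2"]) (use False h d in \<open>auto simp: d_def[of 0]\<close>)
    then obtain t where t: "(if 1 - h < 1 then 1 - h < t \<and> t < 1 else 1 < t \<and> t < 1 - h)"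
      "F (1 - h) = (\<Sum>m<4. d m 1 / fact m * (1 - h - 1) ^ m) + d 4 t / fact 4 * (1 - h - 1) ^ 4" by blast
    have "t \<in> {1/2..3/2}" using t(1) h by (auto split: if_splits)
    then have tB: "\<bar>deriv (deriv (deriv f)) t\<bar> \<le> B" by (rule B)
    have "(\<Sum>m<4. d m 1 / fact m * (1 - h - 1) ^ m) = c\<^sup>2 / 4 * h\<^sup>2 + deriv (deriv f) 1 / 6 * h ^ 3"
      unfolding c_sq by (simp add: eval_nat_numeral d_def F_one f_one)
    moreover have "d 4 t / fact 4 * (1 - h - 1) ^ 4 \<le> B / 24 * h ^ 4"
    proof -
      have "- deriv (deriv (deriv f)) t * h ^ 4 \<le> B * h ^ 4"
        using tB by (intro mult_right_mono) auto
      then show ?thesis by (simp add: d_def fact_numeral)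
    qed
    ultimately show ?thesis using t(2) by linarith
  qed (simp add: F_one)
  then show ?thesis using B(1) by (intro exI[of _ "B / 24"]) auto
qed

text \<open>Amplitude e^2 against wavelength 1/e puts gradient and cubic terms at the same order e^5
  and the quartic one at e^7. With s = (c/2) h the quadratic terms contribute exactly c times the
  momentum. The factor \<open>m\<close> may have either sign, since that of \<Gamma> is unknown; the
  smallness condition keeps 1 - h >= 1/2 and h within the range of \<open>F_upper\<close>.\<close>

lemma test_family:
  "\<exists>C\<ge>0. \<forall>m e. e > 0 \<longrightarrow> \<bar>m\<bar> * e\<^sup>2 \<le> 1/2 \<longrightarrow>
    (\<exists>\<rho> r s. polar f \<rho> r s \<and> polar_momentum \<rho> s = c / 4 * hat_mass 2 * m\<^sup>2 * e ^ 3 \<and>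
      polar_energy f \<rho> r s \<le> c * (c / 4 * hat_mass 2 * m\<^sup>2 * e ^ 3)
        + e ^ 5 * (hat_stiffness / 4 * m\<^sup>2 + \<Gamma> * hat_mass 3 * m ^ 3) + C * m ^ 4 * e ^ 7)"
proof -
  obtain C where C: "C \<ge> 0" "\<And>h. \<bar>h\<bar> \<le> 1/2 \<Longrightarrow>
     F (1 - h) \<le> c\<^sup>2 / 4 * h\<^sup>2 + deriv (deriv f) 1 / 6 * h ^ 3 + C * h ^ 4"
    using F_upper by blast
  show ?thesis
  proof (intro exI[of _ "C / 2 * hat_mass 4"] conjI allI impI)
    show "0 \<le> C / 2 * hat_mass 4" using C(1) hat_mass_pos[of 4] by simp
    fix m e :: real assume e: "e > 0" and me: "\<bar>m\<bar> * e\<^sup>2 \<le> 1/2"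
    define h where "h x = m * e\<^sup>2 * hat (e * x)" for x
    define h' where "h' x = m * e ^ 3 * hat' (e * x)" for x
    have hb: "\<bar>h x\<bar> \<le> 1/2" for x
    proof -
      have "\<bar>h x\<bar> = (\<bar>m\<bar> * e\<^sup>2) * hat (e * x)" by (simp add: h_def abs_mult hat_bounds)
      also have "\<dots> \<le> (1/2) * 1" using me hat_bounds by (intro mult_mono) auto
      finally show ?thesis by simp
    qed
    have h1: "1 - h x \<ge> 1/2" for x using hb[of x] by (simp add: abs_le_iff)
    have dh: "(h has_real_derivative h' x) (at x)" for x
      unfolding h_def[abs_def] h'_def
      by (rule derivative_eq_intros DERIV_chain2[OF DERIV_hat] refl)+ (simp add: power3_eq_cube power2_eq_square)
    have ch: "continuous_on A h" "continuous_on A h'" for A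
      unfolding h_def[abs_def] h'_def[abs_def]
      by (intro continuous_intros continuous_on_compose2[OF continuous_hat(1)[of UNIV]]
          continuous_on_compose2[OF continuous_hat(2)[of UNIV]] subset_UNIV)+
    have h0: "h x = 0" "h' x = 0" if "\<bar>x\<bar> \<ge> 1 / e" for x
    proof -
      have "\<bar>e * x\<bar> \<ge> 1" using that e by (simp add: abs_mult field_simps)
      then show "h x = 0" "h' x = 0" by (simp_all add: h_def h'_def hat_outside)
    qed
    define \<rho> where "\<rho> x = sqrt (1 - h x)" for x
    define r where "r x = - h' x / (2 * \<rho> x)" for x
    define s where "s x = c / 2 * h x" for x
    have \<rho>2: "(\<rho> x)\<^sup>2 = 1 - h x" and \<rho>pos: "\<rho> x > 0" for x
      using h1[of x] by (simp_all add: \<rho>_def)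
    have c\<rho>: "continuous_on A \<rho>" for A unfolding \<rho>_def[abs_def] by (intro continuous_intros ch)
    have cr: "continuous_on A r" for A
      unfolding r_def[abs_def] using \<rho>pos by (intro continuous_intros ch c\<rho>) (auto simp: less_imp_neq[symmetric])
    have cs: "continuous_on A s" for A
      unfolding s_def[abs_def] by (intro continuous_intros ch)
    have "(\<rho> has_real_derivative r x) (at x)" for x
    proof -
      have "((\<lambda>x. sqrt (1 - h x)) has_real_derivative inverse (sqrt (1 - h x)) / 2 * (0 - h' x)) (at x)"
        using h1[of x] by (intro DERIV_chain2[OF DERIV_real_sqrt] DERIV_diff DERIV_const dh) auto
      then show ?thesis by (simp add: \<rho>_def[abs_def] r_def field_simps)
    qed
    then have pr: "primitive \<rho> r"
      by (intro primitive_C1 cr) (simp flip: has_real_derivative_iff_has_vector_derivative)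
    have i: "integrable lborel g" if "continuous_on UNIV g" "\<And>x. h x = 0 \<Longrightarrow> h' x = 0 \<Longrightarrow> g x = 0" for g :: "real \<Rightarrow> real"
      by (rule integrable_compact_support[where R = "1 / e"]) (use that h0 in auto)
    have ir: "integrable lborel (\<lambda>x. (r x)\<^sup>2)" "integrable lborel (\<lambda>x. (\<rho> x * s x)\<^sup>2)"
      "integrable lborel (\<lambda>x. F ((\<rho> x)\<^sup>2))"
      by (rule i; (intro continuous_intros cr c\<rho> cs continuous_on_compose2[OF F_cont[of UNIV]] subset_UNIV)?;
          simp add: r_def s_def \<rho>2 F_one)+
    have "sqrt (1/2) \<le> \<rho> x" for x unfolding \<rho>_def using h1[of x] by (rule real_sqrt_le_mono)
    then have pol: "polar f \<rho> r s"
      unfolding polar_def using pr ir cs by (auto intro!: borel_measurable_continuous_onI exI[of _ "sqrt (1/2)"])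
    have J: "(LINT x|lborel. (h x) ^ k) = m ^ k * e ^ (2 * k) * hat_mass k / e" for k
    proof -
      have "(LINT x|lborel. (h x) ^ k) = (LINT x|lborel. (m ^ k * e ^ (2 * k)) * hat (e * x) ^ k)"
        by (simp add: h_def power_mult_distrib power_mult)
      also have "\<dots> = (m ^ k * e ^ (2 * k)) * (LINT x|lborel. hat (e * x) ^ k)" by simp
      also have "(LINT x|lborel. hat (e * x) ^ k) = hat_mass k / e"
        using integral_dilate[OF e, of "\<lambda>x. hat x ^ k"] by (simp add: hat_mass_def)
      finally show ?thesis by simp
    qed
    have J': "(LINT x|lborel. (h' x)\<^sup>2) = m\<^sup>2 * e ^ 6 * hat_stiffness / e"
    proof -
      have "(LINT x|lborel. (h' x)\<^sup>2) = (LINT x|lborel. (m\<^sup>2 * e ^ 6) * (hat' (e * x))\<^sup>2)"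
        by (simp add: h'_def power_mult_distrib flip: power_mult)
      also have "\<dots> = (m\<^sup>2 * e ^ 6) * (LINT x|lborel. (hat' (e * x))\<^sup>2)" by simp
      also have "(LINT x|lborel. (hat' (e * x))\<^sup>2) = hat_stiffness / e"
        using integral_dilate[OF e, of "\<lambda>x. (hat' x)\<^sup>2"] by (simp add: hat_stiffness_def)
      finally show ?thesis by simp
    qed
    have mom: "polar_momentum \<rho> s = c / 4 * hat_mass 2 * m\<^sup>2 * e ^ 3"
    proof -
      have "polar_momentum \<rho> s = 1/2 * (LINT x|lborel. c / 2 * (h x) ^ 2)"
      proof -
        have "(1 - (\<rho> x)\<^sup>2) * s x = c / 2 * (h x) ^ 2" for x
          unfolding \<rho>2 s_def by (simp add: power2_eq_square)
        then show ?thesis by (simp only: polar_momentum_def)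
      qed
      also have "\<dots> = c / 4 * (LINT x|lborel. (h x) ^ 2)" by simp
      finally show ?thesis unfolding J using e by (simp add: eval_nat_numeral)
    qed
    have ih: "integrable lborel (\<lambda>x. (h x) ^ k)" if "k > 0" for k
      by (rule i) (use that in \<open>auto intro!: continuous_intros ch\<close>)
    have ih': "integrable lborel (\<lambda>x. (h' x)\<^sup>2)"
      by (rule i) (auto intro!: continuous_intros ch)
    have "(LINT x|lborel. (r x)\<^sup>2 + (\<rho> x * s x)\<^sup>2 + F ((\<rho> x)\<^sup>2)) \<le>
      (LINT x|lborel. 1/2 * (h' x)\<^sup>2 + c\<^sup>2 / 2 * (h x) ^ 2 + 2 * \<Gamma> * (h x) ^ 3 + C * (h x) ^ 4)"
    proof (rule integral_mono)
      show "(r x)\<^sup>2 + (\<rho> x * s x)\<^sup>2 + F ((\<rho> x)\<^sup>2) \<le> 1/2 * (h' x)\<^sup>2 + c\<^sup>2 / 2 * (h x) ^ 2 + 2 * \<Gamma> * (h x) ^ 3 + C * (h x) ^ 4" for x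
      proof -
        have "(r x)\<^sup>2 = (h' x)\<^sup>2 / (4 * (1 - h x))"
          by (simp add: r_def power_divide power_mult_distrib \<rho>2)
        also have "\<dots> \<le> (h' x)\<^sup>2 / 2" using h1[of x] by (intro divide_left_mono) auto
        finally have 1: "(r x)\<^sup>2 \<le> (h' x)\<^sup>2 / 2" .
        have 2: "(\<rho> x * s x)\<^sup>2 = (1 - h x) * (c\<^sup>2 / 4 * (h x)\<^sup>2)"
          by (simp add: power_mult_distrib \<rho>2 s_def power_divide)
        have 3: "F ((\<rho> x)\<^sup>2) \<le> c\<^sup>2 / 4 * (h x)\<^sup>2 + deriv (deriv f) 1 / 6 * h x ^ 3 + C * h x ^ 4"
          unfolding \<rho>2 by (rule C(2)[OF hb])
        have 4: "2 * \<Gamma> = deriv (deriv f) 1 / 6 - c\<^sup>2 / 4" unfolding c_sq by (simp add: \<Gamma>_def field_simps)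
        have "(1 - h x) * (c\<^sup>2 / 4 * (h x)\<^sup>2) + (c\<^sup>2 / 4 * (h x)\<^sup>2 + deriv (deriv f) 1 / 6 * h x ^ 3 + C * h x ^ 4)
          = c\<^sup>2 / 2 * (h x) ^ 2 + 2 * \<Gamma> * (h x) ^ 3 + C * (h x) ^ 4"
          unfolding 4 by (simp add: power2_eq_square power3_eq_cube field_simps)
        with 1 2 3 show ?thesis by linarith
      qed
    qed (use ir ih ih' in simp_all)
    also have "\<dots> = 1/2 * (LINT x|lborel. (h' x)\<^sup>2) + c\<^sup>2 / 2 * (LINT x|lborel. (h x) ^ 2)
       + 2 * \<Gamma> * (LINT x|lborel. (h x) ^ 3) + C * (LINT x|lborel. (h x) ^ 4)"
      using ih[of 2] ih[of 3] ih[of 4] ih' by simp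
    finally have "polar_energy f \<rho> r s \<le> 1/2 * (1/2 * (LINT x|lborel. (h' x)\<^sup>2) + c\<^sup>2 / 2 * (LINT x|lborel. (h x) ^ 2)
       + 2 * \<Gamma> * (LINT x|lborel. (h x) ^ 3) + C * (LINT x|lborel. (h x) ^ 4))"
      by (simp add: polar_energy_def)
    also have "\<dots> = c * (c / 4 * hat_mass 2 * m\<^sup>2 * e ^ 3)
        + e ^ 5 * (hat_stiffness / 4 * m\<^sup>2 + \<Gamma> * hat_mass 3 * m ^ 3) + C / 2 * hat_mass 4 * m ^ 4 * e ^ 7"
      unfolding J J' using e by (simp add: eval_nat_numeral algebra_simps)
    finally show "\<exists>\<rho> r s. polar f \<rho> r s \<and> polar_momentum \<rho> s = c / 4 * hat_mass 2 * m\<^sup>2 * e ^ 3 \<and>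
      polar_energy f \<rho> r s \<le> c * (c / 4 * hat_mass 2 * m\<^sup>2 * e ^ 3)
        + e ^ 5 * (hat_stiffness / 4 * m\<^sup>2 + \<Gamma> * hat_mass 3 * m ^ 3) + C / 2 * hat_mass 4 * m ^ 4 * e ^ 7"
      using pol mom by blast
  qed
qed

end

section \<open>Reflection and scaling\<close>

lemma primitive_reflect:
  fixes u :: "real \<Rightarrow> 'a::euclidean_space"
  assumes p: "primitive u g"
  shows "primitive (\<lambda>x. u (t - x)) (\<lambda>x. - g (t - x))"
proof -
  have g: "g \<in> L1_loc" using p by (simp add: primitive_def)
  have ind: "indicat_real {t - b..t - a} (t + (-1) * x) = indicator {a..b} x" for a b x
    by (auto simp: indicator_def)
  have si: "set_integrable lborel {a..b} (\<lambda>x. g (t - x))" for a b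
    using lborel_integrable_real_affine[OF L1_locD(2)[OF g, of "t - b" "t - a", unfolded set_integrable_def], of "-1" t]
    unfolding set_integrable_def ind by simp
  have "(LINT x:{a..b}|lborel. g (t - x)) = u (t - a) - u (t - b)" if "a \<le> b" for a b
    using lborel_integral_real_affine[of "-1" "\<lambda>x. indicat_real {t - b..t - a} x *\<^sub>R g x" t] that
      primitive_integral[OF p, of "t - b" "t - a"]
    unfolding set_lebesgue_integral_def ind by simp
  moreover have L: "(\<lambda>x. g (t - x)) \<in> L1_loc"
    using si L1_locD(1)[OF g] by (intro L1_locI) auto
  ultimately have "((\<lambda>x. g (t - x)) has_integral u (t - a) - u (t - b)) {a..b}" if "a \<le> b" for a b
    using L1_loc_has_integral[OF L, of a b] that by simp
  from has_integral_neg[OF this] show ?thesis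
    using L1_loc_bounded_linear[OF L bounded_linear_minus[OF bounded_linear_ident]] by (auto simp: primitive_def)
qed

lemma primitive_glue:
  fixes u :: "real \<Rightarrow> 'a::euclidean_space"
  assumes u: "primitive u g" and v: "primitive v k" and eq: "u a = v a"
  shows "primitive (\<lambda>x. if x \<le> a then u x else v x) (\<lambda>x. if x \<le> a then g x else k x)" (is "primitive ?u ?g")
proof -
  have m[measurable]: "g \<in> borel_measurable borel" "k \<in> borel_measurable borel"
    using primitive_measurable u v by blast+
  have hi: "(?g has_integral ?u y - ?u x) {x..y}" if "x \<le> y" for x y
  proof -
    have l: "(?g has_integral ?u y - ?u x) {x..y}" if "x \<le> y" "y \<le> a" for x y
      using has_integral_eq[of "{x..y}" g ?g "u y - u x"] u that by (auto simp: primitive_def)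
    have r: "(?g has_integral ?u y - ?u x) {x..y}" if "x \<le> y" "a \<le> x" for x y
    proof -
      have "(?g has_integral v y - v x) {x..y}"
        by (rule has_integral_spike[of "{a}" _ _ k]) (use v that in \<open>auto simp: primitive_def\<close>)
      moreover have uz: "?u z = v z" if "a \<le> z" for z
        using that eq by (cases "z = a") simp_all
      have "?u y = v y" "?u x = v x" using that by (intro uz; simp)+
      ultimately show ?thesis by (simp only:)
    qed
    consider "y \<le> a" | "a \<le> x" | "x < a" "a < y" by linarith
    then show ?thesis
    proof cases
      case 3
      from has_integral_combine[OF _ _ l[of x a] r[of a y]] 3 show ?thesis by simp
    qed (use l r \<open>x \<le> y\<close> in auto)
  qed
  have "?g \<in> L1_loc"
  proof (rule L1_loc_dominated)
    show "(\<lambda>x. norm (g x) + norm (k x)) \<in> L1_loc"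
      using u v by (intro L1_loc_add L1_loc_norm) (auto simp: primitive_def)
  qed auto
  with hi show ?thesis by (auto simp: primitive_def)
qed

definition fold_at :: "real \<Rightarrow> (real \<Rightarrow> real) \<Rightarrow> real \<Rightarrow> real" where
  "fold_at a k x = (if x \<le> a then k x else k (2 * a - x))"

lemma fold_at_integral:
  assumes k: "integrable lborel k"
  shows "integrable lborel (fold_at a k)" "(LINT x|lborel. fold_at a k x) = 2 * (LINT x:{..a}|lborel. k x)"
proof -
  have m[measurable]: "k \<in> borel_measurable borel" using k by auto
  \<comment> \<open>One half-line is closed and the other open, so that \<open>a\<close> is counted
    once.\<close>
  have e: "fold_at a k x = indicator {..a} x *\<^sub>R k x + indicator {..<a} (2 * a + (-1) * x) *\<^sub>R k (2 * a + (-1) * x)" for x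
    by (auto simp: fold_at_def indicator_def)
  have i1: "integrable lborel (\<lambda>x. indicator {..a} x *\<^sub>R k x)"
    using k by (intro integrable_mult_indicator) auto
  have i2: "integrable lborel (\<lambda>x. indicator {..<a} x *\<^sub>R k x)"
    using k by (intro integrable_mult_indicator) auto
  have i3: "integrable lborel (\<lambda>x. indicator {..<a} (2 * a + (-1) * x) *\<^sub>R k (2 * a + (-1) * x))"
    by (rule lborel_integrable_real_affine[OF i2]) simp
  show "integrable lborel (fold_at a k)"
    unfolding e[abs_def] by (intro Bochner_Integration.integrable_add i1 i3)
  have "(LINT x|lborel. indicator {..<a} (2 * a + (-1) * x) *\<^sub>R k (2 * a + (-1) * x)) = (LINT x|lborel. indicator {..<a} x *\<^sub>R k x)"
    using lborel_integral_real_affine[of "-1" "\<lambda>x. indicator {..<a} x *\<^sub>R k x" "2 * a"] by simp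
  also have "\<dots> = (LINT x|lborel. indicator {..a} x *\<^sub>R k x)"
  proof (rule integral_cong_AE)
    show "AE x in lborel. indicat_real {..<a} x *\<^sub>R k x = indicat_real {..a} x *\<^sub>R k x"
      using AE_lborel_singleton[of a] by eventually_elim (auto simp: indicator_def)
  qed auto
  finally show "(LINT x|lborel. fold_at a k x) = 2 * (LINT x:{..a}|lborel. k x)"
    unfolding e Bochner_Integration.integral_add[OF i1 i3] by (simp add: set_lebesgue_integral_def)
qed

lemma integral_tails:
  fixes k :: "real \<Rightarrow> real"
  assumes k: "integrable lborel k"
  shows "(\<lambda>n. LINT x:{..- real n}|lborel. k x) \<longlonglongrightarrow> 0"
    "(\<lambda>n. LINT x:{..real n}|lborel. k x) \<longlonglongrightarrow> (LINT x|lborel. k x)"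
proof -
  have m[measurable]: "k \<in> borel_measurable borel" using k by auto
  have "(\<lambda>n. LINT x|lborel. indicator {..- real n} x *\<^sub>R k x) \<longlonglongrightarrow> (LINT x|(lborel :: real measure). (0::real))"
  proof (rule integral_dominated_convergence[where w = "\<lambda>x. norm (k x)"])
    have "(\<lambda>n. indicator {..- real n} x *\<^sub>R k x) \<longlonglongrightarrow> 0" for x
    proof -
      obtain N where N: "- x < real N" using reals_Archimedean2 by blast
      have "\<forall>n\<ge>N. indicator {..- real n} x *\<^sub>R k x = 0" using N by (auto simp: indicator_def)
      then show ?thesis by (intro tendsto_eventually) (auto simp: eventually_sequentially)
    qed
    then show "AE x in lborel. (\<lambda>n. indicator {..- real n} x *\<^sub>R k x) \<longlonglongrightarrow> 0" by simp
  qed (use k in \<open>auto simp: indicator_def\<close>)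
  then show "(\<lambda>n. LINT x:{..- real n}|lborel. k x) \<longlonglongrightarrow> 0" by (simp add: set_lebesgue_integral_def)
  have "(\<lambda>n. LINT x|lborel. indicator {..real n} x *\<^sub>R k x) \<longlonglongrightarrow> (LINT x|lborel. k x)"
  proof (rule integral_dominated_convergence[where w = "\<lambda>x. norm (k x)"])
    have "(\<lambda>n. indicator {..real n} x *\<^sub>R k x) \<longlonglongrightarrow> k x" for x
    proof -
      obtain N where N: "x < real N" using reals_Archimedean2 by blast
      have "\<forall>n\<ge>N. indicator {..real n} x *\<^sub>R k x = k x" using N by (auto simp: indicator_def)
      then show ?thesis by (intro tendsto_eventually) (auto simp: eventually_sequentially)
    qed
    then show "AE x in lborel. (\<lambda>n. indicator {..real n} x *\<^sub>R k x) \<longlonglongrightarrow> k x" by simp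
  qed (use k in \<open>auto simp: indicator_def\<close>)
  then show "(\<lambda>n. LINT x:{..real n}|lborel. k x) \<longlonglongrightarrow> (LINT x|lborel. k x)"
    by (simp add: set_lebesgue_integral_def)
qed

lemma left_integral_continuous:
  fixes k :: "real \<Rightarrow> real"
  assumes k: "integrable lborel k"
  shows "continuous_on UNIV (\<lambda>a. LINT x:{..a}|lborel. k x)"
proof -
  have m[measurable]: "k \<in> borel_measurable borel" using k by auto
  have si: "set_integrable lborel A k" if "A \<in> sets borel" for A
    using k that unfolding set_integrable_def by (intro integrable_mult_indicator) auto
  have L: "k \<in> L1_loc" using si by (intro L1_locI) auto
  have "(k has_integral (LINT x:{..b}|lborel. k x) - (LINT x:{..a}|lborel. k x)) {a..b}" if "a \<le> b" for a b
  proof -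
    have "(LINT x:{..b}|lborel. k x) = (LINT x:{..a} \<union> {a<..b}|lborel. k x)"
      using that by (simp add: ivl_disj_un_one)
    also have "\<dots> = (LINT x:{..a}|lborel. k x) + (LINT x:{a<..b}|lborel. k x)"
      by (intro set_integral_Un si) auto
    also have "(LINT x:{a<..b}|lborel. k x) = (LINT x:{a..b}|lborel. k x)"
      unfolding set_lebesgue_integral_def
    proof (rule integral_cong_AE)
      show "AE x in lborel. indicat_real {a<..b} x *\<^sub>R k x = indicat_real {a..b} x *\<^sub>R k x"
        using AE_lborel_singleton[of a] by eventually_elim (auto simp: indicator_def)
    qed auto
    finally show ?thesis using L1_loc_has_integral[OF L, of a b] by simp
  qed
  then have "primitive (\<lambda>a. LINT x:{..a}|lborel. k x) k" using L by (simp add: primitive_def)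
  then show ?thesis by (rule primitive_continuous)
qed

section \<open>Operations on near-minimizers: scaling the phase, folding, flipping\<close>

context nonlinearity
begin

definition energy_density :: "(real \<Rightarrow> real) \<Rightarrow> (real \<Rightarrow> real) \<Rightarrow> (real \<Rightarrow> real) \<Rightarrow> real \<Rightarrow> real" where
  "energy_density \<rho> r s x = (r x)\<^sup>2 + (\<rho> x * s x)\<^sup>2 + F ((\<rho> x)\<^sup>2)"

lemma energy_density_nonneg: "0 \<le> energy_density \<rho> r s x"
  by (simp add: energy_density_def F_nonneg)

lemma polar_energy_density: "polar_energy f \<rho> r s = 1/2 * (LINT x|lborel. energy_density \<rho> r s x)"
  by (simp add: polar_energy_def energy_density_def)

text \<open>For the last two facts: the quadratic lower bound on F turns finite potential energy
  into square integrability of 1 - \<rho>^2, and the positive lower bound on \<rho> passes from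
  \<rho> s to \<open>s\<close>, so the momentum density is integrable.\<close>

lemma polarD:
  assumes "polar f \<rho> r s"
  shows "primitive \<rho> r" "\<And>x. \<rho> x > 0" "integrable lborel (energy_density \<rho> r s)"
    "integrable lborel (\<lambda>x. (r x)\<^sup>2)" "integrable lborel (\<lambda>x. (\<rho> x * s x)\<^sup>2)" "integrable lborel (\<lambda>x. F ((\<rho> x)\<^sup>2))"
    "\<rho> \<in> borel_measurable borel" "r \<in> borel_measurable borel" "s \<in> borel_measurable borel"
    "integrable lborel (\<lambda>x. (1 - (\<rho> x)\<^sup>2)\<^sup>2)" "integrable lborel (\<lambda>x. (1 - (\<rho> x)\<^sup>2) * s x)"
proof -
  show p: "primitive \<rho> r" "integrable lborel (\<lambda>x. (r x)\<^sup>2)" "integrable lborel (\<lambda>x. (\<rho> x * s x)\<^sup>2)"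
    "integrable lborel (\<lambda>x. F ((\<rho> x)\<^sup>2))" and s[measurable]: "s \<in> borel_measurable borel"
    using assms by (auto simp: polar_def)
  obtain d where d: "d > 0" "\<And>x. d \<le> \<rho> x" using assms by (auto simp: polar_def)
  show "\<rho> x > 0" for x using d(1) d(2)[of x] by linarith
  show \<rho>[measurable]: "\<rho> \<in> borel_measurable borel" "r \<in> borel_measurable borel"
    using primitive_measurable[OF p(1)] .
  show "integrable lborel (energy_density \<rho> r s)"
    unfolding energy_density_def[abs_def] using p by simp
  show h2: "integrable lborel (\<lambda>x. (1 - (\<rho> x)\<^sup>2)\<^sup>2)"
  proof (rule Bochner_Integration.integrable_bound)
    show "integrable lborel (\<lambda>x. 4 / c\<^sup>2 * F ((\<rho> x)\<^sup>2))" using p(4) by simp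
    have "(1 - (\<rho> x)\<^sup>2)\<^sup>2 \<le> 4 / c\<^sup>2 * F ((\<rho> x)\<^sup>2)" for x
      using F_ge[of "(\<rho> x)\<^sup>2"] c_pos by (simp add: field_simps)
    then show "AE x in lborel. norm ((1 - (\<rho> x)\<^sup>2)\<^sup>2) \<le> norm (4 / c\<^sup>2 * F ((\<rho> x)\<^sup>2))"
      by (intro AE_I2) (simp add: F_nonneg)
  qed auto
  show "integrable lborel (\<lambda>x. (1 - (\<rho> x)\<^sup>2) * s x)"
  proof (rule Bochner_Integration.integrable_bound)
    show "integrable lborel (\<lambda>x. (1 - (\<rho> x)\<^sup>2)\<^sup>2 + 1 / d\<^sup>2 * (\<rho> x * s x)\<^sup>2)"
      using p(3) h2 by simp
    have "\<bar>(1 - (\<rho> x)\<^sup>2) * s x\<bar> \<le> (1 - (\<rho> x)\<^sup>2)\<^sup>2 + 1 / d\<^sup>2 * (\<rho> x * s x)\<^sup>2" for x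
    proof -
      have "2 * \<bar>a * b\<bar> \<le> a\<^sup>2 + b\<^sup>2" for a b :: real
        using sum_squares_bound[of a b] sum_squares_bound[of "-a" b] by (auto simp: abs_if)
      from this[of "1 - (\<rho> x)\<^sup>2" "s x"]
      have "\<bar>(1 - (\<rho> x)\<^sup>2) * s x\<bar> \<le> (1 - (\<rho> x)\<^sup>2)\<^sup>2 + (s x)\<^sup>2" by linarith
      moreover have "d\<^sup>2 * (s x)\<^sup>2 \<le> (\<rho> x)\<^sup>2 * (s x)\<^sup>2"
        using d by (intro mult_right_mono power_mono) (auto intro: less_imp_le)
      then have "(s x)\<^sup>2 \<le> 1 / d\<^sup>2 * (\<rho> x * s x)\<^sup>2" using d(1) by (simp add: field_simps power_mult_distrib)
      ultimately show ?thesis by linarith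
    qed
    then show "AE x in lborel. norm ((1 - (\<rho> x)\<^sup>2) * s x) \<le> norm ((1 - (\<rho> x)\<^sup>2)\<^sup>2 + 1 / d\<^sup>2 * (\<rho> x * s x)\<^sup>2)"
      by (intro AE_I2) (auto intro: order_trans[OF _ abs_ge_self])
  qed auto
qed

lemma polar_energy_nonneg: "polar f \<rho> r s \<Longrightarrow> 0 \<le> polar_energy f \<rho> r s"
  unfolding polar_energy_density by (simp add: Bochner_Integration.integral_nonneg energy_density_nonneg)

lemma E_min_le:
  assumes "polar f \<rho> r s" "polar_momentum \<rho> s = p"
  shows "E_min f p \<le> polar_energy f \<rho> r s"
  unfolding E_min_polar
  by (rule cInf_lower) (use assms polar_energy_nonneg in \<open>auto intro!: bdd_belowI[of _ 0]\<close>)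

text \<open>The modulus is kept, so only the term (\<rho> s)^2 changes, by the factor l^2. For |l|
  <= 1 the energy does not grow, which is the source of monotonicity.\<close>

lemma polar_scale:
  assumes p: "polar f \<rho> r s"
  shows "polar f \<rho> r (\<lambda>x. l * s x)" "polar_momentum \<rho> (\<lambda>x. l * s x) = l * polar_momentum \<rho> s"
    "polar_energy f \<rho> r (\<lambda>x. l * s x) \<le> max 1 (l\<^sup>2) * polar_energy f \<rho> r s"
proof -
  have "integrable lborel (\<lambda>x. l\<^sup>2 * (\<rho> x * s x)\<^sup>2)" using polarD(5)[OF p] by simp
  then have "integrable lborel (\<lambda>x. (\<rho> x * (l * s x))\<^sup>2)" by (simp add: power_mult_distrib mult_ac)
  then show pl: "polar f \<rho> r (\<lambda>x. l * s x)"
    using p unfolding polar_def by auto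
  have "(1 - (\<rho> x)\<^sup>2) * (l * s x) = l * ((1 - (\<rho> x)\<^sup>2) * s x)" for x by simp
  then show "polar_momentum \<rho> (\<lambda>x. l * s x) = l * polar_momentum \<rho> s"
    by (simp only: polar_momentum_def integral_mult_right_zero)
  have "(LINT x|lborel. energy_density \<rho> r (\<lambda>x. l * s x) x) \<le> (LINT x|lborel. max 1 (l\<^sup>2) * energy_density \<rho> r s x)"
  proof (rule integral_mono)
    show "integrable lborel (energy_density \<rho> r (\<lambda>x. l * s x))" by (rule polarD(3)[OF pl])
    show "integrable lborel (\<lambda>x. max 1 (l\<^sup>2) * energy_density \<rho> r s x)" using polarD(3)[OF p] by simp
    show "energy_density \<rho> r (\<lambda>x. l * s x) x \<le> max 1 (l\<^sup>2) * energy_density \<rho> r s x" for x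
    proof -
      have "1 * (r x)\<^sup>2 \<le> max 1 (l\<^sup>2) * (r x)\<^sup>2" "l\<^sup>2 * (\<rho> x * s x)\<^sup>2 \<le> max 1 (l\<^sup>2) * (\<rho> x * s x)\<^sup>2"
        "1 * F ((\<rho> x)\<^sup>2) \<le> max 1 (l\<^sup>2) * F ((\<rho> x)\<^sup>2)"
        by (intro mult_right_mono; simp add: F_nonneg)+
      moreover have "(\<rho> x * (l * s x))\<^sup>2 = l\<^sup>2 * (\<rho> x * s x)\<^sup>2" by (simp add: power_mult_distrib)
      ultimately show ?thesis unfolding energy_density_def distrib_left by linarith
    qed
  qed
  then show "polar_energy f \<rho> r (\<lambda>x. l * s x) \<le> max 1 (l\<^sup>2) * polar_energy f \<rho> r s"
    by (simp add: polar_energy_density)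
qed

text \<open>One long wave of nonzero momentum, rescaled. Without it the infimum could range over the
  empty set, where \<open>Inf\<close> on the reals carries no information.\<close>

lemma polar_exists: "\<exists>\<rho> r s. polar f \<rho> r s \<and> polar_momentum \<rho> s = p"
proof -
  \<comment> \<open>The choice m = 1/2, e = 1 is the limit case of the smallness condition in
    \<open>test_family\<close>.\<close>
  obtain \<rho> r s where 1: "polar f \<rho> r s" "polar_momentum \<rho> s = c / 4 * hat_mass 2 * (1/2)\<^sup>2 * 1 ^ 3"
    using test_family by (metis abs_of_nonneg half_gt_zero_iff less_eq_real_def mult.right_neutral one_power2 zero_less_one)
  have "polar_momentum \<rho> s \<noteq> 0" using 1(2) c_pos hat_mass_pos[of 2] by auto
  then have "polar_momentum \<rho> (\<lambda>x. p / polar_momentum \<rho> s * s x) = p"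
    unfolding polar_scale(2)[OF 1(1)] by simp
  then show ?thesis using polar_scale(1)[OF 1(1)] by blast
qed

lemma E_min_greatest:
  assumes "\<And>\<rho> r s. polar f \<rho> r s \<Longrightarrow> polar_momentum \<rho> s = p \<Longrightarrow> b \<le> polar_energy f \<rho> r s"
  shows "b \<le> E_min f p"
  unfolding E_min_polar by (rule cInf_greatest) (use assms polar_exists[of p] in auto)

lemma E_min_approx:
  assumes "e > 0"
  obtains \<rho> r s where "polar f \<rho> r s" "polar_momentum \<rho> s = p" "polar_energy f \<rho> r s < E_min f p + e"
proof (rule ccontr)
  assume "\<not> thesis"
  then have "E_min f p + e \<le> E_min f p"
    by (intro E_min_greatest) (metis not_le that)
  then show False using assms by simp
qed

lemma E_min_nonneg: "0 \<le> E_min f p"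
  by (rule E_min_greatest) (rule polar_energy_nonneg)

lemma E_min_scale: "E_min f (l * p) \<le> max 1 (l\<^sup>2) * E_min f p"
proof (rule field_le_epsilon)
  fix e :: real assume e: "e > 0"
  define m where "m = max 1 (l\<^sup>2)"
  have m: "m \<ge> 1" by (simp add: m_def)
  obtain \<rho> r s where p: "polar f \<rho> r s" "polar_momentum \<rho> s = p" "polar_energy f \<rho> r s < E_min f p + e / m"
    using E_min_approx[of "e / m" p] e m by auto
  have "E_min f (l * p) \<le> polar_energy f \<rho> r (\<lambda>x. l * s x)"
    by (rule E_min_le) (use polar_scale[OF p(1)] p(2) in auto)
  also have "\<dots> \<le> m * polar_energy f \<rho> r s" unfolding m_def by (rule polar_scale(3)[OF p(1)])
  also have "\<dots> \<le> m * (E_min f p + e / m)" using p(3) m by (intro mult_left_mono) auto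
  also have "\<dots> = m * E_min f p + e" using m by (simp add: field_simps)
  finally show "E_min f (l * p) \<le> max 1 (l\<^sup>2) * E_min f p + e" by (simp add: m_def)
qed

lemma E_min_even: "E_min f (- p) = E_min f p"
  using E_min_scale[of "-1" p] E_min_scale[of "-1" "-p"] by simp

text \<open>\<open>s\<close> is reflected evenly like \<rho>, that is, the phase is odd about
  \<open>a\<close> up to a constant. Both densities become even, and the doubling of their integrals
  cancels the factor 1/2 in energy and momentum.\<close>

lemma polar_fold:
  assumes p: "polar f \<rho> r s"
  shows "\<exists>\<rho>' r' s'. polar f \<rho>' r' s' \<and> polar_momentum \<rho>' s' = (LINT x:{..a}|lborel. (1 - (\<rho> x)\<^sup>2) * s x) \<and>
    polar_energy f \<rho>' r' s' = (LINT x:{..a}|lborel. energy_density \<rho> r s x)"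
proof -
  define \<rho>' where "\<rho>' = fold_at a \<rho>"
  define r' where "r' x = (if x \<le> a then r x else - r (2 * a - x))" for x
  define s' where "s' = fold_at a s"
  note D = polarD[OF p]
  have [measurable]: "\<rho> \<in> borel_measurable borel" "r \<in> borel_measurable borel" "s \<in> borel_measurable borel"
    using D by auto
  have sq: "(\<lambda>x. (r' x)\<^sup>2) = fold_at a (\<lambda>x. (r x)\<^sup>2)" "(\<lambda>x. (\<rho>' x * s' x)\<^sup>2) = fold_at a (\<lambda>x. (\<rho> x * s x)\<^sup>2)"
    "(\<lambda>x. F ((\<rho>' x)\<^sup>2)) = fold_at a (\<lambda>x. F ((\<rho> x)\<^sup>2))" "energy_density \<rho>' r' s' = fold_at a (energy_density \<rho> r s)"
    "(\<lambda>x. (1 - (\<rho>' x)\<^sup>2) * s' x) = fold_at a (\<lambda>x. (1 - (\<rho> x)\<^sup>2) * s x)"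
    by (auto simp: fun_eq_iff fold_at_def r'_def s'_def \<rho>'_def energy_density_def)
  have "primitive \<rho>' r'"
    using primitive_glue[OF D(1) primitive_reflect[OF D(1), of "2 * a"], of a]
    by (simp add: \<rho>'_def fold_at_def[abs_def] r'_def[abs_def])
  moreover have "s' \<in> borel_measurable borel" unfolding s'_def fold_at_def[abs_def] by measurable
  moreover have "\<exists>d>0. \<forall>x. d \<le> \<rho>' x" using p unfolding polar_def \<rho>'_def fold_at_def by (metis (full_types))
  ultimately have "polar f \<rho>' r' s'"
    unfolding polar_def sq using fold_at_integral(1) D(4-6) by blast
  moreover have "polar_momentum \<rho>' s' = (LINT x:{..a}|lborel. (1 - (\<rho> x)\<^sup>2) * s x)"
    unfolding polar_momentum_def sq fold_at_integral(2)[OF D(11)] by simp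
  moreover have "polar_energy f \<rho>' r' s' = (LINT x:{..a}|lborel. energy_density \<rho> r s x)"
    unfolding polar_energy_density sq(4) fold_at_integral(2)[OF D(3)] by simp
  ultimately show ?thesis by blast
qed

text \<open>\<open>s\<close> is not negated: for the maps themselves this is reflection combined
  with complex conjugation, which preserves the momentum.\<close>

lemma polar_flip:
  assumes p: "polar f \<rho> r s"
  shows "polar f (\<lambda>x. \<rho> (- x)) (\<lambda>x. - r (- x)) (\<lambda>x. s (- x))"
proof -
  note D = polarD[OF p]
  have [measurable]: "s \<in> borel_measurable borel" using D by auto
  have "integrable lborel (\<lambda>x. k (- x))" if "integrable lborel k" for k :: "real \<Rightarrow> real"
    using lborel_integrable_real_affine[OF that, of "-1" 0] by simp
  from this[OF D(4)] this[OF D(5)] this[OF D(6)] show ?thesis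
    using primitive_reflect[OF D(1), of 0] p unfolding polar_def by auto
qed

text \<open>The right half-line is written as a left half-line of the mirrored function, so that one
  folding lemma serves both halves.\<close>

lemma integral_split_flip:
  fixes k :: "real \<Rightarrow> real"
  assumes "integrable lborel k"
  shows "(LINT x:{..a}|lborel. k x) + (LINT x:{..-a}|lborel. k (- x)) = (LINT x|lborel. k x)"
proof -
  have [measurable]: "k \<in> borel_measurable borel" using assms by auto
  have i: "integrable lborel (\<lambda>x. indicator A x *\<^sub>R k x)" if "A \<in> sets borel" for A
    using that assms by (intro integrable_mult_indicator) auto
  have "(LINT x:{..-a}|lborel. k (- x)) = (LINT x|lborel. indicator {a..} x *\<^sub>R k x)"
  proof -
    have "indicat_real {a..} (0 + (-1) * x) = indicator {..-a} x" for x by (auto simp: indicator_def)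
    then show ?thesis
      using lborel_integral_real_affine[of "-1" "\<lambda>x. indicator {a..} x *\<^sub>R k x" 0]
      by (simp add: set_lebesgue_integral_def)
  qed
  then have "(LINT x:{..a}|lborel. k x) + (LINT x:{..-a}|lborel. k (- x)) =
     (LINT x|lborel. indicator {..a} x *\<^sub>R k x + indicator {a..} x *\<^sub>R k x)"
    using i by (simp add: set_lebesgue_integral_def)
  also have "\<dots> = (LINT x|lborel. k x)"
  proof (rule integral_cong_AE)
    show "AE x in lborel. indicat_real {..a} x *\<^sub>R k x + indicat_real {a..} x *\<^sub>R k x = k x"
      using AE_lborel_singleton[of a] by eventually_elim (auto simp: indicator_def)
  qed auto
  finally show ?thesis .
qed

text \<open>Cut a near-minimizer at a point splitting its momentum in the prescribed ratio and
  symmetrize each half by reflection.\<close>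

lemma E_min_midpoint:
  assumes "0 < q" "q < 2 * p"
  shows "E_min f q + E_min f (2 * p - q) \<le> 2 * E_min f p"
proof (rule field_le_epsilon)
  fix e :: real assume e: "e > 0"
  obtain \<rho> r s where p: "polar f \<rho> r s" "polar_momentum \<rho> s = p" "polar_energy f \<rho> r s < E_min f p + e / 2"
    using E_min_approx[of "e / 2" p] e by auto
  note D = polarD[OF p(1)]
  define k where "k x = (1 - (\<rho> x)\<^sup>2) * s x" for x
  have k: "integrable lborel k" using D(11) by (simp add: k_def[abs_def])
  \<comment> \<open>Momentum carries a factor 1/2 that folding undoes: cutting where
    \<open>M a = q\<close> leaves pieces of momentum \<open>q\<close> and \<open>2 * p - q\<close>.
    The cut exists because \<open>q\<close> lies strictly between the limits 0 and
    \<open>2 * p\<close> of \<open>M\<close>.\<close>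
  have kI: "(LINT x|lborel. k x) = 2 * p" using p(2) by (simp add: k_def polar_momentum_def)
  define M where "M a = (LINT x:{..a}|lborel. k x)" for a
  obtain n1 where n1: "M (- real n1) < q"
    using order_tendstoD(2)[OF integral_tails(1)[OF k], of q] assms(1)
    unfolding M_def eventually_sequentially by auto
  have "\<forall>\<^sub>F n in sequentially. q < M (real n)"
    using order_tendstoD(1)[OF integral_tails(2)[OF k], of q] assms(2) unfolding M_def kI by auto
  then obtain n2 where n2: "q < M (real n2)" unfolding eventually_sequentially by auto
  have "\<exists>a\<ge>- real n1. a \<le> real n2 \<and> M a = q"
    using n1 n2 left_integral_continuous[OF k]
    by (intro IVT') (auto simp: M_def[abs_def] intro: continuous_on_subset)
  then obtain a where a: "M a = q" by blast
  obtain \<rho>1 r1 s1 where 1: "polar f \<rho>1 r1 s1" "polar_momentum \<rho>1 s1 = q"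
    "polar_energy f \<rho>1 r1 s1 = (LINT x:{..a}|lborel. energy_density \<rho> r s x)"
    using polar_fold[OF p(1), of a] a by (auto simp: M_def k_def)
  have split: "(LINT x:{..-a}|lborel. k (- x)) = 2 * p - q"
    using integral_split_flip[OF k, of a] a kI by (simp add: M_def)
  obtain \<rho>2 r2 s2 where 2: "polar f \<rho>2 r2 s2" "polar_momentum \<rho>2 s2 = 2 * p - q"
    "polar_energy f \<rho>2 r2 s2 = (LINT x:{..-a}|lborel. energy_density \<rho> r s (- x))"
    using polar_fold[OF polar_flip[OF p(1)], of "-a"] split by (auto simp: k_def energy_density_def)
  have "E_min f q + E_min f (2 * p - q) \<le> polar_energy f \<rho>1 r1 s1 + polar_energy f \<rho>2 r2 s2"
    using E_min_le[OF 1(1,2)] E_min_le[OF 2(1,2)] by simp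
  also have "\<dots> = 2 * polar_energy f \<rho> r s"
    unfolding 1 2 integral_split_flip[OF D(3)] by (simp add: polar_energy_density)
  also have "\<dots> \<le> 2 * E_min f p + e" using p(3) by simp
  finally show "E_min f q + E_min f (2 * p - q) \<le> 2 * E_min f p + e" .
qed

end

section \<open>Concavity\<close>

text \<open>The leftmost minimum of the difference to the chord would be a midpoint of points with
  smaller average.\<close>

lemma continuous_midpoint_concave_above_chord:
  fixes g :: "real \<Rightarrow> real"
  assumes xy: "x < y" and g: "continuous_on {x..y} g"
    and mid: "\<And>u v. x < u \<Longrightarrow> u < v \<Longrightarrow> v < y \<Longrightarrow> g u + g v \<le> 2 * g ((u + v) / 2)"
    and z: "z \<in> {x..y}"
  shows "g x + (g y - g x) / (y - x) * (z - x) \<le> g z"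
proof (rule ccontr)
  assume neg: "\<not> ?thesis"
  define k where "k = (g y - g x) / (y - x)"
  define d where "d t = g t - (g x + k * (t - x))" for t
  have cd: "continuous_on {x..y} d" unfolding d_def by (intro continuous_intros g)
  have d_ends: "d x = 0" "d y = 0" using xy by (auto simp: d_def k_def)
  obtain t0 where t0: "t0 \<in> {x..y}" "\<And>t. t \<in> {x..y} \<Longrightarrow> d t0 \<le> d t"
    using continuous_attains_inf[OF _ _ cd] xy by auto
  define S where "S = {t \<in> {x..y}. d t \<le> d t0}"
  have "S = {x..y} \<inter> d -` {..d t0}" by (auto simp: S_def)
  then have "closed S"
    using continuous_closed_preimage[OF cd closed_atLeastAtMost closed_atMost, of "d t0"] by (simp only:)
  moreover have "S \<noteq> {}" using t0(1) by (auto simp: S_def)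
  moreover have "bdd_below S" by (auto simp: S_def intro!: bdd_belowI[of _ x])
  ultimately have "Inf S \<in> S" by (intro closed_contains_Inf)
  define m where "m = Inf S"
  have m: "m \<in> {x..y}" "d m \<le> d t0" using \<open>Inf S \<in> S\<close> by (auto simp: m_def S_def)
  have "d t0 < 0" using t0(2)[OF z] neg by (auto simp: d_def k_def)
  then have mi: "x < m" "m < y" using m d_ends by (auto simp: less_le)
  \<comment> \<open>Half the smaller distance to the ends keeps both shifted points strictly inside,
    where the midpoint inequality is available.\<close>
  define \<delta> where "\<delta> = min (m - x) (y - m) / 2"
  have \<delta>: "\<delta> > 0" "x < m - \<delta>" "m + \<delta> < y" using mi by (auto simp: \<delta>_def min_def field_simps)
  have "g (m - \<delta>) + g (m + \<delta>) \<le> 2 * g m"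
    using mid[of "m - \<delta>" "m + \<delta>"] \<delta> by simp
  then have "d (m - \<delta>) + d (m + \<delta>) \<le> 2 * d m" by (simp add: d_def algebra_simps)
  moreover have "d t0 \<le> d (m + \<delta>)" using \<delta> mi by (intro t0(2)) auto
  ultimately have "d (m - \<delta>) \<le> d t0" using m(2) by linarith
  then have "m - \<delta> \<in> S" using \<delta> mi by (auto simp: S_def)
  then have "m \<le> m - \<delta>" unfolding m_def by (intro cInf_lower) (auto simp: S_def intro!: bdd_belowI[of _ x])
  then show False using \<delta> by simp
qed

section \<open>Monotonicity, concavity and the comparison with the sound speed\<close>

context nonlinearity
begin

lemma E_min_zero: "E_min f 0 = 0"
proof -
  have p: "primitive (\<lambda>x. 1 :: real) (\<lambda>x. 0)" by (rule primitive_C1) auto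
  have "polar f (\<lambda>x. 1) (\<lambda>x. 0) (\<lambda>x. 0)"
    unfolding polar_def by (auto simp: p F_one intro: exI[of _ 1])
  moreover have "polar_momentum (\<lambda>x. 1) (\<lambda>x. 0) = 0" by (simp add: polar_momentum_def)
  ultimately have "E_min f 0 \<le> polar_energy f (\<lambda>x. 1) (\<lambda>x. 0) (\<lambda>x. 0)" by (rule E_min_le)
  also have "\<dots> = 0" by (simp add: polar_energy_def F_one)
  finally show ?thesis using E_min_nonneg[of 0] by simp
qed

lemma E_min_mono: "0 \<le> p \<Longrightarrow> p \<le> q \<Longrightarrow> E_min f p \<le> E_min f q"
proof (cases "q = 0")
  case False
  assume "0 \<le> p" "p \<le> q"
  with False have l: "0 \<le> p / q" "p / q \<le> 1" by auto
  have "(p / q)\<^sup>2 \<le> 1" using l power_le_one by blast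
  then show ?thesis using E_min_scale[of "p / q" q] False by simp
qed simp

text \<open>For p <= q, scaling by q/p bounds the increment by ((q/p)^2 - 1) times the value at
  \<open>p\<close>. The resulting Lipschitz constant blows up like 1/a^2, so continuity at 0 must
  come from elsewhere.\<close>

lemma E_min_continuous:
  assumes "0 < a"
  shows "continuous_on {a..b} (E_min f)"
proof (rule continuous_on_subset[OF lipschitz_on_continuous_on])
  define K where "K = 2 * b / a\<^sup>2 * E_min f b"
  have K: "0 \<le> K" if "a \<le> b" using that assms E_min_nonneg[of b] by (simp add: K_def)
  have bound: "E_min f q - E_min f p \<le> K * (q - p)" if "a \<le> p" "p \<le> q" "q \<le> b" for p q
  proof -
    have p: "p > 0" using that assms by simp
    have "q = q / p * p" using p by simp
    moreover have "E_min f (q / p * p) \<le> max 1 ((q / p)\<^sup>2) * E_min f p" by (rule E_min_scale)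
    moreover have "max 1 ((q / p)\<^sup>2) = (q / p)\<^sup>2" using that p by (simp add: max_def)
    ultimately have "E_min f q - E_min f p \<le> ((q / p)\<^sup>2 - 1) * E_min f p" by (simp add: algebra_simps)
    also have "\<dots> \<le> (2 * b / a\<^sup>2 * (q - p)) * E_min f b"
    proof (rule mult_mono)
      have "(q / p)\<^sup>2 - 1 = (q + p) * (q - p) / p\<^sup>2" using p by (simp add: power2_eq_square field_simps)
      also have "\<dots> \<le> (2 * b) * (q - p) / p\<^sup>2" using that p by (intro divide_right_mono mult_right_mono) auto
      also have "\<dots> \<le> (2 * b) * (q - p) / a\<^sup>2"
        using that p assms by (intro divide_left_mono) (auto intro!: power_mono mult_nonneg_nonneg)
      finally show "(q / p)\<^sup>2 - 1 \<le> 2 * b / a\<^sup>2 * (q - p)" by simp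
      show "E_min f p \<le> E_min f b" using that p by (intro E_min_mono) auto
      show "0 \<le> 2 * b / a\<^sup>2 * (q - p)" using that p by auto
    qed (rule E_min_nonneg)
    finally show ?thesis by (simp add: K_def algebra_simps)
  qed
  show "(max 0 K)-lipschitz_on {a..b} (E_min f)"
  proof (rule lipschitz_onI)
    fix p q assume pq: "p \<in> {a..b}" "q \<in> {a..b}"
    have "\<bar>E_min f p - E_min f q\<bar> \<le> K * \<bar>p - q\<bar>"
    proof (cases "p \<le> q")
      case True
      then show ?thesis using bound[of p q] E_min_mono[of p q] pq assms by (auto simp: abs_if)
    next
      case False
      then show ?thesis using bound[of q p] E_min_mono[of q p] pq assms by (auto simp: abs_if)
    qed
    also have "\<dots> \<le> max 0 K * \<bar>p - q\<bar>" by (intro mult_right_mono) auto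
    finally show "dist (E_min f p) (E_min f q) \<le> max 0 K * dist p q" by (simp add: dist_real_def)
  qed simp
qed simp

lemma E_min_above_chord:
  assumes "0 < x" "x < y" "z \<in> {x..y}"
  shows "E_min f x + (E_min f y - E_min f x) / (y - x) * (z - x) \<le> E_min f z"
proof (rule continuous_midpoint_concave_above_chord)
  fix u v assume "x < u" "u < v" "v < y"
  moreover have "2 * ((u + v) / 2) - u = v" by (simp add: field_simps)
  ultimately show "E_min f u + E_min f v \<le> 2 * E_min f ((u + v) / 2)"
    using E_min_midpoint[of u "(u + v) / 2"] assms by fastforce
qed (use assms E_min_continuous in auto)

text \<open>Take the chord from t > 0 to \<open>p\<close>, discard the nonnegative contribution of
  its left end, and let t tend to 0. Nonnegativity thus replaces continuity at 0.\<close>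

lemma E_min_star:
  assumes "0 < p" "0 \<le> l" "l \<le> 1"
  shows "l * E_min f p \<le> E_min f (l * p)"
proof -
  consider "l = 0" | "l = 1" | "0 < l" "l < 1" using assms by linarith
  then show ?thesis
  proof cases
    case 3
    have "(l * p - t) * E_min f p \<le> (p - t) * E_min f (l * p)" if "0 < t" "t < l * p" for t
    proof -
      have tp: "t < p" using that 3 assms(1) mult_strict_right_mono[of l 1 p] by linarith
      have "E_min f t + (E_min f p - E_min f t) / (p - t) * (l * p - t) \<le> E_min f (l * p)"
        by (rule E_min_above_chord) (use that tp 3 assms in \<open>auto simp: mult_left_le_one_le\<close>)
      then have "(p - t) * (E_min f t + (E_min f p - E_min f t) / (p - t) * (l * p - t)) \<le> (p - t) * E_min f (l * p)"
        using tp by (intro mult_left_mono) auto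
      also have "(p - t) * (E_min f t + (E_min f p - E_min f t) / (p - t) * (l * p - t)) =
         (p - l * p) * E_min f t + (l * p - t) * E_min f p"
        using tp by (simp add: field_simps)
      finally have "(p - l * p) * E_min f t + (l * p - t) * E_min f p \<le> (p - t) * E_min f (l * p)" .
      moreover have "0 \<le> (p - l * p) * E_min f t"
        using E_min_nonneg[of t] 3 assms(1) by (intro mult_nonneg_nonneg) (auto simp: mult_left_le_one_le)
      ultimately show ?thesis by linarith
    qed
    then have "\<forall>\<^sub>F t in at_right 0. (l * p - t) * E_min f p \<le> (p - t) * E_min f (l * p)"
      using 3 assms(1) by (auto simp: eventually_at_right intro!: exI[of _ "l * p"])
    moreover have "((\<lambda>t. (l * p - t) * E_min f p) \<longlongrightarrow> (l * p - 0) * E_min f p) (at_right 0)"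
      by (intro tendsto_intros)
    moreover have "((\<lambda>t. (p - t) * E_min f (l * p)) \<longlongrightarrow> (p - 0) * E_min f (l * p)) (at_right 0)"
      by (intro tendsto_intros)
    ultimately have "(l * p - 0) * E_min f p \<le> (p - 0) * E_min f (l * p)"
      by (intro tendsto_le[of "at_right 0"]) auto
    then show ?thesis using assms(1) by simp
  qed (auto simp: E_min_zero)
qed

lemma E_min_concave:
  assumes "0 \<le> x" "0 \<le> y" "0 \<le> u" "0 \<le> v" "u + v = 1"
  shows "u * E_min f x + v * E_min f y \<le> E_min f (u * x + v * y)"
proof -
  have main: "u * E_min f x + v * E_min f y \<le> E_min f (u * x + v * y)"
    if "0 \<le> x" "x < y" "0 \<le> u" "0 \<le> v" "u + v = 1" for x y u v
  proof (cases "x = 0")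
    case True
    then show ?thesis using E_min_star[of y v] that by (simp add: E_min_zero)
  next
    case False
    have u: "u = 1 - v" using that by simp
    have e: "u * x + v * y - x = v * (y - x)" unfolding u by (simp add: algebra_simps)
    have "u * x + v * y \<in> {x..y}"
    proof -
      have "0 \<le> v * (y - x)" "v * (y - x) \<le> 1 * (y - x)"
        using that by (auto intro!: mult_right_mono)
      then show ?thesis using e by auto
    qed
    then have "E_min f x + (E_min f y - E_min f x) / (y - x) * (u * x + v * y - x) \<le> E_min f (u * x + v * y)"
      using that False by (intro E_min_above_chord) auto
    moreover have "(E_min f y - E_min f x) / (y - x) * (u * x + v * y - x) = v * (E_min f y - E_min f x)"
      using that unfolding e by simp
    ultimately show ?thesis unfolding u by (simp add: algebra_simps)
  qed
  consider "x < y" | "y < x" | "x = y" by linarith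
  then show ?thesis
  proof cases
    case 2
    from main[of y x v u] 2 assms show ?thesis by (simp add: add.commute)
  next
    case 3
    then show ?thesis using assms by (simp flip: distrib_right)
  qed (use main assms in auto)
qed

text \<open>The momentum N e^3 dictates e = (p/N)^(1/3), so e^5 and e^7 turn into the powers 5/3 and
  7/3; the threshold N e0^3 corresponds to |m| e0^2 = 1/2. \<open>m\<close> stays a parameter: any
  value gives slope \<open>c\<close> at 0, a suitable one a negative \<open>B\<close>.\<close>

lemma E_min_upper_small:
  assumes m: "m \<noteq> 0"
  defines "B \<equiv> hat_stiffness / 4 * m\<^sup>2 + \<Gamma> * hat_mass 3 * m ^ 3"
  shows "\<exists>k>0. \<exists>p0>0. \<exists>C\<ge>0. \<forall>p. 0 < p \<and> p \<le> p0 \<longrightarrow>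
    E_min f p \<le> c * p + k * B * p powr (5/3) + C * p powr (7/3)"
proof -
  obtain C where C: "C \<ge> 0" "\<And>m e. e > 0 \<Longrightarrow> \<bar>m\<bar> * e\<^sup>2 \<le> 1/2 \<Longrightarrow>
    (\<exists>\<rho> r s. polar f \<rho> r s \<and> polar_momentum \<rho> s = c / 4 * hat_mass 2 * m\<^sup>2 * e ^ 3 \<and>
      polar_energy f \<rho> r s \<le> c * (c / 4 * hat_mass 2 * m\<^sup>2 * e ^ 3)
        + e ^ 5 * (hat_stiffness / 4 * m\<^sup>2 + \<Gamma> * hat_mass 3 * m ^ 3) + C * m ^ 4 * e ^ 7)"
    using test_family by metis
  define N where "N = c / 4 * hat_mass 2 * m\<^sup>2"
  have N: "N > 0" using m c_pos hat_mass_pos[of 2] by (simp add: N_def)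
  define e0 where "e0 = sqrt (1 / (2 * \<bar>m\<bar>))"
  have e0: "e0 > 0" using m by (simp add: e0_def)
  show ?thesis
  proof (intro exI conjI allI impI)
    show "N powr (- (5/3)) > 0" using N by simp
    show "N * e0 ^ 3 > 0" using N e0 by simp
    show "C * m ^ 4 * N powr (- (7/3)) \<ge> 0" using C(1) by simp
    fix p assume p: "0 < p \<and> p \<le> N * e0 ^ 3"
    define e where "e = (p / N) powr (1/3)"
    have e: "e > 0" using p N by (simp add: e_def)
    have e_pow: "e ^ k = p powr (real k / 3) * N powr (- (real k / 3))" for k
    proof -
      have "e ^ k = e powr real k" by (rule powr_realpow[OF e, symmetric])
      also have "\<dots> = (p / N) powr (real k / 3)" by (simp add: e_def powr_powr)
      also have "\<dots> = p powr (real k / 3) / N powr (real k / 3)" by (rule powr_divide)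
      finally show ?thesis by (simp add: powr_minus_divide)
    qed
    have "e \<le> e0"
    proof -
      have "e ^ 3 = p / N" using p N by (simp add: e_pow powr_minus divide_inverse)
      also have "\<dots> \<le> e0 ^ 3" using p N by (simp add: field_simps)
      finally show ?thesis using e0 by (simp add: power_mono_iff[of e e0 3] e[THEN less_imp_le] less_imp_le)
    qed
    then have "e\<^sup>2 \<le> e0\<^sup>2" using e by (intro power_mono) auto
    then have "e\<^sup>2 \<le> 1 / (2 * \<bar>m\<bar>)" using m by (simp add: e0_def)
    then have "\<bar>m\<bar> * e\<^sup>2 \<le> 1/2" using m by (simp add: field_simps)
    from C(2)[OF e this] obtain \<rho> r s where P: "polar f \<rho> r s" "polar_momentum \<rho> s = N * e ^ 3"
      "polar_energy f \<rho> r s \<le> c * (N * e ^ 3) + e ^ 5 * B + C * m ^ 4 * e ^ 7"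
      by (auto simp: N_def B_def)
    have Ne: "N * e ^ 3 = p" using p N by (simp add: e_pow powr_minus)
    have "E_min f p \<le> polar_energy f \<rho> r s" by (rule E_min_le[OF P(1)]) (use P(2) Ne in simp)
    also have "\<dots> \<le> c * p + e ^ 5 * B + C * m ^ 4 * e ^ 7" using P(3) Ne by simp
    also have "\<dots> = c * p + N powr (- (5/3)) * B * p powr (5/3) + C * m ^ 4 * N powr (- (7/3)) * p powr (7/3)"
      by (simp add: e_pow algebra_simps)
    finally show "E_min f p \<le> c * p + N powr (- (5/3)) * B * p powr (5/3) + C * m ^ 4 * N powr (- (7/3)) * p powr (7/3)" .
  qed
qed

text \<open>By \<open>E_min_star\<close> the ratio of \<open>E_min f t\<close> to \<open>t\<close>
  does not increase with \<open>t\<close>, and long waves bound it by c + o(1) as t tends to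
  0.\<close>

lemma E_min_le_sound:
  assumes "0 \<le> p"
  shows "E_min f p \<le> c * p"
proof (cases "p = 0")
  case False
  with assms have p: "p > 0" by simp
  obtain k p0 C where U: "p0 > 0" "\<And>t. 0 < t \<Longrightarrow> t \<le> p0 \<Longrightarrow> E_min f t \<le> c * t + k * t powr (5/3) + C * t powr (7/3)"
    using E_min_upper_small[of 1] by (metis one_neq_zero)
  have "E_min f p \<le> c * p + p * (k * t powr (2/3) + C * t powr (4/3))" if t: "0 < t" "t \<le> min p p0" for t
  proof -
    have "t / p * E_min f p \<le> E_min f (t / p * p)" by (rule E_min_star) (use t p in auto)
    also have "\<dots> \<le> c * t + k * t powr (5/3) + C * t powr (7/3)" using U(2)[of t] t p by simp
    also have "\<dots> = t * (c + k * t powr (2/3) + C * t powr (4/3))"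
    proof -
      have "t powr (5/3) = t * t powr (2/3)" "t powr (7/3) = t * t powr (4/3)"
        using t powr_add[of t 1 "2/3"] powr_add[of t 1 "4/3"] by simp_all
      then show ?thesis by (simp add: algebra_simps)
    qed
    finally have "t * E_min f p \<le> t * (p * (c + k * t powr (2/3) + C * t powr (4/3)))"
      using p by (simp add: field_simps)
    then have "E_min f p \<le> p * (c + k * t powr (2/3) + C * t powr (4/3))"
      using t by (simp only: mult_le_cancel_left_pos)
    then show ?thesis by (simp add: algebra_simps)
  qed
  then have "\<forall>\<^sub>F t in at_right 0. E_min f p \<le> c * p + p * (k * t powr (2/3) + C * t powr (4/3))"
    using p U(1) by (auto simp: eventually_at_right intro!: exI[of _ "min p p0"])
  moreover have "((\<lambda>t. c * p + p * (k * t powr (2/3) + C * t powr (4/3))) \<longlongrightarrow> c * p + p * (k * 0 + C * 0)) (at_right 0)"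
    by (intro tendsto_intros tendsto_zero_powrI[where b = "2/3"] tendsto_zero_powrI[where b = "4/3"])
      (auto simp: eventually_at_filter)
  ultimately show ?thesis by (intro tendsto_lowerbound[of _ _ "at_right 0"]) auto
qed (simp add: E_min_zero)

text \<open>Each summand is at least its proportional share of
  \<open>E_min f (p + q)\<close>.\<close>

lemma E_min_subadditive:
  assumes "0 \<le> p" "0 \<le> q"
  shows "E_min f (p + q) \<le> E_min f p + E_min f q"
proof (cases "p + q = 0")
  case True
  then show ?thesis using assms E_min_nonneg by (simp add: E_min_zero)
next
  case False
  then have s: "p + q > 0" using assms by simp
  have "p / (p + q) * E_min f (p + q) \<le> E_min f p" "q / (p + q) * E_min f (p + q) \<le> E_min f q"
    using E_min_star[OF s, of "p / (p + q)"] E_min_star[OF s, of "q / (p + q)"] assms s by auto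
  moreover have "p / (p + q) * E_min f (p + q) + q / (p + q) * E_min f (p + q) = E_min f (p + q)"
    using s by (simp flip: distrib_right add_divide_distrib)
  ultimately show ?thesis by linarith
qed

text \<open>For 0 <= p <= q, monotonicity bounds the increment below, and subadditivity with
  \<open>E_min_le_sound\<close> at q - p bounds it above; evenness reduces everything to this
  case.\<close>

lemma E_min_lipschitz: "\<bar>E_min f p - E_min f q\<bar> \<le> c * \<bar>p - q\<bar>"
proof -
  have main: "\<bar>E_min f p - E_min f q\<bar> \<le> c * (q - p)" if "0 \<le> p" "p \<le> q" for p q
    using E_min_subadditive[of p "q - p"] E_min_le_sound[of "q - p"] E_min_mono[OF that] that by simp
  have abs: "E_min f \<bar>p\<bar> = E_min f p" for p by (auto simp: abs_if E_min_even)
  have "\<bar>E_min f \<bar>p\<bar> - E_min f \<bar>q\<bar>\<bar> \<le> c * \<bar>\<bar>p\<bar> - \<bar>q\<bar>\<bar>"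
    using main[of "\<bar>p\<bar>" "\<bar>q\<bar>"] main[of "\<bar>q\<bar>" "\<bar>p\<bar>"] by (cases "\<bar>p\<bar> \<le> \<bar>q\<bar>") (auto simp: abs_minus_commute)
  also have "\<dots> \<le> c * \<bar>p - q\<bar>" using c_pos by (intro mult_left_mono) auto
  finally show ?thesis by (simp add: abs)
qed

end

section \<open>Lower bound for small momentum\<close>

text \<open>Otherwise the integral would be at least n e for every n. Applied to (1 - \<rho>^2)^2 it
  supplies distant points with modulus close to 1, so no limit at infinity has to be
  established.\<close>

lemma integrable_small_left:
  fixes k :: "real \<Rightarrow> real"
  assumes k: "integrable lborel k" "\<And>x. 0 \<le> k x" and e: "e > 0"
  shows "\<exists>a\<le>x. k a < e"
proof (rule ccontr)
  assume "\<not> ?thesis"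
  then have big: "e \<le> k a" if "a \<le> x" for a using that by (auto simp: not_less)
  obtain n where n: "(LINT x|lborel. k x) / e < real n" using reals_Archimedean2 by blast
  have "real n * e = (LINT t|lborel. indicator {x - real n..x} t *\<^sub>R e)" by simp
  also have "\<dots> \<le> (LINT x|lborel. k x)"
  proof (rule integral_mono)
    show "integrable lborel (\<lambda>t. indicator {x - real n..x} t *\<^sub>R e)"
      by (intro borel_integrable_compact) auto
    show "indicator {x - real n..x} t *\<^sub>R e \<le> k t" for t
      using big[of t] k(2)[of t] by (auto simp: indicator_def)
  qed fact
  finally show False using n e by (simp add: field_simps)
qed

lemma integrable_small_right:
  fixes k :: "real \<Rightarrow> real"
  assumes k: "integrable lborel k" "\<And>x. 0 \<le> k x" and e: "e > 0"
  shows "\<exists>a\<ge>x. k a < e"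
proof -
  have "integrable lborel (\<lambda>x. k (- x))"
    using lborel_integrable_real_affine[OF k(1), of "-1" 0] by simp
  from integrable_small_left[OF this k(2) e, of "- x"] obtain a where "a \<le> - x" "k (- a) < e" by blast
  then show ?thesis by (intro exI[of _ "- a"]) auto
qed

lemma primitive_increment_le_integral:
  fixes u :: "real \<Rightarrow> real"
  assumes u: "primitive u g" and ab: "a \<le> b" and k: "integrable lborel k" "\<And>x. \<bar>g x\<bar> \<le> k x"
  shows "\<bar>u b - u a\<bar> \<le> (LINT x:{a..b}|lborel. k x)"
proof -
  have g: "g \<in> L1_loc" using u by (simp add: primitive_def)
  have "\<bar>u b - u a\<bar> = \<bar>LINT x:{a..b}|lborel. g x\<bar>" by (simp add: primitive_integral[OF u ab])
  also have "\<dots> \<le> (LINT x:{a..b}|lborel. \<bar>g x\<bar>)"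
    using set_integral_norm_bound[OF L1_locD(2)[OF g, of a b]] by simp
  also have "\<dots> \<le> (LINT x:{a..b}|lborel. k x)"
  proof (rule set_integral_mono)
    show "set_integrable lborel {a..b} (\<lambda>x. \<bar>g x\<bar>)"
      using L1_locD(2)[OF L1_loc_norm[OF g]] by simp
    show "set_integrable lborel {a..b} k"
      using k(1) unfolding set_integrable_def by (intro integrable_mult_indicator) auto
  qed (rule k(2))
  finally show ?thesis .
qed

lemma set_integral_le_integral:
  fixes k :: "real \<Rightarrow> real"
  assumes "integrable lborel k" "\<And>x. 0 \<le> k x" "A \<in> sets borel"
  shows "(LINT x:A|lborel. k x) \<le> (LINT x|lborel. k x)"
  unfolding set_lebesgue_integral_def
  using assms by (intro integral_mono integrable_mult_indicator) (auto simp: indicator_def)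

context nonlinearity
begin

text \<open>The derivative of hat(\<rho>) is at most 4 |r| times the positive part of 1 - \<rho>^2,
  since \<rho> <= 1 where the latter is nonzero. Young's inequality with weight \<open>t\<close>
  gives an integrable bound, and the integration starts at a point where hat(\<rho>) is as small as
  desired.\<close>

lemma hat_bound:
  assumes p: "polar f \<rho> r s" and t: "t > 0"
  shows "hat (\<rho> x) \<le> 2 * (t * (LINT x|lborel. (1 - (\<rho> x)\<^sup>2)\<^sup>2) + (LINT x|lborel. (r x)\<^sup>2) / t)"
proof -
  note D = polarD[OF p]
  define k where "k x = 2 * (t * (1 - (\<rho> x)\<^sup>2)\<^sup>2 + (r x)\<^sup>2 / t)" for x
  have k: "integrable lborel k" unfolding k_def[abs_def] using D(4,10) by simp
  have k0: "0 \<le> k x" for x using t by (simp add: k_def)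
  have prim: "primitive (\<lambda>x. hat (\<rho> x)) (\<lambda>x. hat' (\<rho> x) * r x)"
    by (rule primitive_chain[OF D(1)]) (auto intro: DERIV_hat continuous_hat)
  have kb: "\<bar>hat' (\<rho> x) * r x\<bar> \<le> k x" for x
  proof -
    define m where "m = max 0 (1 - (\<rho> x)\<^sup>2)"
    have "\<rho> x * m \<le> m"
    proof (cases "(\<rho> x)\<^sup>2 \<le> 1")
      case True
      then have "\<rho> x \<le> 1" using D(2)[of x] by (simp add: power_le_one_iff abs_square_le_1)
      then show ?thesis by (simp add: m_def mult_left_le_one_le D(2)[THEN less_imp_le])
    qed (simp add: m_def)
    moreover have "\<bar>hat' (\<rho> x) * r x\<bar> = 4 * (\<rho> x * m) * \<bar>r x\<bar>"
      using D(2)[of x] by (simp add: hat'_def m_def abs_mult)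
    ultimately have 1: "\<bar>hat' (\<rho> x) * r x\<bar> \<le> 4 * m * \<bar>r x\<bar>" by (simp add: mult_right_mono)
    have "0 \<le> (t * m - \<bar>r x\<bar>)\<^sup>2 / t" using t by simp
    also have "\<dots> = t * m\<^sup>2 + (r x)\<^sup>2 / t - 2 * (m * \<bar>r x\<bar>)"
      using t by (simp add: power2_diff power_mult_distrib field_simps power2_eq_square)
    finally have 2: "4 * m * \<bar>r x\<bar> \<le> 2 * (t * m\<^sup>2 + (r x)\<^sup>2 / t)" by simp
    have "m\<^sup>2 \<le> (1 - (\<rho> x)\<^sup>2)\<^sup>2" by (auto simp: m_def max_def)
    then have "t * m\<^sup>2 \<le> t * (1 - (\<rho> x)\<^sup>2)\<^sup>2" using t by (intro mult_left_mono) auto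
    with 1 2 show ?thesis by (simp add: k_def)
  qed
  have "hat (\<rho> x) \<le> (LINT x|lborel. k x)"
  proof (rule field_le_epsilon)
    fix e :: real assume "e > 0"
    then obtain a where a: "a \<le> x" "(1 - (\<rho> a)\<^sup>2)\<^sup>2 < e"
      using integrable_small_left[OF D(10), of e x] by auto
    have "hat (\<rho> a) \<le> (1 - (\<rho> a)\<^sup>2)\<^sup>2" by (auto simp: hat_def max_def)
    moreover have "\<bar>hat (\<rho> x) - hat (\<rho> a)\<bar> \<le> (LINT x:{a..x}|lborel. k x)"
      by (rule primitive_increment_le_integral[OF prim a(1) k kb])
    moreover have "\<dots> \<le> (LINT x|lborel. k x)" by (rule set_integral_le_integral[OF k k0]) simp
    ultimately show "hat (\<rho> x) \<le> (LINT x|lborel. k x) + e" using a(2) by linarith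
  qed
  also have "(LINT x|lborel. k x) = 2 * (t * (LINT x|lborel. (1 - (\<rho> x)\<^sup>2)\<^sup>2) + (LINT x|lborel. (r x)\<^sup>2) / t)"
    unfolding k_def using D(4,10) by simp
  finally show ?thesis .
qed

lemma polar_energy_bounds:
  assumes p: "polar f \<rho> r s"
  shows "(LINT x|lborel. (r x)\<^sup>2) \<le> 2 * polar_energy f \<rho> r s"
    "(LINT x|lborel. (\<rho> x * s x)\<^sup>2) \<le> 2 * polar_energy f \<rho> r s"
    "c\<^sup>2 * (LINT x|lborel. (1 - (\<rho> x)\<^sup>2)\<^sup>2) \<le> 8 * polar_energy f \<rho> r s"
proof -
  note D = polarD[OF p]
  have E: "2 * polar_energy f \<rho> r s = (LINT x|lborel. (r x)\<^sup>2) + (LINT x|lborel. (\<rho> x * s x)\<^sup>2) + (LINT x|lborel. F ((\<rho> x)\<^sup>2))"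
    using D(4-6) by (simp add: polar_energy_def)
  have n: "0 \<le> (LINT x|lborel. (r x)\<^sup>2)" "0 \<le> (LINT x|lborel. (\<rho> x * s x)\<^sup>2)" "0 \<le> (LINT x|lborel. F ((\<rho> x)\<^sup>2))"
    by (auto intro!: Bochner_Integration.integral_nonneg F_nonneg)
  show "(LINT x|lborel. (r x)\<^sup>2) \<le> 2 * polar_energy f \<rho> r s"
    "(LINT x|lborel. (\<rho> x * s x)\<^sup>2) \<le> 2 * polar_energy f \<rho> r s" using E n by linarith+
  have "(LINT x|lborel. c\<^sup>2 / 4 * (1 - (\<rho> x)\<^sup>2)\<^sup>2) \<le> (LINT x|lborel. F ((\<rho> x)\<^sup>2))"
    using D(6,10) by (intro integral_mono F_ge) auto
  then have "c\<^sup>2 * (LINT x|lborel. (1 - (\<rho> x)\<^sup>2)\<^sup>2) \<le> 4 * (LINT x|lborel. F ((\<rho> x)\<^sup>2))" by simp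
  then show "c\<^sup>2 * (LINT x|lborel. (1 - (\<rho> x)\<^sup>2)\<^sup>2) \<le> 8 * polar_energy f \<rho> r s"
    using E n by linarith
qed

text \<open>With h = 1 - \<rho>^2, the square of \<rho> s - c h / (2 \<rho>) reduces the energy
  density minus c h s to r^2 + F - (c^2/4) h^2/\<rho>^2. As F >= (c^2/4) h^2, the loss is at most
  (c^2/2) X h^2, where \<open>X\<close> bounds the positive part of h.\<close>

lemma polar_energy_lower:
  assumes p: "polar f \<rho> r s" and mom: "polar_momentum \<rho> s = t ^ 3" and t: "t > 0"
    and small: "2 * (8 / c + 2 * c) * t ^ 3 \<le> 1 / 4"
  shows "c * t ^ 3 - (4 * c\<^sup>2 + 4 / c) * t ^ 5 \<le> polar_energy f \<rho> r s"
proof (cases "c * t ^ 3 \<le> polar_energy f \<rho> r s")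
  case True
  moreover have "0 \<le> (4 * c\<^sup>2 + 4 / c) * t ^ 5" using c_pos t by simp
  ultimately show ?thesis by linarith
next
  \<comment> \<open>The energy is now below c t^3, which bounds both \<open>N\<close> and
    \<open>R\<close> by multiples of t^3.\<close>
  case False
  note D = polarD[OF p]
  define h where "h x = 1 - (\<rho> x)\<^sup>2" for x
  define N where "N = (LINT x|lborel. (h x)\<^sup>2)"
  define R where "R = (LINT x|lborel. (r x)\<^sup>2)"
  have N0: "0 \<le> N" and R0: "0 \<le> R" unfolding N_def R_def by (auto intro!: Bochner_Integration.integral_nonneg)
  have R: "R \<le> 2 * c * t ^ 3"
    using polar_energy_bounds(1)[OF p] False unfolding R_def by linarith
  have N: "N \<le> 8 / c * t ^ 3"
  proof -
    have "c\<^sup>2 * N \<le> 8 * (c * t ^ 3)"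
      using polar_energy_bounds(3)[OF p] False unfolding N_def h_def by linarith
    then show ?thesis using c_pos by (simp add: field_simps power2_eq_square)
  qed
  have hb: "(max 0 (h x))\<^sup>2 \<le> 2 * (\<mu> * N + R / \<mu>)" if "\<mu> > 0" for \<mu> x
    using hat_bound[OF p that, of x] by (simp add: hat_def h_def N_def R_def)
  \<comment> \<open>Inserting the bound on \<open>R\<close> here would give only X = O(t) and a loss
    of order t^4; the term R/t is therefore kept and absorbed at the end.\<close>
  define X where "X = sqrt (2 * (t * N + R / t))"
  have X2: "X\<^sup>2 = 2 * (t * N + R / t)" and X0: "0 \<le> X"
    using N0 R0 t by (simp_all add: X_def)
  have hX: "max 0 (h x) \<le> X" for x
    using hb[OF t, of x] unfolding X_def by (intro real_le_rsqrt)
  \<comment> \<open>Weight 1 instead of \<open>t\<close>: only an absolute bound is wanted, and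
    \<open>small\<close> is exactly what it takes.\<close>
  have half: "h x \<le> 1 / 2" for x
  proof -
    have "(max 0 (h x))\<^sup>2 \<le> 2 * (N + R)" using hb[of 1 x] by simp
    also have "\<dots> \<le> 2 * (8 / c * t ^ 3 + 2 * c * t ^ 3)" using N R by simp
    also have "\<dots> \<le> (1/2)\<^sup>2" using small by (simp add: power2_eq_square algebra_simps)
    finally have "max 0 (h x) \<le> 1/2" by (rule power2_le_imp_le) simp
    then show ?thesis by simp
  qed
  have pt: "(r x)\<^sup>2 - c\<^sup>2 / 2 * X * (h x)\<^sup>2 \<le> energy_density \<rho> r s x - c * (h x * s x)" for x
  proof -
    have \<rho>2: "(\<rho> x)\<^sup>2 = 1 - h x" by (simp add: h_def)
    have q: "(\<rho> x)\<^sup>2 \<ge> 1/2" using half[of x] \<rho>2 by simp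
    have sq: "0 \<le> (\<rho> x * s x - c * h x / (2 * \<rho> x))\<^sup>2" by simp
    have "(\<rho> x * s x - c * h x / (2 * \<rho> x))\<^sup>2 = (\<rho> x * s x)\<^sup>2 - c * (h x * s x) + c\<^sup>2 / 4 * ((h x)\<^sup>2 / (\<rho> x)\<^sup>2)"
      using D(2)[of x] by (simp add: power2_diff power_divide power_mult_distrib)
    moreover have "(h x)\<^sup>2 / (\<rho> x)\<^sup>2 \<le> (h x)\<^sup>2 + 2 * X * (h x)\<^sup>2"
    proof -
      have "h x \<le> 2 * X * (\<rho> x)\<^sup>2"
      proof (cases "h x \<le> 0")
        case True
        also have "0 \<le> 2 * X * (\<rho> x)\<^sup>2" using X0 by simp
        finally show ?thesis .
      next
        case False
        then have "h x \<le> 2 * X * (1/2)" using hX[of x] by simp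
        also have "\<dots> \<le> 2 * X * (\<rho> x)\<^sup>2" using q X0 by (intro mult_left_mono) auto
        finally show ?thesis .
      qed
      then have "1 \<le> (1 + 2 * X) * (\<rho> x)\<^sup>2" using \<rho>2 unfolding distrib_right by linarith
      then have "(h x)\<^sup>2 * 1 \<le> (h x)\<^sup>2 * ((1 + 2 * X) * (\<rho> x)\<^sup>2)" by (intro mult_left_mono) auto
      moreover have "(\<rho> x)\<^sup>2 > 0" using q by linarith
      ultimately have "(h x)\<^sup>2 / (\<rho> x)\<^sup>2 \<le> (h x)\<^sup>2 * (1 + 2 * X)"
        by (simp only: pos_divide_le_eq mult_1_right mult.assoc)
      then show ?thesis by (simp add: algebra_simps)
    qed
    then have "c\<^sup>2 / 4 * ((h x)\<^sup>2 / (\<rho> x)\<^sup>2) \<le> c\<^sup>2 / 4 * ((h x)\<^sup>2 + 2 * X * (h x)\<^sup>2)" by (intro mult_left_mono) auto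
    moreover have "c\<^sup>2 / 4 * ((h x)\<^sup>2 + 2 * X * (h x)\<^sup>2) = c\<^sup>2 / 4 * (h x)\<^sup>2 + c\<^sup>2 / 2 * X * (h x)\<^sup>2"
      by (simp add: algebra_simps)
    moreover have "c\<^sup>2 / 4 * (h x)\<^sup>2 \<le> F ((\<rho> x)\<^sup>2)" using F_ge[of "(\<rho> x)\<^sup>2"] by (simp add: h_def)
    ultimately show ?thesis using sq unfolding energy_density_def by linarith
  qed
  have ih: "integrable lborel (\<lambda>x. (h x)\<^sup>2)" "integrable lborel (\<lambda>x. h x * s x)"
    using D(10,11) by (simp_all add: h_def)
  have "(LINT x|lborel. (r x)\<^sup>2 - c\<^sup>2 / 2 * X * (h x)\<^sup>2) \<le> (LINT x|lborel. energy_density \<rho> r s x - c * (h x * s x))"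
    by (rule integral_mono) (use D(3,4) ih pt in simp_all)
  moreover have "(LINT x|lborel. (r x)\<^sup>2 - c\<^sup>2 / 2 * X * (h x)\<^sup>2) = R - c\<^sup>2 / 2 * X * N"
    using D(4) ih by (simp add: R_def N_def)
  moreover have "(LINT x|lborel. energy_density \<rho> r s x - c * (h x * s x)) = 2 * polar_energy f \<rho> r s - 2 * c * t ^ 3"
    using D(3) ih mom by (simp add: polar_energy_density polar_momentum_def h_def)
  ultimately have main: "R / 2 - c\<^sup>2 / 4 * X * N \<le> polar_energy f \<rho> r s - c * t ^ 3" by simp
  have "c\<^sup>2 / 4 * X * N \<le> 2 * c * (X * t ^ 3)"
  proof -
    have "c\<^sup>2 / 4 * X * N \<le> c\<^sup>2 / 4 * X * (8 / c * t ^ 3)" using N X0 by (intro mult_left_mono) auto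
    then show ?thesis using c_pos by (simp add: power2_eq_square field_simps)
  qed
  moreover have "2 * c * (X * t ^ 3) \<le> 4 * c\<^sup>2 * t ^ 5 + 4 / c * t ^ 5 + R / 2"
  proof -
    \<comment> \<open>Young's inequality weighted so that (t/4) X^2 contains exactly R/2, the
      gradient term available in \<open>main\<close>.\<close>
    have "0 \<le> (X - 4 * c * t\<^sup>2)\<^sup>2" by simp
    then have "2 * (4 * c * t\<^sup>2) * X \<le> X\<^sup>2 + 16 * c\<^sup>2 * t ^ 4"
      by (simp add: power2_diff power_mult_distrib algebra_simps)
    then have "(t / 4) * (2 * (4 * c * t\<^sup>2) * X) \<le> (t / 4) * (X\<^sup>2 + 16 * c\<^sup>2 * t ^ 4)"
      using t by (intro mult_left_mono) auto
    also have "(t / 4) * (2 * (4 * c * t\<^sup>2) * X) = 2 * c * (X * t ^ 3)"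
      by (simp add: power3_eq_cube power2_eq_square)
    also have "(t / 4) * (X\<^sup>2 + 16 * c\<^sup>2 * t ^ 4) = t\<^sup>2 * N / 2 + R / 2 + 4 * c\<^sup>2 * t ^ 5"
      unfolding X2 using t by (simp add: eval_nat_numeral field_simps)
    also have "t\<^sup>2 * N / 2 \<le> t\<^sup>2 * (8 / c * t ^ 3) / 2"
      using N by (intro divide_right_mono mult_left_mono) auto
    also have "t\<^sup>2 * (8 / c * t ^ 3) / 2 = 4 / c * t ^ 5" by (simp add: eval_nat_numeral)
    finally show ?thesis by simp
  qed
  ultimately show ?thesis using main by (simp add: algebra_simps)
qed

lemma E_min_lower:
  "\<exists>K>0. \<exists>p0>0. \<forall>p. 0 < p \<and> p \<le> p0 \<longrightarrow> c * p - K * p powr (5/3) \<le> E_min f p"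
proof (intro exI conjI allI impI)
  show "4 * c\<^sup>2 + 4 / c > 0" using c_pos by (simp add: add_pos_pos)
  have k: "8 * (8 / c + 2 * c) > 0" using c_pos by (simp add: add_pos_pos)
  \<comment> \<open>With t^3 = p this threshold is the smallness condition of
    \<open>polar_energy_lower\<close>.\<close>
  then show "1 / (8 * (8 / c + 2 * c)) > 0" by simp
  fix p assume p: "0 < p \<and> p \<le> 1 / (8 * (8 / c + 2 * c))"
  define t where "t = p powr (1/3)"
  have t: "t > 0" using p by (simp add: t_def)
  have tp: "t ^ k = p powr (real k / 3)" for k
  proof -
    have "t ^ k = t powr real k" by (rule powr_realpow[OF t, symmetric])
    then show ?thesis by (simp add: t_def powr_powr)
  qed
  have t3: "t ^ 3 = p" using p by (simp add: tp)
  have "p * (8 * (8 / c + 2 * c)) \<le> 1" using p k by (simp add: pos_le_divide_eq)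
  then have small: "2 * (8 / c + 2 * c) * t ^ 3 \<le> 1 / 4" unfolding t3 by (simp add: algebra_simps)
  show "c * p - (4 * c\<^sup>2 + 4 / c) * p powr (5/3) \<le> E_min f p"
  proof (rule E_min_greatest)
    fix \<rho> r s assume "polar f \<rho> r s" "polar_momentum \<rho> s = p"
    with polar_energy_lower[of \<rho> r s t] t small show "c * p - (4 * c\<^sup>2 + 4 / c) * p powr (5/3) \<le> polar_energy f \<rho> r s"
      by (simp add: t3 tp[of 5])
  qed
qed

lemma E_min_asymptotics:
  assumes "deriv (deriv f) 1 + 3 * deriv f 1 \<noteq> 0"
  shows "\<exists>q0>0. \<exists>K0>0. \<exists>K1>0. \<exists>K2>0. \<forall>q\<in>{0..q0}.
    c * q - K0 * q powr (5/3) \<le> E_min f q \<and> E_min f q \<le> c * q - K1 * q powr (5/3) + K2 * q powr (7/3)"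
proof -
  have \<Gamma>: "\<Gamma> \<noteq> 0" using assms by (simp add: \<Gamma>_def)
  obtain K0 p0 where L: "K0 > 0" "p0 > 0" "\<And>p. 0 < p \<Longrightarrow> p \<le> p0 \<Longrightarrow> c * p - K0 * p powr (5/3) \<le> E_min f p"
    using E_min_lower by blast
  \<comment> \<open>Chosen so that \<open>hat_stiffness / 4\<close> minus |\<Gamma>|
    \<open>hat_mass 3\<close> M equals -1. With the sign of \<open>m\<close> opposite to that of
    \<Gamma>, the cubic term is negative and the coefficient of e^5 becomes -M^2.\<close>
  define M where "M = (hat_stiffness / 4 + 1) / (\<bar>\<Gamma>\<bar> * hat_mass 3)"
  have M: "M > 0" using \<Gamma> hat_stiffness_nonneg hat_mass_pos[of 3] by (simp add: M_def)
  define m where "m = - sgn \<Gamma> * M"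
  have "hat_stiffness / 4 * m\<^sup>2 + \<Gamma> * hat_mass 3 * m ^ 3 = M\<^sup>2 * (hat_stiffness / 4 - \<bar>\<Gamma>\<bar> * hat_mass 3 * M)"
    using \<Gamma> by (auto simp: m_def sgn_if abs_if power2_eq_square power3_eq_cube algebra_simps)
  also have "\<bar>\<Gamma>\<bar> * hat_mass 3 * M = hat_stiffness / 4 + 1"
    using \<Gamma> hat_mass_pos[of 3] by (simp add: M_def)
  finally have B: "hat_stiffness / 4 * m\<^sup>2 + \<Gamma> * hat_mass 3 * m ^ 3 = - M\<^sup>2" by simp
  have "m \<noteq> 0" using M \<Gamma> by (simp add: m_def sgn_zero_iff)
  from E_min_upper_small[OF this, unfolded B] obtain k p1 C where
    U: "k > 0" "p1 > 0" "C \<ge> 0" "\<And>p. 0 < p \<Longrightarrow> p \<le> p1 \<Longrightarrow> E_min f p \<le> c * p + k * (- M\<^sup>2) * p powr (5/3) + C * p powr (7/3)"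
    by blast
  show ?thesis
  proof (intro exI conjI ballI)
    \<comment> \<open>\<open>C\<close> may be 0 while the last constant has to be positive, hence
      \<open>C + 1\<close>.\<close>
    show "min p0 p1 > 0" "K0 > 0" "k * M\<^sup>2 > 0" "C + 1 > 0" using L U M by auto
    fix q assume q: "q \<in> {0..min p0 p1}"
    show "c * q - K0 * q powr (5/3) \<le> E_min f q"
      using L(3)[of q] q by (cases "q = 0") (auto simp: E_min_zero)
    show "E_min f q \<le> c * q - k * M\<^sup>2 * q powr (5/3) + (C + 1) * q powr (7/3)"
    proof (cases "q = 0")
      case False
      then have "E_min f q \<le> c * q + k * (- M\<^sup>2) * q powr (5/3) + C * q powr (7/3)" using U(4)[of q] q by auto
      moreover have "C * q powr (7/3) \<le> (C + 1) * q powr (7/3)" by (intro mult_right_mono) auto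
      ultimately show ?thesis by simp
    qed (simp add: E_min_zero)
  qed
qed

lemma E_min_strict_subadditive:
  assumes nd: "deriv (deriv f) 1 + 3 * deriv f 1 \<noteq> 0" and pq: "0 < p" "0 < q"
  shows "E_min f (p + q) < E_min f p + E_min f q"
proof (rule ccontr)
  assume "\<not> ?thesis"
  define s where "s = p + q"
  have s: "s > 0" using pq by (simp add: s_def)
  have star: "p / s * E_min f s \<le> E_min f p" "q / s * E_min f s \<le> E_min f q"
    using E_min_star[OF s, of "p / s"] E_min_star[OF s, of "q / s"] pq by (auto simp: s_def)
  have "p / s * E_min f s + q / s * E_min f s = E_min f s"
    using s by (simp add: s_def flip: distrib_right add_divide_distrib)
  \<comment> \<open>The two star inequalities already add up to subadditivity, so equality there
    forces equality in each of them.\<close>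
  with star \<open>\<not> ?thesis\<close> have Ep: "E_min f p = p / s * E_min f s" by (simp add: s_def)
  define k where "k = E_min f s / s"
  text \<open>Equality in the star inequality at the interior point \<open>p\<close> makes the concave function
    linear on \<open>[0, p]\<close>.\<close>
  have lin: "E_min f t = k * t" if t: "0 < t" "t < p" for t
  proof (rule antisym)
    have "E_min f t + (E_min f s - E_min f t) / (s - t) * (p - t) \<le> E_min f p"
      by (rule E_min_above_chord) (use t pq in \<open>auto simp: s_def\<close>)
    then have "(s - t) * (E_min f t + (E_min f s - E_min f t) / (s - t) * (p - t)) \<le> (s - t) * E_min f p"
      using t pq by (intro mult_left_mono) (auto simp: s_def)
    also have "(s - t) * (E_min f t + (E_min f s - E_min f t) / (s - t) * (p - t)) = (s - p) * E_min f t + (p - t) * E_min f s"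
      using t pq by (simp add: field_simps s_def)
    finally have "(s - p) * E_min f t \<le> (s - t) * (p * k) - (p - t) * (s * k)"
      using s unfolding Ep by (simp add: k_def)
    also have "\<dots> = (s - p) * (k * t)" by (simp add: algebra_simps)
    finally show "E_min f t \<le> k * t" using pq by (simp add: s_def)
    show "k * t \<le> E_min f t"
      using E_min_star[OF s, of "t / s"] t pq s by (simp add: k_def s_def mult.commute)
  qed
  obtain q0 K0 K1 K2 where A: "q0 > 0" "K0 > 0" "K1 > 0" "K2 > 0"
    "\<And>t. t \<in> {0..q0} \<Longrightarrow> c * t - K0 * t powr (5/3) \<le> E_min f t"
    "\<And>t. t \<in> {0..q0} \<Longrightarrow> E_min f t \<le> c * t - K1 * t powr (5/3) + K2 * t powr (7/3)"
    using E_min_asymptotics[OF nd] by metis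
  have fac: "t powr (5/3) = t * t powr (2/3)" "t powr (7/3) = t * (t powr (2/3) * t powr (2/3))" if "t > 0" for t :: real
    using that powr_add[of t 1 "2/3"] powr_add[of t 1 "4/3"] powr_add[of t "2/3" "2/3"] by simp_all
  \<comment> \<open>Divided by \<open>t\<close>, the asymptotics contradict a constant slope: the
    lower bound forces k >= c in the limit, the upper one k < c for small \<open>t\<close>.\<close>
  have small: "c - K0 * t powr (2/3) \<le> k" "k \<le> c - t powr (2/3) * (K1 - K2 * t powr (2/3))" if t: "0 < t" "t < min p q0" for t
  proof -
    have "t * (c - K0 * t powr (2/3)) \<le> t * k" "t * k \<le> t * (c - t powr (2/3) * (K1 - K2 * t powr (2/3)))"
      using A(5)[of t] A(6)[of t] lin[of t] t fac[of t] by (simp_all add: algebra_simps)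
    then show "c - K0 * t powr (2/3) \<le> k" "k \<le> c - t powr (2/3) * (K1 - K2 * t powr (2/3))"
      using t by (simp_all only: mult_le_cancel_left_pos)
  qed
  have z: "((\<lambda>t::real. t powr (2/3)) \<longlongrightarrow> 0) (at_right 0)"
    by (intro tendsto_zero_powrI[where b = "2/3"] tendsto_intros) (auto simp: eventually_at_filter)
  have ev: "\<forall>\<^sub>F t in at_right 0. 0 < t \<and> t < min p q0"
    using pq A(1) by (auto simp: eventually_at_right intro!: exI[of _ "min p q0"])
  have "((\<lambda>t. c - K0 * t powr (2/3)) \<longlongrightarrow> c - K0 * 0) (at_right 0)" by (intro tendsto_intros z)
  then have "c - K0 * 0 \<le> k"
    by (rule tendsto_upperbound) (use ev small(1) in \<open>auto elim: eventually_mono\<close>)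
  then have ck: "c \<le> k" by simp
  have "((\<lambda>t. K1 - K2 * t powr (2/3)) \<longlongrightarrow> K1 - K2 * 0) (at_right 0)" by (intro tendsto_intros z)
  then have "\<forall>\<^sub>F t in at_right 0. 0 < K1 - K2 * t powr (2/3)" using A(3) by (intro order_tendstoD) auto
  with ev have "\<forall>\<^sub>F t in at_right (0::real). False"
  proof eventually_elim
    case (elim t)
    then have "0 < t powr (2/3) * (K1 - K2 * t powr (2/3))" by (intro mult_pos_pos) auto
    then show False using small(2)[of t] elim ck by linarith
  qed
  then show False by simp
qed

end

section \<open>The kink and the threshold momentum\<close>

lemma bounded_partial_integrals:
  fixes k :: "real \<Rightarrow> real"
  assumes k: "continuous_on UNIV k" "\<And>x. 0 \<le> k x"
    and B: "\<And>n. (LINT x:{- real n..real n}|lborel. k x) \<le> B"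
  shows "integrable lborel k" "(LINT x|lborel. k x) \<le> B"
proof -
  define I where "I n = (LINT x|lborel. indicator {- real n..real n} x *\<^sub>R k x)" for n
  have IB: "I n \<le> B" for n using B by (simp add: I_def set_lebesgue_integral_def)
  have ii: "integrable lborel (\<lambda>x. indicator {- real n..real n} x *\<^sub>R k x)" for n
    by (intro borel_integrable_compact continuous_on_subset[OF k(1)]) auto
  have mono: "indicator {- real n..real n} x *\<^sub>R k x \<le> indicator {- real m..real m} x *\<^sub>R k x" if "n \<le> m" for n m x
    using that k(2)[of x] by (auto simp: indicator_def)
  have "incseq I" unfolding I_def by (intro incseq_SucI integral_mono ii mono) auto
  then obtain L where L: "I \<longlonglongrightarrow> L" "\<And>n. I n \<le> L"
    using incseq_convergent[of I B] IB by auto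
  have lim: "(\<lambda>n. indicator {- real n..real n} x *\<^sub>R k x) \<longlonglongrightarrow> k x" for x
  proof -
    obtain N where N: "\<bar>x\<bar> < real N" using reals_Archimedean2 by blast
    have "\<forall>n\<ge>N. indicator {- real n..real n} x *\<^sub>R k x = k x" using N by (auto simp: indicator_def)
    then show ?thesis by (intro tendsto_eventually) (auto simp: eventually_sequentially)
  qed
  have hb: "has_bochner_integral lborel k L"
    by (rule has_bochner_integral_monotone_convergence[OF ii])
      (use lim L(1) k(1) mono in \<open>auto simp: I_def[abs_def] mono_def intro!: borel_measurable_continuous_onI\<close>)
  then show "integrable lborel k" by (rule integrable.intros)
  have "L \<le> B" by (rule LIMSEQ_le_const2[OF L(1)]) (use IB in auto)
  then show "(LINT x|lborel. k x) \<le> B" using hb by (simp add: has_bochner_integral_integral_eq)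
qed

text \<open>Separation of variables: \<open>g\<close> is the inverse of the primitive
  \<open>G\<close> of 1/\<beta>. The bound \<open>C\<close> makes \<open>G\<close> grow at least
  linearly, so \<open>G\<close> is onto and its inverse is \<open>C\<close>-Lipschitz, hence
  continuous.\<close>

lemma autonomous_ode_global_solution:
  fixes \<beta> :: "real \<Rightarrow> real"
  assumes \<beta>: "continuous_on UNIV \<beta>" "\<And>z. 0 < \<beta> z" "\<And>z. \<beta> z \<le> C"
  shows "\<exists>g. g 0 = 0 \<and> (\<forall>x. (g has_real_derivative \<beta> (g x)) (at x))"
proof -
  have C: "C > 0" using \<beta>(2,3)[of 0] by linarith
  have ci: "continuous_on UNIV (\<lambda>z. 1 / \<beta> z)"
    using \<beta> by (intro continuous_intros) (auto simp: less_imp_neq[symmetric])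
  obtain G where G: "primitive G (\<lambda>z. 1 / \<beta> z)" "G 0 = 0"
    using primitive_exists[OF L1_loc_continuous[OF ci]] by blast
  have dG: "(G has_real_derivative 1 / \<beta> z) (at z)" for z
    using primitive_has_vector_derivative[OF G(1) ci] by (simp add: has_real_derivative_iff_has_vector_derivative)
  have inc: "(y - x) / C \<le> G y - G x" if "x \<le> y" for x y
  proof -
    have "G x - x / C \<le> G y - y / C"
    proof (rule DERIV_nonneg_imp_nondecreasing[OF that])
      fix z
      have "((\<lambda>z. G z - z / C) has_real_derivative 1 / \<beta> z - 1 / C) (at z)"
        by (rule DERIV_diff[OF dG DERIV_cdivide[OF DERIV_ident]])
      moreover have "1 / C \<le> 1 / \<beta> z" using \<beta>(2,3)[of z] by (intro divide_left_mono) auto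
      ultimately show "\<exists>y. ((\<lambda>z. G z - z / C) has_real_derivative y) (at z) \<and> 0 \<le> y"
        by (intro exI[of _ "1 / \<beta> z - 1 / C"]) simp
    qed
    then show ?thesis by (simp add: diff_divide_distrib)
  qed
  have surj: "\<exists>z. G z = x" for x
  proof -
    have "G (- C * \<bar>x\<bar>) \<le> x" "x \<le> G (C * \<bar>x\<bar>)"
      using inc[of "- C * \<bar>x\<bar>" 0] inc[of 0 "C * \<bar>x\<bar>"] C G(2) by (auto simp: field_simps abs_if split: if_splits)
    then have "\<exists>z\<ge>- C * \<bar>x\<bar>. z \<le> C * \<bar>x\<bar> \<and> G z = x"
      using primitive_continuous[OF G(1)] C by (intro IVT') (auto intro: continuous_on_subset)
    then show ?thesis by blast
  qed
  then obtain g where g: "\<And>x. G (g x) = x" by metis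
  have up: "\<bar>g y - g x\<bar> \<le> C * \<bar>y - x\<bar>" if "g x \<le> g y" for x y
  proof -
    have "g y - g x \<le> C * (y - x)" using inc[OF that] C by (simp add: g pos_divide_le_eq mult.commute)
    also have "\<dots> \<le> C * \<bar>y - x\<bar>" using C by (intro mult_left_mono) auto
    finally show ?thesis using that by simp
  qed
  have dist: "\<bar>g x - g y\<bar> \<le> C * \<bar>x - y\<bar>" for x y
    using up[of x y] up[of y x] by (cases "g x \<le> g y") (auto simp: abs_minus_commute)
  have "C-lipschitz_on UNIV g"
    by (rule lipschitz_onI) (use dist C in \<open>auto simp: dist_real_def\<close>)
  then have "continuous_on UNIV g" by (rule lipschitz_on_continuous_on)
  then have cg: "isCont g x" for x by (simp add: continuous_on_eq_continuous_at)
  have "(g has_real_derivative inverse (1 / \<beta> (g x))) (at x)" for x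
    by (rule DERIV_inverse_function[where f = G and a = "x - 1" and b = "x + 1"])
      (use dG \<beta>(2)[of "g x"] g cg in auto)
  moreover have "g 0 = 0"
    using inc[of 0 "g 0"] inc[of "g 0" 0] G(2) C g[of 0] by (cases "0 \<le> g 0") (auto simp: divide_le_0_iff zero_le_divide_iff)
  ultimately show ?thesis by auto
qed

section \<open>The kink and the cost of coming close to zero\<close>

context nonlinearity
begin

text \<open>The speed in the kink equation v' = w v and at the same time the Modica-Mortola weight:
  its primitive W turns energy into variation of W along the modulus.\<close>

definition w :: "real \<Rightarrow> real" where "w y = sqrt (F (y\<^sup>2))"

lemma w_cont: "continuous_on A w"
  unfolding w_def[abs_def] by (intro continuous_intros continuous_on_compose2[OF F_cont[of UNIV]] subset_UNIV)

lemma w_sq: "(w y)\<^sup>2 = F (y\<^sup>2)" and w_nonneg: "0 \<le> w y"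
  by (simp_all add: w_def F_nonneg)

lemma w_lower: "c / 2 * \<bar>1 - y\<^sup>2\<bar> \<le> w y"
proof -
  have "(c / 2 * \<bar>1 - y\<^sup>2\<bar>)\<^sup>2 \<le> F (y\<^sup>2)"
    using F_ge[of "y\<^sup>2"] by (simp add: power_mult_distrib power_divide)
  then show ?thesis unfolding w_def by (rule real_le_rsqrt)
qed

text \<open>This will bound the right-hand side of the kink equation after the substitution by tanh.
  Where y^2 >= 1/2, Taylor gives F (y^2) <= K (1 - y^2)^2; elsewhere 1 - y^2 > 1/2 and boundedness
  of F suffices.\<close>

lemma w_upper: "\<exists>C. \<forall>y. \<bar>y\<bar> < 1 \<longrightarrow> w y \<le> C * (1 - y\<^sup>2)"
proof -
  obtain C where C: "C \<ge> 0" "\<And>h. \<bar>h\<bar> \<le> 1/2 \<Longrightarrow> F (1 - h) \<le> c\<^sup>2 / 4 * h\<^sup>2 + deriv (deriv f) 1 / 6 * h ^ 3 + C * h ^ 4"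
    using F_upper by blast
  define K where "K = c\<^sup>2 / 4 + \<bar>deriv (deriv f) 1 / 6\<bar> + C"
  have K: "K \<ge> 0" using C(1) by (simp add: K_def)
  have near: "F (1 - h) \<le> K * h\<^sup>2" if "0 \<le> h" "h \<le> 1/2" for h
  proof -
    have h1: "h * h\<^sup>2 \<le> 1 * h\<^sup>2" "h\<^sup>2 * h\<^sup>2 \<le> 1 * h\<^sup>2"
      using mult_right_mono[of h 1 "h\<^sup>2"] mult_right_mono[of "h\<^sup>2" 1 "h\<^sup>2"] power_le_one[of h 2] that by auto
    have "deriv (deriv f) 1 / 6 * h ^ 3 \<le> \<bar>deriv (deriv f) 1 / 6\<bar> * h ^ 3"
      using that by (intro mult_right_mono) auto
    also have "\<dots> \<le> \<bar>deriv (deriv f) 1 / 6\<bar> * h\<^sup>2"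
      using h1(1) by (intro mult_left_mono) (auto simp: power3_eq_cube power2_eq_square)
    finally have "deriv (deriv f) 1 / 6 * h ^ 3 \<le> \<bar>deriv (deriv f) 1 / 6\<bar> * h\<^sup>2" .
    moreover have "C * h ^ 4 \<le> C * h\<^sup>2" using h1(2) C(1) by (intro mult_left_mono) (auto simp: power4_eq_xxxx power2_eq_square mult.assoc)
    ultimately show ?thesis using C(2)[of h] that by (simp add: K_def algebra_simps)
  qed
  have "bounded (F ` {0..1/2})" by (intro compact_imp_bounded compact_continuous_image F_cont) auto
  then obtain M where M: "M > 0" "\<And>z. z \<in> {0..1/2} \<Longrightarrow> \<bar>F z\<bar> \<le> M"
    unfolding bounded_pos by (metis imageI real_norm_def)
  have "w y \<le> (sqrt K + 2 * sqrt M) * (1 - y\<^sup>2)" if "\<bar>y\<bar> < 1" for y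
  proof -
    have y2: "y\<^sup>2 < 1" using that by (simp add: abs_square_less_1)
    have nn: "0 \<le> sqrt K * (1 - y\<^sup>2)" "0 \<le> 2 * sqrt M * (1 - y\<^sup>2)" using K M(1) y2 by auto
    show ?thesis
    proof (cases "y\<^sup>2 \<ge> 1/2")
      case True
      then have "F (y\<^sup>2) \<le> K * (1 - y\<^sup>2)\<^sup>2" using near[of "1 - y\<^sup>2"] y2 by simp
      then have "w y \<le> sqrt (K * (1 - y\<^sup>2)\<^sup>2)" unfolding w_def by (rule real_sqrt_le_mono)
      also have "\<dots> = sqrt K * (1 - y\<^sup>2)" using y2 by (simp add: real_sqrt_mult)
      finally show ?thesis using nn by (simp add: algebra_simps)
    next
      case False
      then have "w y \<le> sqrt M" unfolding w_def using M(2)[of "y\<^sup>2"] by (intro real_sqrt_le_mono) auto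
      also have "sqrt M * 1 \<le> sqrt M * (2 * (1 - y\<^sup>2))" using False M(1) by (intro mult_left_mono) auto
      finally show ?thesis using nn by (simp add: algebra_simps)
    qed
  qed
  then show ?thesis by blast
qed

text \<open>The substitution \<open>v = tanh g\<close> turns the equation \<open>v' = w v\<close> of the kink into one with a bounded
  right-hand side.\<close>

lemma kink_exists:
  assumes W: "\<And>y. (W has_real_derivative w y) (at y)"
  obtains v where "v \<in> X1 f" "v 0 = 0" "energy f v \<le> W 1 - W (- 1)"
proof -
  obtain C where C: "\<And>y. \<bar>y\<bar> < 1 \<Longrightarrow> w y \<le> C * (1 - y\<^sup>2)" using w_upper by blast
  have th: "\<bar>tanh z\<bar> < 1" "1 - (tanh z)\<^sup>2 > 0" for z :: real
    using tanh_real_bounds[of z] by (auto simp: abs_less_iff abs_square_less_1)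
  define \<beta> where "\<beta> z = w (tanh z) / (1 - (tanh z)\<^sup>2)" for z
  have c\<beta>: "continuous_on UNIV \<beta>"
    unfolding \<beta>_def using th(2)
    by (intro continuous_intros continuous_on_compose2[OF w_cont[of UNIV]]) (auto simp: less_imp_neq[symmetric])
  have "0 < \<beta> z" for z
  proof -
    have "0 < c / 2 * \<bar>1 - (tanh z)\<^sup>2\<bar>" using c_pos th(2)[of z] by simp
    also have "\<dots> \<le> w (tanh z)" by (rule w_lower)
    finally show ?thesis using th(2)[of z] by (simp add: \<beta>_def)
  qed
  moreover have "\<beta> z \<le> C" for z
    using C[OF th(1)] th(2)[of z] by (simp add: \<beta>_def pos_divide_le_eq)
  ultimately obtain g where g: "g 0 = 0" "\<And>x. (g has_real_derivative \<beta> (g x)) (at x)"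
    using autonomous_ode_global_solution[OF c\<beta>] by blast
  define v where "v x = tanh (g x)" for x
  have dv: "(v has_real_derivative w (v x)) (at x)" for x
  proof -
    have "cosh (g x) \<noteq> 0" using cosh_real_pos[of "g x"] by simp
    then have "((\<lambda>x. tanh (g x)) has_real_derivative (1 - (tanh (g x))\<^sup>2) * \<beta> (g x)) (at x)"
      by (auto intro!: derivative_eq_intros g(2))
    then show ?thesis using th(2)[of "g x"] by (simp add: v_def[abs_def] \<beta>_def)
  qed
  have cv: "continuous_on UNIV v" using dv by (auto intro!: continuous_at_imp_continuous_on DERIV_isCont)
  have cw: "continuous_on UNIV (\<lambda>x. w (v x))" by (intro continuous_on_compose2[OF w_cont[of UNIV] cv]) auto
  have pv: "primitive v (\<lambda>x. w (v x))"
    by (rule primitive_C1[OF _ cw]) (simp add: dv flip: has_real_derivative_iff_has_vector_derivative)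
  have pW: "primitive (\<lambda>x. W (v x)) (\<lambda>x. w (v x) * w (v x))"
    by (rule primitive_chain[OF pv W w_cont])
  have Wmono: "W a \<le> W b" if "a \<le> b" for a b
    by (rule DERIV_nonneg_imp_nondecreasing[OF that]) (use W w_nonneg in blast)
  have vb: "- 1 \<le> v x" "v x \<le> 1" for x using th(1)[of "g x"] by (auto simp: v_def)
  \<comment> \<open>As v' = w v, the square of w v is the derivative of W v, and \<open>v\<close>
    stays between -1 and 1.\<close>
  have "(LINT x:{- real n..real n}|lborel. (w (v x))\<^sup>2) \<le> W 1 - W (- 1)" for n
    using primitive_integral[OF pW, of "- real n" "real n"] Wmono[OF vb(2)[of "real n"]] Wmono[OF vb(1)[of "- real n"]]
    by (simp add: power2_eq_square)
  note I = bounded_partial_integrals[OF _ _ this]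
  have i: "integrable lborel (\<lambda>x. (w (v x))\<^sup>2)" "(LINT x|lborel. (w (v x))\<^sup>2) \<le> W 1 - W (- 1)"
    using I continuous_on_power[OF cw, of 2] by auto
  define u where "u x = complex_of_real (v x)" for x
  have pu: "primitive u (\<lambda>x. complex_of_real (w (v x)))"
    unfolding u_def[abs_def] by (rule primitive_of_real[OF pv])
  have Fu: "F ((cmod (u x))\<^sup>2) = (w (v x))\<^sup>2" for x by (simp add: u_def w_sq)
  have ig: "integrable lborel (\<lambda>x. (cmod (complex_of_real (w (v x))))\<^sup>2)" "integrable lborel (\<lambda>x. F ((cmod (u x))\<^sup>2))"
    unfolding Fu using i(1) by simp_all
  note X = X1_energy[OF pu ig]
  \<comment> \<open>Equipartition: gradient and potential terms coincide, and the factor 1/2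
    disappears.\<close>
  have "energy f u = (LINT x|lborel. (w (v x))\<^sup>2)"
    unfolding X(2) Fu using i(1) by simp
  moreover have "u 0 = 0" using g(1) by (simp add: u_def v_def)
  ultimately show ?thesis using X(1) i(2) by (intro that[of u]) simp_all
qed

text \<open>The inequality w(\<rho>) |r| <= half the energy density bounds the variation of W along
  \<rho> by the energy. On each side of \<open>x\<close> there is a point where \<rho> >= 1 - d, so
  the transition between 1 - d and d is paid twice.\<close>

lemma polar_energy_transition:
  assumes p: "polar f \<rho> r s" and W: "\<And>y. (W has_real_derivative w y) (at y)"
    and x: "\<rho> x < d" and d: "0 < d" "d < 1"
  shows "2 * (W (1 - d) - W d) \<le> polar_energy f \<rho> r s"
proof -
  note D = polarD[OF p]
  define k where "k x = energy_density \<rho> r s x / 2" for x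
  have k: "integrable lborel k" unfolding k_def[abs_def] using D(3) by simp
  have k0: "0 \<le> k x" for x by (simp add: k_def energy_density_nonneg)
  have kE: "(LINT x|lborel. k x) = polar_energy f \<rho> r s" by (simp add: k_def polar_energy_density)
  have prim: "primitive (\<lambda>x. W (\<rho> x)) (\<lambda>x. w (\<rho> x) * r x)"
    by (rule primitive_chain[OF D(1) W w_cont])
  have kb: "\<bar>w (\<rho> x) * r x\<bar> \<le> k x" for x
  proof -
    have "2 * (w (\<rho> x) * \<bar>r x\<bar>) \<le> (w (\<rho> x))\<^sup>2 + (r x)\<^sup>2"
      using sum_squares_bound[of "w (\<rho> x)" "\<bar>r x\<bar>"] by simp
    moreover have "0 \<le> (\<rho> x * s x)\<^sup>2" "\<bar>w (\<rho> x) * r x\<bar> = w (\<rho> x) * \<bar>r x\<bar>"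
      using w_nonneg[of "\<rho> x"] by (simp_all add: abs_mult)
    moreover have "2 * A \<le> B + R \<Longrightarrow> 0 \<le> S \<Longrightarrow> A \<le> (R + S + B) / 2" for A B R S :: real by simp
    ultimately show ?thesis unfolding k_def energy_density_def w_sq by metis
  qed
  have Wmono: "W a \<le> W b" if "a \<le> b" for a b
    by (rule DERIV_nonneg_imp_nondecreasing[OF that]) (use W w_nonneg in blast)
  \<comment> \<open>The hypothesis gives \<rho>^2 > 1 - d, and (1 - d)^2 <= 1 - d turns this into a
    bound on \<rho>.\<close>
  have near: "1 - d \<le> \<rho> a" if "(1 - (\<rho> a)\<^sup>2)\<^sup>2 < d\<^sup>2" for a
  proof -
    have "\<bar>1 - (\<rho> a)\<^sup>2\<bar> < d" using that d(1) by (simp add: abs_square_less_1 power2_less_imp_less[of "\<bar>1 - (\<rho> a)\<^sup>2\<bar>" d])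
    moreover have "(1 - d)\<^sup>2 \<le> 1 - d" using d by (simp add: power2_eq_square mult_left_le_one_le)
    ultimately have "(1 - d)\<^sup>2 \<le> (\<rho> a)\<^sup>2" by simp
    then show ?thesis using D(2)[of a] by (rule power2_le_imp_le[OF _ less_imp_le])
  qed
  obtain a where a: "a \<le> x" "(1 - (\<rho> a)\<^sup>2)\<^sup>2 < d\<^sup>2"
    using integrable_small_left[OF D(10), of "d\<^sup>2" x] d by auto
  obtain b where b: "x \<le> b" "(1 - (\<rho> b)\<^sup>2)\<^sup>2 < d\<^sup>2"
    using integrable_small_right[OF D(10), of "d\<^sup>2" x] d by auto
  have Wx: "W (\<rho> x) \<le> W d" using x by (intro Wmono) simp
  have "W (1 - d) - W d \<le> \<bar>W (\<rho> x) - W (\<rho> a)\<bar>" using Wmono[OF near[OF a(2)]] Wx by simp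
  also have "\<dots> \<le> (LINT x:{a..x}|lborel. k x)" by (rule primitive_increment_le_integral[OF prim a(1) k kb])
  also have "\<dots> \<le> (LINT x:{..x}|lborel. k x)"
    using k k0 unfolding set_lebesgue_integral_def
    by (intro integral_mono integrable_mult_indicator) (auto simp: indicator_def)
  finally have 1: "W (1 - d) - W d \<le> (LINT x:{..x}|lborel. k x)" .
  have k': "integrable lborel (\<lambda>x. k (- x))"
    using lborel_integrable_real_affine[OF k, of "-1" 0] by simp
  \<comment> \<open>Mirrored so that the right half-line takes the form \<open>{..- x}\<close>
    required by \<open>integral_split_flip\<close>.\<close>
  have primr: "primitive (\<lambda>x. W (\<rho> (0 - x))) (\<lambda>x. - (w (\<rho> (0 - x)) * r (0 - x)))"
    by (rule primitive_reflect[OF prim])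
  have "W (1 - d) - W d \<le> \<bar>W (\<rho> (0 - (- x))) - W (\<rho> (0 - (- b)))\<bar>" using Wmono[OF near[OF b(2)]] Wx by simp
  also have "\<dots> \<le> (LINT x:{- b..- x}|lborel. k (- x))"
    by (rule primitive_increment_le_integral[OF primr _ k']) (use b(1) kb in \<open>auto simp flip: minus_mult_left\<close>)
  also have "\<dots> \<le> (LINT x:{..- x}|lborel. k (- x))"
    using k' k0 unfolding set_lebesgue_integral_def
    by (intro integral_mono integrable_mult_indicator) (auto simp: indicator_def)
  finally have 2: "W (1 - d) - W d \<le> (LINT x:{..- x}|lborel. k (- x))" .
  show ?thesis using 1 2 integral_split_flip[OF k, of x] kE by simp
qed

text \<open>Young's inequality, with \<open>s\<close> controlled through \<rho> >= d. Read
  contrapositively: at bounded energy, a larger momentum pushes the modulus below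
  \<open>d\<close>.\<close>

lemma polar_momentum_bound:
  assumes p: "polar f \<rho> r s" and d: "0 < d" "\<And>x. d \<le> \<rho> x"
  shows "\<bar>polar_momentum \<rho> s\<bar> \<le> (2 / c\<^sup>2 + 1 / (2 * d\<^sup>2)) * polar_energy f \<rho> r s"
proof -
  note D = polarD[OF p]
  have i: "integrable lborel (\<lambda>x. (1 - (\<rho> x)\<^sup>2)\<^sup>2 + 1 / d\<^sup>2 * (\<rho> x * s x)\<^sup>2)" using D(5,10) by simp
  have pt: "2 * \<bar>(1 - (\<rho> x)\<^sup>2) * s x\<bar> \<le> (1 - (\<rho> x)\<^sup>2)\<^sup>2 + 1 / d\<^sup>2 * (\<rho> x * s x)\<^sup>2" for x
  proof -
    have "2 * \<bar>(1 - (\<rho> x)\<^sup>2) * s x\<bar> \<le> (1 - (\<rho> x)\<^sup>2)\<^sup>2 + (s x)\<^sup>2"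
      using sum_squares_bound[of "\<bar>1 - (\<rho> x)\<^sup>2\<bar>" "\<bar>s x\<bar>"] by (simp add: abs_mult)
    moreover have "d\<^sup>2 * (s x)\<^sup>2 \<le> (\<rho> x)\<^sup>2 * (s x)\<^sup>2"
      using d by (intro mult_right_mono power_mono) (auto intro: less_imp_le)
    then have "(s x)\<^sup>2 \<le> 1 / d\<^sup>2 * (\<rho> x * s x)\<^sup>2" using d(1) by (simp add: field_simps power_mult_distrib)
    ultimately show ?thesis by linarith
  qed
  have "4 * \<bar>polar_momentum \<rho> s\<bar> \<le> 2 * (LINT x|lborel. \<bar>(1 - (\<rho> x)\<^sup>2) * s x\<bar>)"
    using integral_abs_bound[of lborel "\<lambda>x. (1 - (\<rho> x)\<^sup>2) * s x"] by (simp add: polar_momentum_def)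
  also have "\<dots> = (LINT x|lborel. 2 * \<bar>(1 - (\<rho> x)\<^sup>2) * s x\<bar>)" by simp
  also have "\<dots> \<le> (LINT x|lborel. (1 - (\<rho> x)\<^sup>2)\<^sup>2 + 1 / d\<^sup>2 * (\<rho> x * s x)\<^sup>2)"
    using D(11) i pt by (intro integral_mono) auto
  also have "\<dots> = (LINT x|lborel. (1 - (\<rho> x)\<^sup>2)\<^sup>2) + 1 / d\<^sup>2 * (LINT x|lborel. (\<rho> x * s x)\<^sup>2)"
    using D(5,10) by simp
  also have "\<dots> \<le> 8 / c\<^sup>2 * polar_energy f \<rho> r s + 1 / d\<^sup>2 * (2 * polar_energy f \<rho> r s)"
  proof (rule add_mono)
    show "(LINT x|lborel. (1 - (\<rho> x)\<^sup>2)\<^sup>2) \<le> 8 / c\<^sup>2 * polar_energy f \<rho> r s"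
      using polar_energy_bounds(3)[OF p] c_pos by (simp add: field_simps)
    show "1 / d\<^sup>2 * (LINT x|lborel. (\<rho> x * s x)\<^sup>2) \<le> 1 / d\<^sup>2 * (2 * polar_energy f \<rho> r s)"
      using polar_energy_bounds(2)[OF p] by (intro mult_left_mono) auto
  qed
  finally show ?thesis by (simp add: algebra_simps)
qed

text \<open>A bounded energy at arbitrarily large momentum forces near-vanishing, which costs at least the
  energy of the kink.\<close>

lemma kink_energy_le:
  assumes m: "\<And>p. a \<le> p \<Longrightarrow> E_min f p \<le> m" and W: "\<And>y. (W has_real_derivative w y) (at y)"
  shows "2 * (W 1 - W 0) \<le> m"
proof -
  have step: "2 * (W (1 - d) - W d) \<le> m + d" if d: "0 < d" "d < 1" for d
  proof -
    define K where "K = (2 / c\<^sup>2 + 1 / (2 * d\<^sup>2)) * (m + d)"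
    \<comment> \<open>Beyond any momentum that a modulus >= d allows, and in the range where
      \<open>E_min\<close> is at most \<open>m\<close>.\<close>
    define p where "p = max a (K + 1)"
    obtain \<rho> r s where P: "polar f \<rho> r s" "polar_momentum \<rho> s = p" "polar_energy f \<rho> r s < E_min f p + d"
      using E_min_approx[OF d(1), of p] by blast
    have E: "polar_energy f \<rho> r s \<le> m + d" using P(3) m[of p] by (simp add: p_def)
    have "\<exists>x. \<rho> x < d"
    proof (rule ccontr)
      assume "\<not> ?thesis"
      then have "\<And>x. d \<le> \<rho> x" by (auto simp: not_less)
      from polar_momentum_bound[OF P(1) d(1) this]
      have "\<bar>p\<bar> \<le> (2 / c\<^sup>2 + 1 / (2 * d\<^sup>2)) * polar_energy f \<rho> r s" by (simp add: P(2))
      also have "\<dots> \<le> K" unfolding K_def using E by (intro mult_left_mono) auto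
      finally show False by (simp add: p_def)
    qed
    then obtain x where "\<rho> x < d" by blast
    from polar_energy_transition[OF P(1) W this d] E show ?thesis by linarith
  qed
  have cW: "isCont W y" for y using W by (rule DERIV_isCont)
  have "((\<lambda>d. 2 * (W (1 - d) - W d)) \<longlongrightarrow> 2 * (W (1 - 0) - W 0)) (at_right 0)"
    by (intro tendsto_intros isCont_tendsto_compose[OF cW])
  moreover have "((\<lambda>d. m + d) \<longlongrightarrow> m + 0) (at_right 0)" by (intro tendsto_intros)
  moreover have "\<forall>\<^sub>F d in at_right 0. 2 * (W (1 - d) - W d) \<le> m + d"
    unfolding eventually_at_right_field using step by (intro exI[of _ 1] conjI allI impI) (auto simp del: right_diff_distrib_numeral)
  ultimately have "2 * (W (1 - 0) - W 0) \<le> m + 0" by (intro tendsto_le[of "at_right 0"]) auto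
  then show ?thesis by simp
qed

lemma E_min_strict_mono:
  assumes ab: "0 \<le> a" "a < b" "ereal b \<le> q_star f"
  shows "E_min f a < E_min f b"
proof (rule ccontr)
  assume "\<not> ?thesis"
  then have eq: "E_min f b \<le> E_min f a" by simp
  define m where "m = E_min f a"
  have le: "E_min f p \<le> m" if "a \<le> p" for p
  proof (cases "p \<le> b")
    case True
    then show ?thesis using E_min_mono[of p b] eq that ab by (simp add: m_def)
  next
    case False
    \<comment> \<open>\<open>b\<close> is the convex combination of \<open>a\<close> and
      \<open>p\<close> with weight \<open>t\<close>; concavity at \<open>b\<close>, where the value
      is at most \<open>m\<close>, bounds the value at \<open>p\<close>.\<close>
    define t where "t = (b - a) / (p - a)"
    have t: "0 < t" "t \<le> 1" using False ab by (auto simp: t_def)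
    have "(1 - t) * a + t * p = a + t * (p - a)" by (simp add: algebra_simps)
    also have "\<dots> = b" using False ab by (simp add: t_def)
    finally have "(1 - t) * E_min f a + t * E_min f p \<le> E_min f b"
      using E_min_concave[of a p "1 - t" t] t ab False by simp
    then have "t * E_min f p \<le> t * m" using eq by (simp add: m_def algebra_simps)
    then show ?thesis using t by simp
  qed
  \<comment> \<open>Strictness yields an admissible \<open>q\<close> beyond \<open>a\<close>. Its
    value \<open>E_min f q\<close> is at least the plateau value \<open>m\<close>, so the threshold
    condition applies to the kink.\<close>
  have "ereal a < q_star f" using ab by (meson ereal_less(1) less_ereal.simps(1) order_less_le_trans)
  then obtain q where q: "a < q" "\<forall>v \<in> X1 f. energy f v \<le> E_min f q \<longrightarrow> (INF x. cmod (v x)) > 0"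
    unfolding q_star_def less_Sup_iff by auto
  have qm: "m \<le> E_min f q" unfolding m_def using q(1) ab by (intro E_min_mono) auto
  obtain W where pW: "primitive W w"
    using primitive_exists[OF L1_loc_continuous[OF w_cont]] by blast
  have W: "(W has_real_derivative w y) (at y)" for y
    using primitive_has_vector_derivative[OF pW w_cont] by (simp add: has_real_derivative_iff_has_vector_derivative)
  \<comment> \<open>\<open>w\<close> is even, so the full kink from -1 to 1 costs twice the
    transition from 0 to 1.\<close>
  have even: "W 0 - W (- 1) = W 1 - W 0"
  proof -
    have "((\<lambda>y. w (- y)) has_integral W 0 - W (- 1)) {-0..- (-1)}"
      using pW by (subst has_integral_reflect_real) (simp add: primitive_def)
    moreover have "(\<lambda>y. w (- y)) = w" by (auto simp: w_def)
    ultimately have "(w has_integral W 0 - W (- 1)) {0..1}" by simp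
    moreover have "(w has_integral W 1 - W 0) {0..1}" using pW by (simp add: primitive_def)
    ultimately show ?thesis by (rule has_integral_unique)
  qed
  obtain v where v: "v \<in> X1 f" "v 0 = 0" "energy f v \<le> W 1 - W (- 1)"
    using kink_exists[OF W] by blast
  have "2 * (W 1 - W 0) \<le> m" by (rule kink_energy_le[of a]) (use le W in auto)
  have "energy f v \<le> E_min f q"
  proof -
    have "W 1 - W (- 1) = 2 * (W 1 - W 0)" using even by (simp add: algebra_simps)
    with v(3) \<open>2 * (W 1 - W 0) \<le> m\<close> qm show ?thesis by simp
  qed
  then have "0 < (INF x. cmod (v x))" using q(2) v(1) by blast
  also have "\<dots> \<le> cmod (v 0)" by (intro cINF_lower bdd_belowI[of _ 0]) auto
  finally show False using v(2) by simp
qed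

end

theorem proposition1p15:
  fixes f :: "real \<Rightarrow> real"
  assumes "C_class 3 f"
    and "f 1 = 0"
    and "deriv f 1 < 0"
    and "\<forall>\<rho>\<ge>0. (sound_speed f)\<^sup>2 / 4 * (1 - \<rho>)\<^sup>2 \<le> F_pot f \<rho>"
    and "\<exists>M\<ge>0. \<exists>q\<ge>2. \<forall>\<rho>\<ge>2. F_pot f \<rho> \<le> M * \<bar>1 - \<rho>\<bar> powr q"
  shows
    "((\<forall>p. 0 \<le> E_min f p) \<and> (\<forall>p. E_min f (- p) = E_min f p) \<and>
      (\<forall>p q. \<bar>E_min f p - E_min f q\<bar> \<le> sound_speed f * \<bar>p - q\<bar>)) \<and>
     (mono_on {0..} (E_min f) \<and> concave_on {0..} (E_min f) \<and>
      strict_mono_on {q. 0 \<le> q \<and> ereal q \<le> q_star f} (E_min f)) \<and>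
     (deriv (deriv f) 1 + 3 * deriv f 1 \<noteq> 0 \<longrightarrow>
      (\<exists>q\<^sub>0>0. \<exists>K\<^sub>0>0. \<exists>K\<^sub>1>0. \<exists>K\<^sub>2>0. \<forall>q\<in>{0..q\<^sub>0}.
         sound_speed f * q - K\<^sub>0 * q powr (5/3) \<le> E_min f q \<and>
         E_min f q \<le> sound_speed f * q - K\<^sub>1 * q powr (5/3) + K\<^sub>2 * q powr (7/3))) \<and>
     (deriv (deriv f) 1 + 3 * deriv f 1 \<noteq> 0 \<longrightarrow>
      (\<forall>p>0. \<forall>q>0. E_min f (p + q) < E_min f p + E_min f q))"
proof -
  interpret nonlinearity f by unfold_locales (use assms in auto)
  have "mono_on {0..} (E_min f)" by (rule mono_onI) (auto intro: E_min_mono)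
  moreover have "concave_on {0..} (E_min f)"
    unfolding concave_on_iff by (auto intro: E_min_concave convex_real_interval)
  moreover have "strict_mono_on {q. 0 \<le> q \<and> ereal q \<le> q_star f} (E_min f)"
    by (rule strict_mono_onI) (auto intro: E_min_strict_mono)
  ultimately show ?thesis
    using E_min_nonneg E_min_even E_min_lipschitz E_min_asymptotics E_min_strict_subadditive by blast
qed

end
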